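(* Let $\beta\in\{1,4\}$ and suppose that $\alpha$ is independent of $n$, i.e. $m=n+C$ for some constant $C$. Then the joint cumulants $\kappa^{(\beta)}_{l,k}$ of conductance and shot noise satisfy the following. (i) For $l$ odd and $(l,k)\neq(1,0)$, $$\lim_{n\to\infty}n^{l+k}\kappa^{(\beta)}_{l,k}=\bigl(\delta/2-\alpha\bigr)\bigl(\alpha+\delta/2+2-\beta\bigr)\frac{(k+l-1)!}{\beta(2\beta)^l(4\beta)^k}.$$ (ii) For $l$ even and $(l,k)\notin\{(0,0),(0,1),(0,2),(2,0)\}$, $$\lim_{n\to\infty}n^{l+k-1}\kappa^{(\beta)}_{l,k}=(-1)^k\left(\frac{\beta}{2}-1\right)\frac{(l+k-2)!}{(4\beta)^k(4\beta)^l}\sum_{j=0}^{k}\binom{2j+l}{j+l/2}\binom{k}{j}(-2)^{-j}.$$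
   Context: Let $m\ge n\ge 1$ be integers (numbers of quantum channels in the two leads), $\alpha=\frac{\beta}{2}(m-n+1)-1$, and $\delta$ an integer fixed independently of $n$; the pairs considered are $(\beta,\delta)\in\{(1,0),(2,0),(4,0),(4,2),(2,1),(1,-1),(2,-1)\}$. The random variables $T_1,\dots,T_n\in[0,1]$ have joint density $$\frac{1}{c_n^{(\beta)}}\prod_{j=1}^nT_j^{\alpha}(1-T_j)^{\delta/2}\prod_{1\le j<k\le n}|T_k-T_j|^\beta ,$$ where $c_n^{(\beta)}$ is the normalization constant. The conductance is $G=\sum_jT_j$ and the shot noise is $P=\sum_jT_j(1-T_j)$. The joint moment generating function is $$\mathcal M_n^{(\beta)}(z,w)=\frac1{c_n^{(\beta)}}\int_{[0,1]^n}\prod_{j=1}^nT_j^\alpha(1-T_j)^{\delta/2}\exp\bigl(-zT_j-wT_j(1-T_j)\bigr)\prod_{1\le j<k\le n}|T_k-T_j|^\beta\,dT_1\cdots dT_n,$$ and the joint cumulants $\kappa^{(\beta)}_{l,k}$ ($l,k\ge0$), which depend on $n,\alpha,\delta$, are defined by $$\log\mathcal M_n^{(\beta)}(z,w)=\sum_{l=0}^\infty\sum_{k=0}^\infty\frac{(-1)^{l+k}\kappa^{(\beta)}_{l,k}}{l!\,k!}z^lw^k .$$ *)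

theory Defs
  imports "HOL-Analysis.Analysis"
begin

definition symmetry_pairs :: "(nat \<times> int) set" where
  "symmetry_pairs = {(1, 0), (2, 0), (4, 0), (4, 2), (2, 1), (1, -1), (2, -1)}"

definition channel_exponent :: "nat \<Rightarrow> nat \<Rightarrow> nat \<Rightarrow> real" where
  "channel_exponent \<beta> m n = real \<beta> / 2 * (real m - real n + 1) - 1"

text \<open>
  The transmission eigenvalues \<open>T\<^sub>1, \<dots>, T\<^sub>n\<close> are indexed by \<open>{..<n}\<close>.
  The convention \<open>0 powr a = 0\<close> affects the integrands below only on a null set
  (some \<open>T\<^sub>j \<in> {0, 1}\<close>).
\<close>

definition unnormalized_mgf :: "nat \<Rightarrow> int \<Rightarrow> real \<Rightarrow> nat \<Rightarrow> real \<Rightarrow> real \<Rightarrow> real" where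
  "unnormalized_mgf \<beta> \<delta> \<alpha> n z w =
     (LINT T : (\<Pi>\<^sub>E j\<in>{..<n}. {0..1}) | (\<Pi>\<^sub>M j\<in>{..<n}. lborel).
        (\<Prod>j<n. T j powr \<alpha> * (1 - T j) powr (of_int \<delta> / 2)
                 * exp (- z * T j - w * (T j * (1 - T j))))
        * (\<Prod>k<n. \<Prod>j<k. \<bar>T k - T j\<bar> ^ \<beta>))"

definition normalization_constant :: "nat \<Rightarrow> int \<Rightarrow> real \<Rightarrow> nat \<Rightarrow> real" where
  "normalization_constant \<beta> \<delta> \<alpha> n =
     (LINT T : (\<Pi>\<^sub>E j\<in>{..<n}. {0..1}) | (\<Pi>\<^sub>M j\<in>{..<n}. lborel).
        (\<Prod>j<n. T j powr \<alpha> * (1 - T j) powr (of_int \<delta> / 2))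
        * (\<Prod>k<n. \<Prod>j<k. \<bar>T k - T j\<bar> ^ \<beta>))"

definition joint_mgf :: "nat \<Rightarrow> int \<Rightarrow> real \<Rightarrow> nat \<Rightarrow> real \<Rightarrow> real \<Rightarrow> real" where
  "joint_mgf \<beta> \<delta> \<alpha> n z w =
     unnormalized_mgf \<beta> \<delta> \<alpha> n z w / normalization_constant \<beta> \<delta> \<alpha> n"

text \<open>
  The expansion of \<open>log M(z, w)\<close> is required to hold, with unconditional summation,
  in some real neighbourhood of the origin; this determines the coefficients.
\<close>

definition is_joint_cumulants :: "(real \<Rightarrow> real \<Rightarrow> real) \<Rightarrow> (nat \<Rightarrow> nat \<Rightarrow> real) \<Rightarrow> bool" where
  "is_joint_cumulants M \<kappa> \<longleftrightarrow>
     (\<exists>r>0. \<forall>z w. \<bar>z\<bar> < r \<and> \<bar>w\<bar> < r \<longrightarrow>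
        ((\<lambda>(l, k). (-1) ^ (l + k) * \<kappa> l k / (fact l * fact k) * z ^ l * w ^ k)
           has_sum ln (M z w)) UNIV)"

definition joint_cumulant :: "nat \<Rightarrow> int \<Rightarrow> real \<Rightarrow> nat \<Rightarrow> nat \<Rightarrow> nat \<Rightarrow> real" where
  "joint_cumulant \<beta> \<delta> \<alpha> n = (THE \<kappa>. is_joint_cumulants (joint_mgf \<beta> \<delta> \<alpha> n) \<kappa>)"

end

(* With T = (1 + cos \<theta>) / 2 and x_k = \<Sum>\<^sub>j 2 cos (k \<theta>\<^sub>j) one has G = n / 2 + x_1 / 4 and P = n / 8 - x_2 / 16, so
   that everything reduces to the joint cumulants \<kappa>(x_k, x_m1, ..., x_mr). Integration by parts along
   the vector fields sin (k \<theta>) d/d\<theta> yields loop equations for them. Rescaled by n^(r - 1), they become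
   a recursion whose only non-triangular terms carry negative powers of n, so the rescaled cumulants have
   expansions in powers of 1/n, and comparing coefficients gives linear recursions for the successive
   orders. The order 0 vanishes except for the pairs (x_k, x_k). The order 1 beyond the mean is
   proportional to the coefficient of u^k in the product of the Laurent polynomials u^m + u^-m, which
   vanishes unless k + m1 + ... + mr is even. When this sum is odd, the order 2 is an explicit product.
   The powers of n in the two parts of the theorem select the orders 2 and 1, respectively. *)
theory Submission
  imports Defs "HOL-Library.Landau_Symbols" "HOL-Computational_Algebra.Polynomial"
begin

section \<open>Convolution of functions on lists\<close>

text \<open>A small coefficient does not by itself bound a term that involves a longer list. The
  grading by weight supplies what is missing: with positive indices only finitely many unknowns have
  a given weight, so they can be bounded jointly before any expansion is attempted. To pass from
  moments to cumulants without set partitions, functions on lists are multiplied by splitting the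
  list, which models products of exponential generating functions. A cumulant with a distinguished
  first entry is then a quotient of two moment functions, and a common factor can be cancelled from
  the loop equations. The constant 1/\<beta> - 1/2 in the order 1 compares the derivative of the
  vector field with the pair interaction at coincident points; it vanishes for \<beta> = 2 and
  yields the factor \<beta>/2 - 1. The reflection T -> 1 - T swaps the exponents at 0 and 1 and
  multiplies x_k by (-1)^k; hence cumulants of odd total index are antisymmetric in the two
  exponents, which accounts for the factor \<delta>/2 - \<alpha>.\<close>

fun splits :: "'a list \<Rightarrow> ('a list \<times> 'a list) list" where
  "splits [] = [([], [])]"
| "splits (x # xs) =
     map (\<lambda>(ys, zs). (x # ys, zs)) (splits xs) @ map (\<lambda>(ys, zs). (ys, x # zs)) (splits xs)"

text \<open>A function on lists is read as an exponential generating function in formal variables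
  t_x, its value at \<open>xs\<close> being the mixed derivative at 0 in the listed variables. Under
  this reading \<open>conv\<close> is the product.\<close>

definition conv :: "('a list \<Rightarrow> 'b) \<Rightarrow> ('a list \<Rightarrow> 'b) \<Rightarrow> 'a list \<Rightarrow> 'b :: comm_ring_1" where
  "conv f g xs = (\<Sum>(ys, zs)\<leftarrow>splits xs. f ys * g zs)"

fun picks :: "'a list \<Rightarrow> ('a \<times> 'a list) list" where
  "picks [] = []"
| "picks (x # xs) = (x, xs) # map (\<lambda>(y, ys). (y, x # ys)) (picks xs)"

text \<open>In the same reading: the sum over y of t_y times \<open>G y\<close>. A mixed derivative
  at 0 must hit the variable t_y exactly once, which removes one entry.\<close>

definition pick_sum :: "('a \<Rightarrow> 'a list \<Rightarrow> 'b) \<Rightarrow> 'a list \<Rightarrow> 'b :: comm_ring_1" where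
  "pick_sum G xs = (\<Sum>(y, ys)\<leftarrow>picks xs. G y ys)"

definition conv_unit :: "'a list \<Rightarrow> 'b :: comm_ring_1" where
  "conv_unit xs = (if xs = [] then 1 else 0)"

lemma conv_Nil [simp]: "conv f g [] = f [] * g []"
  by (simp add: conv_def)

text \<open>The Leibniz rule, prefixing an entry being a partial derivative. The ring laws of
  \<open>conv\<close> follow from it by induction on the list, with the functions kept arbitrary
  because prefixing changes them.\<close>

lemma conv_Cons:
  "conv f g (x # xs) = conv (\<lambda>ys. f (x # ys)) g xs + conv f (\<lambda>zs. g (x # zs)) xs"
  by (simp add: conv_def o_def case_prod_unfold)

lemma pick_sum_Nil [simp]: "pick_sum G [] = 0"
  by (simp add: pick_sum_def)

lemma pick_sum_Cons: "pick_sum G (x # xs) = G x xs + pick_sum (\<lambda>y ys. G y (x # ys)) xs"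
  by (simp add: pick_sum_def o_def case_prod_unfold)

lemma splits_cases:
  assumes "(ys, zs) \<in> set (splits xs)"
  shows "length ys + length zs = length xs" and "set ys \<union> set zs = set xs"
proof -
  show "length ys + length zs = length xs"
    using assms by (induction xs arbitrary: ys zs) auto
  show "set ys \<union> set zs = set xs"
    using assms
  proof (induction xs arbitrary: ys zs)
    case (Cons x xs)
    from Cons.prems consider ys' where "ys = x # ys'" "(ys', zs) \<in> set (splits xs)"
      | zs' where "zs = x # zs'" "(ys, zs') \<in> set (splits xs)"
      by auto
    then show ?case
      by cases (use Cons.IH in force)+
  qed simp
qed

lemma splits_sum_list:
  assumes "(ys, zs) \<in> set (splits xs)"
  shows "sum_list ys + sum_list zs = (sum_list xs :: 'a :: comm_monoid_add)"
  using assms by (induction xs arbitrary: ys zs) (auto simp: ac_simps)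

lemma splits_proper:
  assumes "(ys, zs) \<in> set (splits xs)"
  shows "length ys < length xs \<or> ys = xs" and "length zs < length xs \<or> zs = xs"
proof -
  have "(length ys < length xs \<or> ys = xs) \<and> (length zs < length xs \<or> zs = xs)"
    using assms
  proof (induction xs arbitrary: ys zs)
    case (Cons x xs)
    from Cons.prems consider ys' where "ys = x # ys'" "(ys', zs) \<in> set (splits xs)"
      | zs' where "zs = x # zs'" "(ys, zs') \<in> set (splits xs)"
      by auto
    then show ?case
    proof cases
      case 1
      with Cons.IH[OF 1(2)] show ?thesis by auto
    next
      case 2
      with Cons.IH[OF 2(2)] show ?thesis by auto
    qed
  qed simp
  then show "length ys < length xs \<or> ys = xs" and "length zs < length xs \<or> zs = xs"
    by auto
qed

text \<open>Isolates the one split whose left part is the whole list. The other left parts are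
  shorter, which makes division a well-founded recursion.\<close>

lemma splits_eq_Cons: "\<exists>ps. splits xs = (xs, []) # ps \<and> (\<forall>(ys, zs)\<in>set ps. length ys < length xs)"
proof (induction xs)
  case (Cons x xs)
  then obtain ps where "splits xs = (xs, []) # ps" "\<forall>(ys, zs)\<in>set ps. length ys < length xs"
    by blast
  then show ?case
    by auto
qed simp

lemma splits_eq_Cons_tl: "splits xs = (xs, []) # tl (splits xs)"
  using splits_eq_Cons[of xs] by auto

lemma tl_splits_length:
  assumes "(ys, zs) \<in> set (tl (splits xs))"
  shows "length ys < length xs"
  using splits_eq_Cons[of xs] assms by auto

lemma conv_eq_tl: "conv f g xs = f xs * g [] + (\<Sum>(ys, zs)\<leftarrow>tl (splits xs). f ys * g zs)"
  unfolding conv_def by (subst splits_eq_Cons_tl) simp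

lemma picks_cases:
  assumes "(y, ys) \<in> set (picks xs)"
  shows "length xs = Suc (length ys)" and "set xs = insert y (set ys)"
  using assms by (induction xs arbitrary: y ys) auto

lemma picks_sum_list:
  assumes "(y, ys) \<in> set (picks xs)"
  shows "sum_list xs = (y + sum_list ys :: 'a :: comm_monoid_add)"
  using assms by (induction xs arbitrary: y ys) (auto simp: ac_simps)

lemma picks_prod_list:
  assumes "(y, ys) \<in> set (picks xs)"
  shows "prod_list (map f xs) = (f y * prod_list (map f ys) :: 'a :: comm_monoid_mult)"
  using assms by (induction xs arbitrary: y ys) (auto simp: ac_simps)

lemma conv_cong:
  assumes "\<And>ys zs. (ys, zs) \<in> set (splits xs) \<Longrightarrow> f ys * g zs = f' ys * g' zs"
  shows "conv f g xs = conv f' g' xs"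
  unfolding conv_def by (intro arg_cong[of _ _ sum_list] map_cong) (auto simp: assms)

lemma pick_sum_cong:
  assumes "\<And>y ys. (y, ys) \<in> set (picks xs) \<Longrightarrow> G y ys = H y ys"
  shows "pick_sum G xs = pick_sum H xs"
  unfolding pick_sum_def by (intro arg_cong[of _ _ sum_list] map_cong) (auto simp: assms)

lemma pick_sum_const: "pick_sum (\<lambda>y ys. c) xs = of_nat (length xs) * c"
  by (induction xs) (auto simp: pick_sum_Cons algebra_simps)

lemma pick_sum_add: "pick_sum (\<lambda>y ys. G y ys + H y ys) xs = pick_sum G xs + pick_sum H xs"
  by (induction xs arbitrary: G H) (auto simp: pick_sum_Cons algebra_simps)

lemma pick_sum_cmult: "pick_sum (\<lambda>y ys. c * G y ys) xs = c * pick_sum G xs"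
  by (induction xs arbitrary: G) (auto simp: pick_sum_Cons algebra_simps)

lemma pick_sum_uminus: "pick_sum (\<lambda>y ys. - G y ys) xs = - pick_sum G xs"
  by (induction xs arbitrary: G) (auto simp: pick_sum_Cons algebra_simps)

lemma pick_sum_diff: "pick_sum (\<lambda>y ys. G y ys - H y ys) xs = pick_sum G xs - pick_sum H xs"
  by (induction xs arbitrary: G H) (auto simp: pick_sum_Cons algebra_simps)

lemma pick_sum_sum: "pick_sum (\<lambda>y ys. \<Sum>i\<in>I. G i y ys) xs = (\<Sum>i\<in>I. pick_sum (G i) xs)"
  by (induction xs arbitrary: G) (auto simp: pick_sum_Cons sum.distrib)

lemma conv_add_left: "conv (\<lambda>xs. f xs + g xs) h xs = conv f h xs + conv g h xs"
  by (induction xs arbitrary: f g h) (auto simp: conv_Cons algebra_simps)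

lemma conv_cmult_left: "conv (\<lambda>xs. c * f xs) h xs = c * conv f h xs"
  by (induction xs arbitrary: f h) (auto simp: conv_Cons algebra_simps)

lemma conv_commute: "conv f g xs = conv g f xs"
  by (induction xs arbitrary: f g) (auto simp: conv_Cons algebra_simps)

lemma conv_add_right: "conv h (\<lambda>xs. f xs + g xs) xs = conv h f xs + conv h g xs"
  by (subst (1 2 3) conv_commute) (rule conv_add_left)

lemma conv_cmult_right: "conv h (\<lambda>xs. c * f xs) xs = c * conv h f xs"
  by (subst (1 2) conv_commute) (rule conv_cmult_left)

lemma conv_sum_left: "conv (\<lambda>xs. \<Sum>i\<in>I. f i xs) h xs = (\<Sum>i\<in>I. conv (f i) h xs)"
  by (induction xs arbitrary: f h) (auto simp: conv_Cons sum.distrib sum_distrib_right)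

lemma conv_assoc: "conv (conv f g) h xs = conv f (conv g h) xs"
proof (induction xs arbitrary: f g h)
  case (Cons x xs)
  show ?case
    by (simp add: conv_Cons conv_add_left conv_add_right Cons)
qed (simp add: mult.assoc)

lemma conv_zero_left: "conv (\<lambda>_. 0) g xs = 0"
  by (induction xs arbitrary: g) (auto simp: conv_Cons)

lemma conv_unit_left: "conv conv_unit f xs = f xs"
proof (induction xs arbitrary: f)
  case (Cons x xs)
  show ?case
    using Cons by (simp add: conv_Cons conv_unit_def conv_zero_left)
qed (simp add: conv_unit_def)

text \<open>Such an \<open>f\<close> is linear in the formal variables, so multiplication by it can
  only remove one entry.\<close>

lemma conv_singletons:
  assumes "\<And>ys. length ys \<noteq> 1 \<Longrightarrow> f ys = 0"
  shows "conv f g xs = pick_sum (\<lambda>y ys. f [y] * g ys) xs"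
  using assms
proof (induction xs arbitrary: f g)
  case (Cons x xs)
  have "conv (\<lambda>ys. f (x # ys)) g xs = conv (\<lambda>ys. f [x] * conv_unit ys) g xs"
    by (rule conv_cong) (use Cons.prems in \<open>auto simp: conv_unit_def\<close>)
  then show ?case
    by (simp add: conv_Cons pick_sum_Cons conv_cmult_left conv_unit_left Cons)
qed auto

section \<open>Cancellation and division by a function with value 1 at the empty list\<close>

lemma conv_eq_cancel:
  assumes "\<And>xs. conv f m xs = conv g m xs" and "m [] = 1"
  shows "f xs = g xs"
proof (induction xs rule: length_induct)
  case (1 xs)
  have "(\<Sum>(ys, zs)\<leftarrow>tl (splits xs). f ys * m zs) = (\<Sum>(ys, zs)\<leftarrow>tl (splits xs). g ys * m zs)"
    by (intro arg_cong[of _ _ sum_list] map_cong) (use 1 in \<open>auto dest: tl_splits_length\<close>)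
  with assms conv_eq_tl[of f m xs] conv_eq_tl[of g m xs] show ?case
    by simp
qed

text \<open>Power series division: when \<open>m [] = 1\<close>, the extreme split isolates the
  unknown value at \<open>xs\<close> from those at shorter lists.\<close>

function conv_quot :: "('a list \<Rightarrow> 'b) \<Rightarrow> ('a list \<Rightarrow> 'b) \<Rightarrow> 'a list \<Rightarrow> 'b :: comm_ring_1" where
  "conv_quot f m xs = f xs - (\<Sum>(ys, zs)\<leftarrow>tl (splits xs). conv_quot f m ys * m zs)"
  by pat_completeness auto
termination
  by (relation "Wellfounded.measure (\<lambda>(f, m, xs). length xs)") (auto dest: tl_splits_length)

declare conv_quot.simps [simp del]

lemma conv_conv_quot:
  assumes "m [] = 1"
  shows "conv (conv_quot f m) m xs = f xs"
  by (simp add: assms conv_eq_tl conv_quot.simps[of f m xs])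

lemma conv_quot_unique:
  assumes "m [] = 1" and "\<And>xs. conv h m xs = f xs"
  shows "conv_quot f m xs = h xs"
  by (rule conv_eq_cancel[where m = m]) (simp_all add: assms conv_conv_quot)

text \<open>Multiplication by t_y commutes with multiplication by \<open>f\<close>. This pulls the
  moment function out of the sums over removed entries in the loop equations.\<close>

lemma pick_sum_conv: "pick_sum (\<lambda>y ys. conv (G y) f ys) xs = conv (pick_sum G) f xs"
proof (induction xs arbitrary: G f)
  case (Cons x xs)
  have "pick_sum (\<lambda>y ys. conv (G y) f ys) (x # xs) = conv (G x) f xs
      + pick_sum (\<lambda>y ys. conv (\<lambda>zs. G y (x # zs)) f ys) xs
      + pick_sum (\<lambda>y ys. conv (G y) (\<lambda>zs. f (x # zs)) ys) xs"
    by (simp add: pick_sum_Cons conv_Cons pick_sum_add algebra_simps)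
  also have "\<dots> = conv (G x) f xs + conv (pick_sum (\<lambda>y zs. G y (x # zs))) f xs
      + conv (pick_sum G) (\<lambda>zs. f (x # zs)) xs"
    by (simp add: Cons)
  also have "\<dots> = conv (pick_sum G) f (x # xs)"
    by (simp add: conv_Cons pick_sum_Cons conv_add_left)
  finally show ?case .
qed simp

section \<open>Asymptotic expansions in powers of 1/n\<close>

lemma sum_list_in_bigo:
  assumes "\<And>x. x \<in> set xs \<Longrightarrow> (\<lambda>n. f n x) \<in> O[F](h :: _ \<Rightarrow> real)"
  shows "(\<lambda>n. \<Sum>x\<leftarrow>xs. f n x :: real) \<in> O[F](h)"
  using assms by (induction xs) (auto intro: sum_in_bigo)

lemma conv_in_bigo:
  assumes "\<And>ys zs. (ys, zs) \<in> set (splits xs) \<Longrightarrow> (\<lambda>n. f n ys * g n zs) \<in> O[F](h :: _ \<Rightarrow> real)"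
  shows "(\<lambda>n. conv (f n) (g n) xs :: real) \<in> O[F](h)"
  unfolding conv_def by (rule sum_list_in_bigo) (auto simp: assms)

lemma pick_sum_in_bigo:
  assumes "\<And>y ys. (y, ys) \<in> set (picks xs) \<Longrightarrow> (\<lambda>n. G n y ys) \<in> O[F](h :: _ \<Rightarrow> real)"
  shows "(\<lambda>n. pick_sum (G n) xs :: real) \<in> O[F](h)"
  unfolding pick_sum_def by (rule sum_list_in_bigo) (auto simp: assms)

text \<open>Only the coefficients of \<open>p\<close> below \<open>N\<close> are determined. The
  higher ones stay arbitrary, so that products of polynomials need no truncation.\<close>

definition expansion :: "nat \<Rightarrow> (nat \<Rightarrow> real) \<Rightarrow> real poly \<Rightarrow> bool" where
  "expansion N f p \<longleftrightarrow> (\<lambda>n. f n - poly p (1 / real n)) \<in> O(\<lambda>n. (1 / real n) ^ N)"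

lemma inverse_power_bigo: "N \<le> M \<Longrightarrow> (\<lambda>n. (1 / real n) ^ M) \<in> O(\<lambda>n. (1 / real n) ^ N)"
  by (rule bigoI[where c = 1]) (auto simp: eventually_sequentially intro!: exI[of _ 1] power_decreasing)

lemma poly_inverse_tendsto: "(\<lambda>n. poly p (1 / real n)) \<longlonglongrightarrow> coeff p 0"
proof -
  have "(\<lambda>n. poly p (1 / real n)) \<longlonglongrightarrow> poly p 0"
    by (intro isCont_tendsto_compose[OF poly_isCont] lim_1_over_n)
  then show ?thesis
    by (simp add: poly_0_coeff_0)
qed

lemma poly_inverse_bigo: "(\<lambda>n. poly p (1 / real n)) \<in> O(\<lambda>_. 1)"
proof -
  obtain K where "\<forall>n. norm (poly p (1 / real n)) \<le> K"
    using convergent_imp_Bseq[OF convergentI[OF poly_inverse_tendsto[of p]]] by (auto simp: Bseq_def)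
  then show ?thesis
    by (intro bigoI[where c = K]) simp
qed

lemma expansion_bounded: "expansion 0 f p \<Longrightarrow> f \<in> O(\<lambda>_. 1)"
  unfolding expansion_def using sum_in_bigo(1)[OF _ poly_inverse_bigo[of p], of "\<lambda>n. f n - poly p (1 / real n)"]
  by simp

lemma expansion_0: "f \<in> O(\<lambda>_. 1) \<Longrightarrow> expansion 0 f p"
  unfolding expansion_def by (auto intro: sum_in_bigo poly_inverse_bigo)

lemma expansion_mono: "expansion N f p \<Longrightarrow> M \<le> N \<Longrightarrow> expansion M f p"
  unfolding expansion_def by (rule landau_o.big_trans[OF _ inverse_power_bigo])

lemma expansion_const: "expansion N (\<lambda>_. c) [:c:]"
  by (simp add: expansion_def)

lemma expansion_add:
  assumes "expansion N f p" "expansion N g q"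
  shows "expansion N (\<lambda>n. f n + g n) (p + q)"
  using sum_in_bigo(1)[OF assms[unfolded expansion_def]] by (simp add: expansion_def algebra_simps)

lemma expansion_cmult:
  assumes "expansion N f p"
  shows "expansion N (\<lambda>n. c * f n) (smult c p)"
proof -
  have "(\<lambda>n. c * (f n - poly p (1 / real n))) \<in> O(\<lambda>n. (1 / real n) ^ N)"
    using assms by (cases "c = 0") (auto simp: expansion_def)
  then show ?thesis
    by (simp add: expansion_def algebra_simps)
qed

lemma expansion_diff:
  assumes "expansion N f p" "expansion N g q"
  shows "expansion N (\<lambda>n. f n - g n) (p - q)"
  using sum_in_bigo(2)[OF assms[unfolded expansion_def]] by (simp add: expansion_def algebra_simps)

lemma expansion_mult:
  assumes f: "expansion N f p" and g: "expansion N g q"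
  shows "expansion N (\<lambda>n. f n * g n) (p * q)"
proof -
  have "(\<lambda>n. (f n - poly p (1 / real n)) * g n) \<in> O(\<lambda>n. (1 / real n) ^ N * 1)"
    by (rule landau_o.big.mult[OF f[unfolded expansion_def] expansion_bounded[OF expansion_mono[OF g]]]) simp
  moreover have "(\<lambda>n. poly p (1 / real n) * (g n - poly q (1 / real n))) \<in> O(\<lambda>n. 1 * (1 / real n) ^ N)"
    by (rule landau_o.big.mult[OF poly_inverse_bigo g[unfolded expansion_def]])
  ultimately have "(\<lambda>n. (f n - poly p (1 / real n)) * g n + poly p (1 / real n) * (g n - poly q (1 / real n)))
      \<in> O(\<lambda>n. (1 / real n) ^ N)"
    by (intro sum_in_bigo) simp_all
  then show ?thesis
    by (simp add: expansion_def algebra_simps)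
qed

text \<open>The order gained from the factor 1/n is what drives the induction on the order:
  non-triangular terms need to be known only to the previous order.\<close>

lemma expansion_shift:
  assumes "expansion N f p"
  shows "expansion (Suc N) (\<lambda>n. 1 / real n * f n) (pCons 0 p)"
proof -
  have "(\<lambda>n. 1 / real n * (f n - poly p (1 / real n))) \<in> O(\<lambda>n. 1 / real n * (1 / real n) ^ N)"
    by (rule landau_o.big.mult) (use assms in \<open>auto simp: expansion_def\<close>)
  then show ?thesis
    by (simp add: expansion_def algebra_simps)
qed

lemma expansion_mult_inverse: "expansion N f p \<Longrightarrow> expansion N (\<lambda>n. 1 / real n * f n) (pCons 0 p)"
  by (rule expansion_mono[OF expansion_shift]) auto

lemma expansion_sum:
  assumes "\<And>i. i \<in> I \<Longrightarrow> expansion N (\<lambda>n. f n i) (p i)"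
  shows "expansion N (\<lambda>n. \<Sum>i\<in>I. f n i) (\<Sum>i\<in>I. p i)"
  using big_sum_in_bigo[of I "\<lambda>i n. f n i - poly (p i) (1 / real n)"] assms
  by (simp add: expansion_def sum_subtractf poly_sum)

lemma expansion_sum_list:
  assumes "\<And>x. x \<in> set xs \<Longrightarrow> expansion N (\<lambda>n. f n x) (p x)"
  shows "expansion N (\<lambda>n. \<Sum>x\<leftarrow>xs. f n x) (\<Sum>x\<leftarrow>xs. p x)"
  using assms
proof (induction xs)
  case Nil
  then show ?case using expansion_const[of N 0] by simp
qed (auto intro: expansion_add)

lemma expansion_conv:
  assumes "\<And>ys zs. (ys, zs) \<in> set (splits xs) \<Longrightarrow> expansion N (\<lambda>n. f n ys) (p ys)"
    and "\<And>ys zs. (ys, zs) \<in> set (splits xs) \<Longrightarrow> expansion N (\<lambda>n. g n zs) (q zs)"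
  shows "expansion N (\<lambda>n. conv (f n) (g n) xs) (conv p q xs)"
proof -
  have "expansion N (\<lambda>n. \<Sum>x\<leftarrow>splits xs. f n (fst x) * g n (snd x)) (\<Sum>x\<leftarrow>splits xs. p (fst x) * q (snd x))"
    by (rule expansion_sum_list, rule expansion_mult) (use assms in auto)
  then show ?thesis
    by (simp add: conv_def case_prod_unfold)
qed

lemma expansion_pick_sum:
  assumes "\<And>y ys. (y, ys) \<in> set (picks xs) \<Longrightarrow> expansion N (\<lambda>n. G n y ys) (p y ys)"
  shows "expansion N (\<lambda>n. pick_sum (G n) xs) (pick_sum p xs)"
proof -
  have "expansion N (\<lambda>n. \<Sum>x\<leftarrow>picks xs. G n (fst x) (snd x)) (\<Sum>x\<leftarrow>picks xs. p (fst x) (snd x))"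
    by (rule expansion_sum_list) (use assms in auto)
  then show ?thesis
    by (simp add: pick_sum_def case_prod_unfold)
qed

lemma expansion_cong:
  assumes "expansion N f p" and "\<And>n. n \<ge> 1 \<Longrightarrow> f n = g n"
  shows "expansion N g p"
proof -
  have "(\<lambda>n. f n - poly p (1 / real n)) \<in> O(\<lambda>n. (1 / real n) ^ N) \<longleftrightarrow>
      (\<lambda>n. g n - poly p (1 / real n)) \<in> O(\<lambda>n. (1 / real n) ^ N)"
    using assms(2) by (intro landau_o.big.in_cong) (auto simp: eventually_sequentially intro!: exI[of _ 1])
  with assms(1) show ?thesis
    by (simp add: expansion_def)
qed

text \<open>The constant term is a limit and hence 0; multiplication by n then reduces to the next
  lower order. This turns an asymptotic identity into identities between coefficients.\<close>

lemma expansion_zero_coeff: "expansion N (\<lambda>_. 0) p \<Longrightarrow> j < N \<Longrightarrow> coeff p j = 0"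
proof (induction N arbitrary: p j)
  case (Suc N)
  obtain c q where p: "p = pCons c q"
    by (cases p)
  have O: "(\<lambda>n. poly p (1 / real n)) \<in> O(\<lambda>n. (1 / real n) ^ Suc N)"
    using Suc.prems by (simp add: expansion_def)
  have "(\<lambda>n. poly p (1 / real n)) \<longlonglongrightarrow> 0"
  proof -
    have "(\<lambda>n. poly p (1 / real n)) \<in> O(\<lambda>n. (1 / real n) ^ 1)"
      by (rule landau_o.big_trans[OF O inverse_power_bigo]) simp
    then obtain C where "\<forall>\<^sub>F n in sequentially. norm (poly p (1 / real n)) \<le> C * norm ((1 / real n) ^ 1)"
      by (auto simp: bigo_def)
    moreover have "(\<lambda>n. C * norm ((1 / real n) ^ 1)) \<longlonglongrightarrow> 0"
      using tendsto_mult_right[OF lim_1_over_n, of C] by simp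
    ultimately show ?thesis
      by (rule Lim_null_comparison)
  qed
  then have c: "c = 0"
    using LIMSEQ_unique[OF poly_inverse_tendsto[of p]] by (simp add: p)
  have "(\<lambda>n. real n * poly p (1 / real n)) \<in> O(\<lambda>n. real n * (1 / real n) ^ Suc N)"
    by (rule landau_o.big.mult[OF _ O]) simp
  also have "(\<lambda>n. real n * (1 / real n) ^ Suc N) \<in> O(\<lambda>n. (1 / real n) ^ N)"
    by (rule bigoI[where c = 1]) (auto simp: eventually_sequentially intro!: exI[of _ 1])
  finally have "(\<lambda>n. real n * poly p (1 / real n)) \<in> O(\<lambda>n. (1 / real n) ^ N)" .
  also have "?this \<longleftrightarrow> (\<lambda>n. 0 - poly q (1 / real n)) \<in> O(\<lambda>n. (1 / real n) ^ N)"
    by (subst landau_o.big.in_cong[where g = "\<lambda>n. poly q (1 / real n)"])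
      (auto simp: eventually_sequentially p c intro!: exI[of _ 1])
  finally have "expansion N (\<lambda>_. 0) q"
    by (simp only: expansion_def)
  with Suc.IH[OF this] Suc.prems(2) show ?case
    by (auto simp: p c coeff_pCons split: nat.splits)
qed simp

lemma coeff_conv: "coeff (conv p q xs) j = (\<Sum>i\<le>j. conv (\<lambda>ys. coeff (p ys) i) (\<lambda>zs. coeff (q zs) (j - i)) xs)"
  by (induction xs arbitrary: p q) (auto simp: conv_Cons coeff_mult sum.distrib)

lemma coeff_pick_sum: "coeff (pick_sum G xs) j = pick_sum (\<lambda>y ys. coeff (G y ys) j) xs"
  by (induction xs arbitrary: G) (auto simp: pick_sum_Cons)

lemma expansion_tendsto:
  assumes "expansion (Suc N) f p" and "\<And>j. j < N \<Longrightarrow> coeff p j = 0"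
  shows "(\<lambda>n. real n ^ N * f n) \<longlonglongrightarrow> coeff p N"
  using assms
proof (induction N arbitrary: f p)
  case 0
  then have "(\<lambda>n. f n - poly p (1 / real n)) \<in> O(\<lambda>n. 1 / real n)"
    by (simp add: expansion_def)
  then obtain C where "\<forall>\<^sub>F n in sequentially. norm (f n - poly p (1 / real n)) \<le> C * norm (1 / real n)"
    by (auto simp: bigo_def)
  moreover have "(\<lambda>n. C * norm (1 / real n)) \<longlonglongrightarrow> 0"
    using tendsto_mult_right[OF lim_1_over_n, of C] by simp
  ultimately have "(\<lambda>n. f n - poly p (1 / real n)) \<longlonglongrightarrow> 0"
    by (rule Lim_null_comparison)
  from tendsto_add[OF this poly_inverse_tendsto[of p]] show ?case
    by simp
next
  case (Suc N)
  obtain q where p: "p = pCons 0 q"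
    using Suc.prems(2)[of 0] by (cases p) auto
  have "(\<lambda>n. real n * (f n - poly p (1 / real n))) \<in> O(\<lambda>n. real n * (1 / real n) ^ Suc (Suc N))"
    by (rule landau_o.big.mult) (use Suc.prems in \<open>auto simp: expansion_def\<close>)
  also have "(\<lambda>n. real n * (1 / real n) ^ Suc (Suc N)) \<in> O(\<lambda>n. (1 / real n) ^ Suc N)"
    by (rule bigoI[where c = 1]) (auto simp: eventually_sequentially intro!: exI[of _ 1])
  finally have "(\<lambda>n. real n * (f n - poly p (1 / real n))) \<in> O(\<lambda>n. (1 / real n) ^ Suc N)" .
  also have "?this \<longleftrightarrow> (\<lambda>n. real n * f n - poly q (1 / real n)) \<in> O(\<lambda>n. (1 / real n) ^ Suc N)"
    by (rule landau_o.big.in_cong)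
      (auto simp: eventually_sequentially p algebra_simps intro!: exI[of _ 1])
  finally have "expansion (Suc N) (\<lambda>n. real n * f n) q"
    by (simp only: expansion_def)
  from Suc.IH[OF this] Suc.prems(2)[of "Suc _"] show ?case
    by (simp add: p mult_ac)
qed

section \<open>The recursion for scaled cumulants\<close>

text \<open>\<open>Q n k xs\<close> models the rescaled cumulant of x_k with the entries of
  \<open>xs\<close>; \<open>Q_0\<close> reflects that x_0 is the constant 2n. With truncated
  subtraction, \<open>(k - m) + (m - k)\<close> is the distance between k and m. Entries are kept
  positive so that the weight controls the length.\<close>

locale cumulant_hierarchy =
  fixes Q :: "nat \<Rightarrow> nat \<Rightarrow> nat list \<Rightarrow> real" and \<beta> \<rho> g :: real and \<gamma> :: "nat \<Rightarrow> real"
  assumes Q_0: "\<And>n. n \<ge> 1 \<Longrightarrow> Q n 0 = (\<lambda>xs. 2 * conv_unit xs)"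
    and recursion: "\<And>n k xs. n \<ge> 1 \<Longrightarrow> k \<ge> 1 \<Longrightarrow> 0 \<notin> set xs \<Longrightarrow>
      Q n k xs
      + 1 / 2 * (\<Sum>a\<in>{1..<k}. 1 / real n * (1 / real n * Q n a ((k - a) # xs)) + conv (Q n a) (Q n (k - a)) xs)
      + 1 / real n * ((real k * \<rho> - g) * Q n k xs
          - 2 * (\<Sum>j\<in>{1..<k}. \<gamma> (k - j) * Q n j xs) - \<gamma> k * Q n 0 xs)
      - pick_sum (\<lambda>m ys. real m / \<beta> * (Q n ((k - m) + (m - k)) ys - Q n (k + m) ys)) xs = 0"
begin

lemma Q_0_bounded: "(\<lambda>n. Q n 0 xs) \<in> O(\<lambda>_. 1)"
proof -
  have "(\<lambda>n. Q n 0 xs) \<in> O(\<lambda>_. 1) \<longleftrightarrow> (\<lambda>n. 2 * conv_unit xs :: real) \<in> O(\<lambda>_::nat. 1 :: real)"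
    by (rule landau_o.big.in_cong) (auto simp: eventually_sequentially Q_0 intro!: exI[of _ 1])
  then show ?thesis by simp
qed

lemma Q_eq:
  assumes "n \<ge> 1" "k \<ge> 1" "0 \<notin> set xs"
  shows "Q n k xs = pick_sum (\<lambda>m ys. real m / \<beta> * (Q n ((k - m) + (m - k)) ys - Q n (k + m) ys)) xs
    - 1 / 2 * (\<Sum>a\<in>{1..<k}. 1 / real n * (1 / real n * Q n a ((k - a) # xs)) + conv (Q n a) (Q n (k - a)) xs)
    - 1 / real n * ((real k * \<rho> - g) * Q n k xs
          - 2 * (\<Sum>j\<in>{1..<k}. \<gamma> (k - j) * Q n j xs) - \<gamma> k * Q n 0 xs)"
  using recursion[OF assms] by linarith

text \<open>The recursion preserves the weight \<open>k + sum_list xs\<close> up to lower weights. At a fixed weight the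
  terms that raise the length of \<open>xs\<close> carry a negative power of \<open>n\<close>, so that all unknowns of that
  weight are controlled by an induction on the length and an absorption argument.\<close>

lemma Q_bounded:
  assumes "0 \<notin> set xs"
  shows "(\<lambda>n. Q n k xs) \<in> O(\<lambda>_. 1)"
  using assms
proof (induction "k + sum_list xs" arbitrary: k xs rule: less_induct)
  case (less k0 xs0)
  define w where "w = k0 + sum_list xs0"
  have low: "(\<lambda>n. Q n k xs) \<in> O(\<lambda>_. 1)" if "0 \<notin> set xs" "k + sum_list xs < w" for k xs
    using less.hyps that by (simp add: w_def)
  \<comment> \<open>All unknowns of the weight \<open>w\<close>; positive entries bound the length
    by the weight, so \<open>S\<close> is finite.\<close>
  define S where "S = {(k, xs). 0 < k \<and> 0 \<notin> set xs \<and> k + sum_list xs = w}"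
  define X where "X n = (\<Sum>(k, xs)\<in>S. \<bar>Q n k xs\<bar>)" for n
  \<comment> \<open>Each unknown of this weight is shown to be O(Y): the terms out of reach of both
    inductions carry at least one factor 1/n and are absorbed into X/n.\<close>
  define Y where "Y n = 1 + 1 / real n * X n" for n
  have len: "length xs \<le> sum_list xs" if "0 \<notin> set xs" for xs :: "nat list"
    using that by (induction xs) auto
  have "S \<subseteq> {..w} \<times> {xs. set xs \<subseteq> {..w} \<and> length xs \<le> w}"
  proof
    fix p assume "p \<in> S"
    then obtain k xs where p: "p = (k, xs)" "0 \<notin> set xs" "k + sum_list xs = w"
      by (auto simp: S_def)
    have "x \<le> w" if "x \<in> set xs" for x
      using p member_le_sum_list[of x xs] that by auto
    then show "p \<in> {..w} \<times> {xs. set xs \<subseteq> {..w} \<and> length xs \<le> w}"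
      using p len[of xs] by auto
  qed
  then have fin: "finite S"
    by (rule finite_subset) (simp add: finite_lists_length_le)
  have X_nonneg: "X n \<ge> 0" for n
    unfolding X_def by (auto intro: sum_nonneg)
  have Y_pos: "Y n \<ge> 1" for n
    using X_nonneg[of n] by (simp add: Y_def)
  have one_Y: "(\<lambda>_. 1) \<in> O(Y)"
    by (rule bigoI[where c = 1]) (simp add: abs_of_nonneg[OF order_trans[OF zero_le_one Y_pos]] Y_pos)
  have lowY: "(\<lambda>n. Q n k xs) \<in> O(Y)" if "0 \<notin> set xs" "k + sum_list xs < w" for k xs
    by (rule landau_o.big_trans[OF low[OF that] one_Y])
  have small: "(\<lambda>n. 1 / real n * Q n k xs) \<in> O(Y)" if "0 \<notin> set xs" "k + sum_list xs \<le> w" for k xs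
  proof (cases "k + sum_list xs < w \<or> k = 0")
    case True
    then have Q1: "(\<lambda>n. Q n k xs) \<in> O(\<lambda>_. 1)"
      using low[OF that(1)] Q_0_bounded by auto
    have "(\<lambda>n. 1 / real n * Q n k xs) \<in> O(\<lambda>n. 1 * 1)"
      by (intro landau_o.big.mult Q1) (use inverse_power_bigo[of 0 1] in simp)
    then have "(\<lambda>n. 1 / real n * Q n k xs) \<in> O(\<lambda>_. 1)"
      by simp
    then show ?thesis
      using one_Y by (rule landau_o.big_trans)
  next
    case False
    then have S: "(k, xs) \<in> S"
      using that by (auto simp: S_def)
    have "\<bar>Q n k xs\<bar> \<le> X n" for n
      unfolding X_def using member_le_sum[of "(k, xs)" S "\<lambda>(k, xs). \<bar>Q n k xs\<bar>"] S fin by auto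
    then have "\<bar>1 / real n * Q n k xs\<bar> \<le> Y n" for n
      unfolding Y_def abs_mult
      by (intro order_trans[OF mult_left_mono[of "\<bar>Q n k xs\<bar>" "X n"]]) auto
    then show ?thesis
      by (intro bigoI[where c = 1]) (use Y_pos in \<open>auto intro!: always_eventually order_trans[OF _ abs_ge_self]\<close>)
  qed
  have small2: "(\<lambda>n. 1 / real n * (1 / real n * Q n k xs)) \<in> O(Y)"
    if "0 \<notin> set xs" "k + sum_list xs \<le> w" for k xs
  proof -
    have "(\<lambda>n. 1 / real n * (1 / real n * Q n k xs)) \<in> O(\<lambda>n. 1 * Y n)"
      by (intro landau_o.big.mult small that) (use inverse_power_bigo[of 0 1] in simp)
    then show ?thesis by simp
  qed
  have QY: "(\<lambda>n. Q n k xs) \<in> O(Y)" if "(k, xs) \<in> S" for k xs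
    using that
  proof (induction "length xs" arbitrary: k xs rule: less_induct)
    case (less xs k)
    from less.prems have k: "k \<ge> 1" and xs: "0 \<notin> set xs" and kxs: "k + sum_list xs = w"
      by (auto simp: S_def)
    have cY: "(\<lambda>n. c * f n) \<in> O(Y)" if "f \<in> O(Y)" for c and f :: "nat \<Rightarrow> real"
      using that by (cases "c = 0") auto
    have t1: "(\<lambda>n. pick_sum (\<lambda>m ys. real m / \<beta> * (Q n ((k - m) + (m - k)) ys - Q n (k + m) ys)) xs) \<in> O(Y)"
    proof (rule pick_sum_in_bigo)
      fix m ys assume p: "(m, ys) \<in> set (picks xs)"
      note pc = picks_cases[OF p] picks_sum_list[OF p]
      have ys: "0 \<notin> set ys" "m > 0"
        using xs pc(2) by (auto intro: Suc_leI)
      \<comment> \<open>As k and m are positive, their distance is smaller than k + m and the weight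
        drops. The term with k + m keeps the weight but has a shorter list.\<close>
      have "(\<lambda>n. Q n ((k - m) + (m - k)) ys) \<in> O(Y)"
        by (rule lowY) (use ys k kxs pc(3) in auto)
      moreover have "(\<lambda>n. Q n (k + m) ys) \<in> O(Y)"
        by (rule less.hyps) (use ys k kxs pc in \<open>auto simp: S_def\<close>)
      ultimately show "(\<lambda>n. real m / \<beta> * (Q n ((k - m) + (m - k)) ys - Q n (k + m) ys)) \<in> O(Y)"
        by (intro cY sum_in_bigo)
    qed
    have t2: "(\<lambda>n. conv (Q n a) (Q n (k - a)) xs) \<in> O(Y)" if a: "a \<in> {1..<k}" for a
    proof (rule conv_in_bigo)
      fix ys zs assume p: "(ys, zs) \<in> set (splits xs)"
      note pc = splits_cases[OF p] splits_sum_list[OF p]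
      have "(\<lambda>n. Q n a ys * Q n (k - a) zs) \<in> O(\<lambda>n. 1 * 1)"
        by (intro landau_o.big.mult low) (use a xs kxs pc in auto)
      then show "(\<lambda>n. Q n a ys * Q n (k - a) zs) \<in> O(Y)"
        using one_Y by (auto intro: landau_o.big_trans)
    qed
    have t3: "(\<lambda>n. 1 / real n * ((real k * \<rho> - g) * Q n k xs
          - 2 * (\<Sum>j\<in>{1..<k}. \<gamma> (k - j) * Q n j xs) - \<gamma> k * Q n 0 xs)) \<in> O(Y)"
    proof -
      have "(\<lambda>n. (real k * \<rho> - g) * (1 / real n * Q n k xs)
          - 2 * (\<Sum>j\<in>{1..<k}. \<gamma> (k - j) * (1 / real n * Q n j xs)) - \<gamma> k * (1 / real n * Q n 0 xs)) \<in> O(Y)"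
        by (intro sum_in_bigo cY big_sum_in_bigo small) (use xs kxs in auto)
      then show ?thesis
        by (simp add: algebra_simps sum_distrib_left sum_divide_distrib diff_divide_distrib)
    qed
    have "(\<lambda>n. pick_sum (\<lambda>m ys. real m / \<beta> * (Q n ((k - m) + (m - k)) ys - Q n (k + m) ys)) xs
    - 1 / 2 * (\<Sum>a\<in>{1..<k}. 1 / real n * (1 / real n * Q n a ((k - a) # xs)) + conv (Q n a) (Q n (k - a)) xs)
    - 1 / real n * ((real k * \<rho> - g) * Q n k xs
          - 2 * (\<Sum>j\<in>{1..<k}. \<gamma> (k - j) * Q n j xs) - \<gamma> k * Q n 0 xs)) \<in> O(Y)"
      by (intro sum_in_bigo cY big_sum_in_bigo t1 t2 t3 small2) (use k xs kxs in auto)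
    also have "?this \<longleftrightarrow> (\<lambda>n. Q n k xs) \<in> O(Y)"
      by (rule landau_o.big.in_cong, rule eventually_mono[OF eventually_ge_at_top[of 1]], rule Q_eq[symmetric])
        (use k xs in auto)
    finally show ?case .
  qed
  have "X \<in> O(Y)"
    unfolding X_def by (rule big_sum_in_bigo) (use QY in \<open>auto simp: case_prod_unfold\<close>)
  then obtain c where c: "c > 0" "\<forall>\<^sub>F n in sequentially. norm (X n) \<le> c * norm (Y n)"
    by (auto simp: bigo_def)
  have "X \<in> O(\<lambda>_. 1)"
  proof (rule bigoI[where c = "2 * c"])
    have "\<forall>\<^sub>F n in sequentially. real n \<ge> 2 * c"
      using filterlim_real_sequentially by (auto simp: filterlim_at_top)
    with c(2) show "\<forall>\<^sub>F n in sequentially. norm (X n) \<le> 2 * c * norm (1 :: real)"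
    proof eventually_elim
      case (elim n)
      have n: "real n > 0"
        using elim c(1) by linarith
      \<comment> \<open>Absorption: X is at most c + c X / n, and for n at least 2c the last term is
        at most X / 2.\<close>
      have "c * X n / real n \<le> X n / 2"
        using mult_right_mono[of "2 * c" "real n" "X n"] elim(2) n X_nonneg[of n] by (simp add: field_simps)
      moreover have "X n \<le> c + c * X n / real n"
        using elim(1) X_nonneg[of n] Y_pos[of n] by (simp add: Y_def algebra_simps)
      ultimately have "X n \<le> 2 * c"
        by linarith
      then show ?case
        using X_nonneg[of n] by simp
    qed
  qed
  note X1 = this
  have Y1: "Y \<in> O(\<lambda>_. 1)"
  proof -
    have "(\<lambda>n. 1 / real n * X n) \<in> O(\<lambda>n. 1 * 1)"
      by (intro landau_o.big.mult X1) (use inverse_power_bigo[of 0 1] in simp)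
    then show ?thesis
      unfolding Y_def by (intro sum_in_bigo) auto
  qed
  show ?case
  proof (cases "k0 = 0")
    case False
    then have "(k0, xs0) \<in> S"
      using less.prems by (simp add: S_def w_def)
    from landau_o.big_trans[OF QY[OF this] Y1] show ?thesis .
  qed (simp add: Q_0_bounded)
qed

text \<open>Induction on the order, then the length, then k. Terms with a factor 1/n, among them the
  one with a longer list and the one with the same unknown, use the previous order
  \<open>P0\<close>; all others have a shorter list, or the same list with a smaller index.\<close>

lemma Q_expansion:
  assumes "0 \<notin> set xs"
  shows "\<exists>p. expansion N (\<lambda>n. Q n k xs) p"
  using assms
proof (induction N arbitrary: k xs)
  case 0
  then show ?case
    using expansion_0[OF Q_bounded] by blast
next
  case (Suc N)
  define P0 where "P0 k xs = (SOME p. expansion N (\<lambda>n. Q n k xs) p)" for k xs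
  have P0: "expansion N (\<lambda>n. Q n k xs) (P0 k xs)" if "0 \<notin> set xs" for k xs
    unfolding P0_def by (rule someI_ex, rule Suc.IH[OF that])
  define P where "P k xs = (SOME p. expansion (Suc N) (\<lambda>n. Q n k xs) p)" for k xs
  show ?case
    using Suc.prems
  proof (induction "length xs" arbitrary: k xs rule: less_induct)
    case (less xs)
    show ?case
      using less.prems
    proof (induction k rule: less_induct)
      case (less k)
      have P: "expansion (Suc N) (\<lambda>n. Q n a ys) (P a ys)"
        if "0 \<notin> set ys" "length ys < length xs \<or> ys = xs \<and> a < k" for a ys
        unfolding P_def
        by (rule someI_ex)
          (use that less.IH[of a] \<open>\<And>ys a. length ys < length xs \<Longrightarrow> 0 \<notin> set ys \<Longrightarrow> \<exists>p. expansion (Suc N) (\<lambda>n. Q n a ys) p\<close>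
            in \<open>auto\<close>)
      show ?case
      proof (cases "k = 0")
        case True
        show ?thesis
          by (rule exI, rule expansion_cong[OF expansion_const[of _ "2 * conv_unit xs"]])
            (simp add: True Q_0)
      next
        case False
        have c: "expansion (Suc N) (\<lambda>n. conv (Q n a) (Q n (k - a)) xs) (conv (P a) (P (k - a)) xs)"
          if "a \<in> {1..<k}" for a
        proof (rule expansion_conv)
          fix ys zs assume p: "(ys, zs) \<in> set (splits xs)"
          have nz: "0 \<notin> set ys" "0 \<notin> set zs"
            using splits_cases(2)[OF p] less.prems by auto
          show "expansion (Suc N) (\<lambda>n. Q n a ys) (P a ys)"
            by (rule P) (use nz that splits_proper[OF p] in auto)
          show "expansion (Suc N) (\<lambda>n. Q n (k - a) zs) (P (k - a) zs)"
            by (rule P) (use nz that splits_proper[OF p] in auto)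
        qed
        have t2: "expansion (Suc N)
            (\<lambda>n. \<Sum>a\<in>{1..<k}. 1 / real n * (1 / real n * Q n a ((k - a) # xs)) + conv (Q n a) (Q n (k - a)) xs)
            (\<Sum>a\<in>{1..<k}. pCons 0 (pCons 0 (P0 a ((k - a) # xs))) + conv (P a) (P (k - a)) xs)"
          by (intro expansion_sum expansion_add c expansion_shift expansion_mono[OF expansion_shift[OF P0]])
            (use less.prems in auto)
        have t3: "expansion (Suc N) (\<lambda>n. 1 / real n * ((real k * \<rho> - g) * Q n k xs
          - 2 * (\<Sum>j\<in>{1..<k}. \<gamma> (k - j) * Q n j xs) - \<gamma> k * Q n 0 xs))
          (pCons 0 (smult (real k * \<rho> - g) (P0 k xs)
          - smult 2 (\<Sum>j\<in>{1..<k}. smult (\<gamma> (k - j)) (P0 j xs)) - smult (\<gamma> k) (P0 0 xs)))"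
          by (intro expansion_shift expansion_diff expansion_cmult expansion_sum P0 less.prems)
        have t1: "expansion (Suc N)
            (\<lambda>n. pick_sum (\<lambda>m ys. real m / \<beta> * (Q n ((k - m) + (m - k)) ys - Q n (k + m) ys)) xs)
            (pick_sum (\<lambda>m ys. smult (real m / \<beta>) (P ((k - m) + (m - k)) ys - P (k + m) ys)) xs)"
        proof (intro expansion_pick_sum expansion_cmult expansion_diff)
          fix m ys assume p: "(m, ys) \<in> set (picks xs)"
          have "0 \<notin> set ys" "length ys < length xs"
            using picks_cases[OF p] less.prems by auto
          then show "expansion (Suc N) (\<lambda>n. Q n ((k - m) + (m - k)) ys) (P ((k - m) + (m - k)) ys)"
              "expansion (Suc N) (\<lambda>n. Q n (k + m) ys) (P (k + m) ys)"
            by (auto intro: P)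
        qed
        show ?thesis
          by (rule exI, rule expansion_cong[OF expansion_diff[OF expansion_diff[OF t1 expansion_cmult[OF t2, of "1 / 2"]] t3]])
            (rule Q_eq[symmetric], use False less.prems in auto)
      qed
    qed
  qed
qed

end

section \<open>Solution of the recursion to second order\<close>

text \<open>\<open>coeff_Laurent k xs\<close> is the coefficient of \<open>u\<^sup>k\<close> in the product of the Laurent polynomials
  \<open>u\<^sup>m + u\<^sup>-\<^sup>m\<close> over the entries \<open>m\<close> of \<open>xs\<close>.\<close>

fun coeff_Laurent :: "int \<Rightarrow> nat list \<Rightarrow> real" where
  "coeff_Laurent k [] = (if k = 0 then 1 else 0)"
| "coeff_Laurent k (m # xs) = coeff_Laurent (k - int m) xs + coeff_Laurent (k + int m) xs"

lemma coeff_Laurent_minus: "coeff_Laurent (- k) xs = coeff_Laurent k xs"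
proof (induction xs arbitrary: k)
  case (Cons m xs)
  have "- k - int m = - (k + int m)" "- k + int m = - (k - int m)"
    by auto
  with Cons show ?case
    by (metis add.commute coeff_Laurent.simps(2))
qed simp

lemma coeff_Laurent_parity: "odd (k + int (sum_list xs)) \<Longrightarrow> coeff_Laurent k xs = 0"
proof (induction xs arbitrary: k)
  case (Cons m xs)
  then have "odd (k - int m + int (sum_list xs))" "odd (k + int m + int (sum_list xs))"
    by auto
  with Cons.IH show ?case
    by simp
qed (auto split: if_splits)

text \<open>Restoring the removed factor u^m + u^-m gives the coefficient of the whole product, once
  for each entry.\<close>

lemma coeff_Laurent_pick_sum:
  "pick_sum (\<lambda>m ys. coeff_Laurent (k + int m) ys + coeff_Laurent (k - int m) ys) xs
     = real (length xs) * coeff_Laurent k xs"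
proof (induction xs arbitrary: k)
  case (Cons x xs)
  have "pick_sum (\<lambda>m ys. coeff_Laurent (k + int m) (x # ys) + coeff_Laurent (k - int m) (x # ys)) xs
      = pick_sum (\<lambda>m ys. (coeff_Laurent (k - int x + int m) ys + coeff_Laurent (k - int x - int m) ys)
          + (coeff_Laurent (k + int x + int m) ys + coeff_Laurent (k + int x - int m) ys)) xs"
    by (rule pick_sum_cong) (simp add: algebra_simps)
  also have "\<dots> = real (length xs) * coeff_Laurent (k - int x) xs + real (length xs) * coeff_Laurent (k + int x) xs"
    by (simp only: pick_sum_add[where G = "\<lambda>m ys. coeff_Laurent (k - int x + int m) ys + coeff_Laurent (k - int x - int m) ys"] Cons)
  finally show ?case
    by (simp add: pick_sum_Cons algebra_simps)
qed simp

text \<open>The product rule for \<open>u d/du\<close>, applied to all but one factor at a time.\<close>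

lemma coeff_Laurent_pick_sum_deriv:
  "pick_sum (\<lambda>m ys. of_int (k + int m) * coeff_Laurent (k + int m) ys
       + of_int (k - int m) * coeff_Laurent (k - int m) ys) xs
     = (real (length xs) - 1) * of_int k * coeff_Laurent k xs"
proof (induction xs arbitrary: k)
  case (Cons x xs)
  let ?E = coeff_Laurent
  let ?A = "\<lambda>k m ys. ?E (k + int m) ys + ?E (k - int m) ys"
  let ?B = "\<lambda>k m ys. of_int (k + int m) * ?E (k + int m) ys + of_int (k - int m) * ?E (k - int m) ys"
  \<comment> \<open>The factor u^x + u^-x shifts k to k - x and k + x. Writing the old multipliers
    in terms of the shifted indices leaves an excess of x or -x, which the sum without derivative
    evaluates.\<close>
  have "pick_sum (\<lambda>m ys. of_int (k + int m) * ?E (k + int m) (x # ys)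
       + of_int (k - int m) * ?E (k - int m) (x # ys)) xs
     = pick_sum (\<lambda>m ys. (?B (k - int x) m ys + ?B (k + int x) m ys)
          + (real x * ?A (k - int x) m ys - real x * ?A (k + int x) m ys)) xs"
    by (rule pick_sum_cong) (simp add: algebra_simps)
  also have "\<dots> = (real (length xs) - 1) * of_int (k - int x) * ?E (k - int x) xs
      + (real (length xs) - 1) * of_int (k + int x) * ?E (k + int x) xs
      + (real x * (real (length xs) * ?E (k - int x) xs) - real x * (real (length xs) * ?E (k + int x) xs))"
    by (simp only: pick_sum_add[where G = "\<lambda>m ys. ?B (k - int x) m ys + ?B (k + int x) m ys"]
        pick_sum_add[where G = "?B (k - int x)"] pick_sum_diff pick_sum_cmult Cons coeff_Laurent_pick_sum)
  finally show ?case
    by (simp add: pick_sum_Cons algebra_simps)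
qed simp

text \<open>For nonempty \<open>xs\<close> the two extreme splits are distinct. The hypothesis will
  come from parity, which kills the product whenever both parts are nonempty.\<close>

lemma conv_empty_ends:
  assumes "\<And>ys zs. (ys, zs) \<in> set (splits xs) \<Longrightarrow> ys \<noteq> [] \<Longrightarrow> zs \<noteq> [] \<Longrightarrow> f ys * g zs = 0"
    and "xs \<noteq> []"
  shows "conv f g xs = f [] * g xs + f xs * (g [] :: 'a :: comm_ring_1)"
proof -
  obtain x xs' where xs: "xs = x # xs'"
    using assms(2) by (cases xs) auto
  have "conv (\<lambda>ys. f (x # ys)) g xs' = conv (\<lambda>ys. f (x # ys)) (\<lambda>zs. g [] * conv_unit zs) xs'"
  proof (rule conv_cong)
    fix ys zs assume "(ys, zs) \<in> set (splits xs')"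
    then show "f (x # ys) * g zs = f (x # ys) * (g [] * conv_unit zs)"
      using assms(1)[of "x # ys" zs] image_eqI[of "(x # ys, zs)" "\<lambda>(ys, zs). (x # ys, zs)" "(ys, zs)" "set (splits xs')"]
      by (cases "zs = []") (auto simp: xs conv_unit_def)
  qed
  moreover have "conv f (\<lambda>zs. g (x # zs)) xs' = conv (\<lambda>ys. f [] * conv_unit ys) (\<lambda>zs. g (x # zs)) xs'"
  proof (rule conv_cong)
    fix ys zs assume "(ys, zs) \<in> set (splits xs')"
    then show "f ys * g (x # zs) = (f [] * conv_unit ys) * g (x # zs)"
      using assms(1)[of ys "x # zs"] image_eqI[of "(ys, x # zs)" "\<lambda>(ys, zs). (ys, x # zs)" "(ys, zs)" "set (splits xs')"]
      by (cases "ys = []") (auto simp: xs conv_unit_def)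
  qed
  moreover have unit_right: "conv F conv_unit ys = F ys" for F :: "'b list \<Rightarrow> 'a" and ys
    by (subst conv_commute) (rule conv_unit_left)
  ultimately have "conv f g xs = g [] * conv (\<lambda>ys. f (x # ys)) conv_unit xs'
      + f [] * conv conv_unit (\<lambda>zs. g (x # zs)) xs'"
    by (simp only: xs conv_Cons conv_cmult_left conv_cmult_right)
  then show ?thesis
    by (simp add: unit_right conv_unit_left xs mult.commute add.commute)
qed

section \<open>Coefficients of the orders 0, 1 and 2\<close>

locale cumulant_hierarchy_parity = cumulant_hierarchy +
  fixes h :: real
  assumes \<gamma>: "\<And>d. \<gamma> d = (if even d then g else h)"
begin

text \<open>Order 3 determines the coefficients 0, 1 and 2. The index 0 is set explicitly, so that
  its coefficients are known for all lists and all orders.\<close>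

definition P :: "nat \<Rightarrow> nat list \<Rightarrow> real poly" where
  "P k xs = (if k = 0 then [:2 * conv_unit xs:] else (SOME p. expansion 3 (\<lambda>n. Q n k xs) p))"

lemma P: "0 \<notin> set xs \<Longrightarrow> expansion 3 (\<lambda>n. Q n k xs) (P k xs)"
proof (cases "k = 0")
  case True
  show ?thesis
    unfolding P_def using True
    by (auto intro: expansion_cong[OF expansion_const[of _ "2 * conv_unit xs"]] simp: Q_0)
next
  case False
  assume "0 \<notin> set xs"
  from someI_ex[OF Q_expansion[OF this]] False show ?thesis
    by (simp add: P_def)
qed

definition q :: "nat \<Rightarrow> nat \<Rightarrow> nat list \<Rightarrow> real" where
  "q i k xs = coeff (P k xs) i"

lemma q_index_0: "q 0 0 = (\<lambda>xs. 2 * conv_unit xs)" "0 < i \<Longrightarrow> q i 0 = (\<lambda>xs. 0)"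
  by (auto simp: q_def P_def coeff_pCons split: nat.splits)

lemma P_recursion:
  assumes "k \<ge> 1" "0 \<notin> set xs" "i < 3"
  shows "coeff (P k xs
      + smult (1 / 2) (\<Sum>a\<in>{1..<k}. pCons 0 (pCons 0 (P a ((k - a) # xs))) + conv (P a) (P (k - a)) xs)
      + pCons 0 (smult (real k * \<rho> - g) (P k xs)
          - smult 2 (\<Sum>j\<in>{1..<k}. smult (\<gamma> (k - j)) (P j xs)) - smult (\<gamma> k) (P 0 xs))
      - pick_sum (\<lambda>m ys. smult (real m / \<beta>) (P ((k - m) + (m - k)) ys - P (k + m) ys)) xs) i = 0"
proof (rule expansion_zero_coeff[OF _ assms(3)], rule expansion_cong)
  show "expansion 3 (\<lambda>n. Q n k xs
      + 1 / 2 * (\<Sum>a\<in>{1..<k}. 1 / real n * (1 / real n * Q n a ((k - a) # xs)) + conv (Q n a) (Q n (k - a)) xs)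
      + 1 / real n * ((real k * \<rho> - g) * Q n k xs
          - 2 * (\<Sum>j\<in>{1..<k}. \<gamma> (k - j) * Q n j xs) - \<gamma> k * Q n 0 xs)
      - pick_sum (\<lambda>m ys. real m / \<beta> * (Q n ((k - m) + (m - k)) ys - Q n (k + m) ys)) xs)
     (P k xs
      + smult (1 / 2) (\<Sum>a\<in>{1..<k}. pCons 0 (pCons 0 (P a ((k - a) # xs))) + conv (P a) (P (k - a)) xs)
      + pCons 0 (smult (real k * \<rho> - g) (P k xs)
          - smult 2 (\<Sum>j\<in>{1..<k}. smult (\<gamma> (k - j)) (P j xs)) - smult (\<gamma> k) (P 0 xs))
      - pick_sum (\<lambda>m ys. smult (real m / \<beta>) (P ((k - m) + (m - k)) ys - P (k + m) ys)) xs)"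
  proof (intro expansion_add expansion_diff expansion_cmult expansion_sum expansion_pick_sum
        expansion_conv expansion_mult_inverse)
    fix a ys zs assume p: "(ys, zs) \<in> set (splits xs)"
    have "0 \<notin> set ys" "0 \<notin> set zs"
      using splits_cases(2)[OF p] assms(2) by auto
    then show "expansion 3 (\<lambda>n. Q n a ys) (P a ys)" "expansion 3 (\<lambda>n. Q n (k - a) zs) (P (k - a) zs)"
      by (auto intro: P)
  next
    fix m ys assume p: "(m, ys) \<in> set (picks xs)"
    have "0 \<notin> set ys"
      using picks_cases(2)[OF p] assms(2) by auto
    then show "expansion 3 (\<lambda>n. Q n ((k - m) + (m - k)) ys) (P ((k - m) + (m - k)) ys)"
        "expansion 3 (\<lambda>n. Q n (k + m) ys) (P (k + m) ys)"
      by (auto intro: P)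
  qed (use assms(2) in \<open>auto intro: P\<close>)
  show "Q n k xs
      + 1 / 2 * (\<Sum>a\<in>{1..<k}. 1 / real n * (1 / real n * Q n a ((k - a) # xs)) + conv (Q n a) (Q n (k - a)) xs)
      + 1 / real n * ((real k * \<rho> - g) * Q n k xs
          - 2 * (\<Sum>j\<in>{1..<k}. \<gamma> (k - j) * Q n j xs) - \<gamma> k * Q n 0 xs)
      - pick_sum (\<lambda>m ys. real m / \<beta> * (Q n ((k - m) + (m - k)) ys - Q n (k + m) ys)) xs = 0"
    if "n \<ge> 1" for n
    by (rule recursion[OF that assms(1,2)])
qed

lemma q_recursion:
  assumes "k \<ge> 1" "0 \<notin> set xs"
  shows "q 0 k xs = pick_sum (\<lambda>m ys. real m / \<beta> * (q 0 ((k - m) + (m - k)) ys - q 0 (k + m) ys)) xs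
      - 1 / 2 * (\<Sum>a\<in>{1..<k}. conv (q 0 a) (q 0 (k - a)) xs)" (is ?th0)
    and "q 1 k xs = pick_sum (\<lambda>m ys. real m / \<beta> * (q 1 ((k - m) + (m - k)) ys - q 1 (k + m) ys)) xs
      - (\<Sum>a\<in>{1..<k}. conv (q 0 a) (q 1 (k - a)) xs)
      - ((real k * \<rho> - g) * q 0 k xs - 2 * (\<Sum>j\<in>{1..<k}. \<gamma> (k - j) * q 0 j xs) - \<gamma> k * q 0 0 xs)" (is ?th1)
    and "q 2 k xs = pick_sum (\<lambda>m ys. real m / \<beta> * (q 2 ((k - m) + (m - k)) ys - q 2 (k + m) ys)) xs
      - (\<Sum>a\<in>{1..<k}. conv (q 0 a) (q 2 (k - a)) xs)
      - 1 / 2 * (\<Sum>a\<in>{1..<k}. q 0 a ((k - a) # xs) + conv (q 1 a) (q 1 (k - a)) xs)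
      - ((real k * \<rho> - g) * q 1 k xs - 2 * (\<Sum>j\<in>{1..<k}. \<gamma> (k - j) * q 1 j xs) - \<gamma> k * q 1 0 xs)" (is ?th2)
proof -
  \<comment> \<open>The reflection a -> k - a identifies the two cross terms of different orders;
    among the products, a factor 1/2 survives only where both orders agree.\<close>
  have refl: "(\<Sum>a\<in>{1..<k}. conv (q i a) (q j (k - a)) xs) = (\<Sum>a\<in>{1..<k}. conv (q j a) (q i (k - a)) xs)" for i j
    by (rule sum.reindex_bij_witness[where i = "\<lambda>a. k - a" and j = "\<lambda>a. k - a"])
      (auto intro: conv_commute)
  show ?th0
    using P_recursion[OF assms, of 0]
    by (simp add: coeff_sum coeff_conv coeff_pick_sum flip: q_def)
  show ?th1
    using P_recursion[OF assms, of 1] refl[of 0 1]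
    by (simp add: coeff_sum coeff_conv coeff_pick_sum sum.distrib flip: q_def)
  have c1: "coeff (\<Sum>a\<in>{1..<k}. pCons 0 (pCons 0 (P a ((k - a) # xs))) + conv (P a) (P (k - a)) xs) 2
      = (\<Sum>a\<in>{1..<k}. q 0 a ((k - a) # xs) + conv (q 1 a) (q 1 (k - a)) xs)
        + 2 * (\<Sum>a\<in>{1..<k}. conv (q 0 a) (q 2 (k - a)) xs)"
    using refl[of 0 2] by (simp add: coeff_sum coeff_conv sum.distrib numeral_2_eq_2 flip: q_def)
  have c2: "coeff (pCons 0 (smult (real k * \<rho> - g) (P k xs)
          - smult 2 (\<Sum>j\<in>{1..<k}. smult (\<gamma> (k - j)) (P j xs)) - smult (\<gamma> k) (P 0 xs))) 2
      = (real k * \<rho> - g) * q 1 k xs - 2 * (\<Sum>j\<in>{1..<k}. \<gamma> (k - j) * q 1 j xs) - \<gamma> k * q 1 0 xs"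
    by (simp add: coeff_sum numeral_2_eq_2 flip: q_def)
  have c3: "coeff (pick_sum (\<lambda>m ys. smult (real m / \<beta>) (P ((k - m) + (m - k)) ys - P (k + m) ys)) xs) 2
      = pick_sum (\<lambda>m ys. real m / \<beta> * (q 2 ((k - m) + (m - k)) ys - q 2 (k + m) ys)) xs"
    by (simp add: coeff_pick_sum q_def)
  have main: "q 2 k xs + 1 / 2 * ((\<Sum>a\<in>{1..<k}. q 0 a ((k - a) # xs) + conv (q 1 a) (q 1 (k - a)) xs)
        + 2 * (\<Sum>a\<in>{1..<k}. conv (q 0 a) (q 2 (k - a)) xs))
      + ((real k * \<rho> - g) * q 1 k xs - 2 * (\<Sum>j\<in>{1..<k}. \<gamma> (k - j) * q 1 j xs) - \<gamma> k * q 1 0 xs)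
      - pick_sum (\<lambda>m ys. real m / \<beta> * (q 2 ((k - m) + (m - k)) ys - q 2 (k + m) ys)) xs = 0"
    using P_recursion[OF assms, of 2]
    by (simp only: coeff_add coeff_diff coeff_smult c1 c2 c3 q_def[symmetric])
  have alg: "x + 1 / 2 * (t + 2 * s) + c - p = 0 \<Longrightarrow> x = p - s - 1 / 2 * t - c" for x p s t c :: real
    by argo
  show ?th2
    by (rule alg[OF main])
qed

text \<open>The limiting covariance of the Chebyshev sums x_k, which are uncorrelated to this order
  for different indices.\<close>

definition q0_value :: "nat \<Rightarrow> nat list \<Rightarrow> real" where
  "q0_value k xs = (if xs = [k] then 2 * real k / \<beta> else 0)"

text \<open>As the order 0 lives on singletons, a product with it removes an entry m and lowers the
  index by m, so it can be merged with the reflected terms of the recursion.\<close>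

lemma sum_conv_q0_value:
  assumes "0 \<notin> set xs"
  shows "(\<Sum>a\<in>{1..<k}. conv (q0_value a) (F (k - a)) xs)
    = pick_sum (\<lambda>m ys. if m < k then 2 * real m / \<beta> * F (k - m) ys else 0) xs"
proof -
  have "(\<Sum>a\<in>{1..<k}. conv (q0_value a) (F (k - a)) xs)
      = (\<Sum>a\<in>{1..<k}. pick_sum (\<lambda>m ys. q0_value a [m] * F (k - a) ys) xs)"
    by (intro sum.cong conv_singletons) (auto simp: q0_value_def)
  also have "\<dots> = pick_sum (\<lambda>m ys. \<Sum>a\<in>{1..<k}. q0_value a [m] * F (k - a) ys) xs"
    by (simp add: pick_sum_sum)
  also have "\<dots> = pick_sum (\<lambda>m ys. if m < k then 2 * real m / \<beta> * F (k - m) ys else 0) xs"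
  proof (rule pick_sum_cong)
    fix m ys assume "(m, ys) \<in> set (picks xs)"
    then have "m \<ge> 1"
      using assms picks_cases(2) by (fastforce simp: Suc_le_eq intro: gr0I)
    have "(\<Sum>a\<in>{1..<k}. q0_value a [m] * F (k - a) ys)
        = (\<Sum>a\<in>{1..<k}. if a = m then 2 * real m / \<beta> * F (k - m) ys else 0)"
      by (intro sum.cong) (auto simp: q0_value_def)
    with \<open>m \<ge> 1\<close> show "(\<Sum>a\<in>{1..<k}. q0_value a [m] * F (k - a) ys)
        = (if m < k then 2 * real m / \<beta> * F (k - m) ys else 0)"
      by (simp add: sum.delta)
  qed
  finally show ?thesis .
qed

text \<open>For m < k the reflected term cancels against half of the products. The case m = k
  produces the variance through x_0, and the other remaining terms cancel.\<close>

lemma q0_eq: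
  assumes "k \<ge> 1" "0 \<notin> set xs"
  shows "q 0 k xs = q0_value k xs"
  using assms
proof (induction "length xs" arbitrary: k xs rule: less_induct)
  case (less xs)
  from less.prems(1) show ?case
  proof (induction k rule: less_induct)
    case (less k)
    note xs = \<open>0 \<notin> set xs\<close>
    note IHlen = \<open>\<And>ys k. length ys < length xs \<Longrightarrow> k \<ge> 1 \<Longrightarrow> 0 \<notin> set ys \<Longrightarrow> q 0 k ys = q0_value k ys\<close>
    have IH: "q 0 a ys = q0_value a ys" if "1 \<le> a" "a < k" "set ys \<subseteq> set xs" "length ys \<le> length xs" "ys = xs \<or> length ys < length xs" for a ys
      using that less.IH[of a] IHlen[of ys a] xs by auto
    have "(\<Sum>a\<in>{1..<k}. conv (q 0 a) (q 0 (k - a)) xs) = (\<Sum>a\<in>{1..<k}. conv (q0_value a) (q0_value (k - a)) xs)"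
    proof (intro sum.cong refl conv_cong)
      fix a ys zs assume a: "a \<in> {1..<k}" and p: "(ys, zs) \<in> set (splits xs)"
      have ys: "set ys \<subseteq> set xs" "set zs \<subseteq> set xs" "length ys \<le> length xs" "length zs \<le> length xs"
        using splits_cases[OF p] by auto
      have "q 0 a ys = q0_value a ys"
        by (rule IH) (use a ys splits_proper[OF p] in auto)
      moreover have "q 0 (k - a) zs = q0_value (k - a) zs"
        by (rule IH) (use a ys splits_proper[OF p] in auto)
      ultimately show "q 0 a ys * q 0 (k - a) zs = q0_value a ys * q0_value (k - a) zs"
        by (simp only:)
    qed
    also have "\<dots> = pick_sum (\<lambda>m ys. if m < k then 2 * real m / \<beta> * q0_value (k - m) ys else 0) xs"
      by (rule sum_conv_q0_value[OF xs])
    finally have "q 0 k xs = pick_sum (\<lambda>m ys. real m / \<beta> * (q 0 ((k - m) + (m - k)) ys - q 0 (k + m) ys)) xs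
        - 1 / 2 * pick_sum (\<lambda>m ys. if m < k then 2 * real m / \<beta> * q0_value (k - m) ys else 0) xs"
      using q_recursion(1)[OF less.prems xs] by simp
    also have "\<dots> = pick_sum (\<lambda>m ys. real m / \<beta> * (q 0 ((k - m) + (m - k)) ys - q 0 (k + m) ys)
        - 1 / 2 * (if m < k then 2 * real m / \<beta> * q0_value (k - m) ys else 0)) xs"
      by (simp only: pick_sum_diff pick_sum_cmult)
    also have "\<dots> = pick_sum (\<lambda>m ys. real m / \<beta> * ((if m = k then 2 * conv_unit ys else 0)
        + (if k < m then q0_value (m - k) ys else 0) - q0_value (k + m) ys)) xs"
    proof (rule pick_sum_cong)
      fix m ys assume p: "(m, ys) \<in> set (picks xs)"
      have ys: "length ys < length xs" "0 \<notin> set ys"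
        using picks_cases[OF p] xs by auto
      have "q 0 (k + m) ys = q0_value (k + m) ys"
        by (rule IHlen) (use ys less.prems in auto)
      moreover have "q 0 ((k - m) + (m - k)) ys
          = (if m = k then 2 * conv_unit ys else q0_value ((k - m) + (m - k)) ys)"
        using IHlen[OF ys(1) _ ys(2), of "(k - m) + (m - k)"] by (auto simp: q_index_0)
      ultimately show "real m / \<beta> * (q 0 ((k - m) + (m - k)) ys - q 0 (k + m) ys)
          - 1 / 2 * (if m < k then 2 * real m / \<beta> * q0_value (k - m) ys else 0)
        = real m / \<beta> * ((if m = k then 2 * conv_unit ys else 0)
          + (if k < m then q0_value (m - k) ys else 0) - q0_value (k + m) ys)"
        by (cases m k rule: linorder_cases) (auto simp: algebra_simps)
    qed
    also have "\<dots> = q0_value k xs"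
    proof (cases xs)
      case (Cons m xs')
      note xs1 = Cons
      show ?thesis
      proof (cases xs')
        case (Cons p xs'')
        have 0: "conv_unit ys = (0 :: real)" "q0_value j ys = 0" if "length ys \<ge> 2" for ys :: "nat list" and j
          using that by (auto simp: conv_unit_def q0_value_def)
        show ?thesis
        proof (cases xs'')
          case Nil
          \<comment> \<open>For two entries a term survives only if one entry is k plus the other,
            and then the two removals contribute opposite amounts.\<close>
          have e: "(if k < r then q0_value (r - k) [s] else 0) = (if r = k + s then 2 * real s / \<beta> else 0)"
              "q0_value (k + r) [s] = (if s = k + r then 2 * real s / \<beta> else 0)"
              "(if r = k then 2 * conv_unit [s] else 0) = (0 :: real)"
            if "s \<ge> 1" for r s
            using that by (auto simp: q0_value_def conv_unit_def)
          have mp: "m \<ge> 1" "p \<ge> 1" and mpxs: "xs = [m, p]"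
            using xs by (auto simp: xs1 Cons Nil)
          show ?thesis
            unfolding mpxs pick_sum_Cons e[OF mp(1)] e[OF mp(2)] pick_sum_Nil q0_value_def by simp
        next
          case (Cons r xs''')
          have "pick_sum (\<lambda>m ys. real m / \<beta> * ((if m = k then 2 * conv_unit ys else 0)
              + (if k < m then q0_value (m - k) ys else 0) - q0_value (k + m) ys)) xs
            = pick_sum (\<lambda>m ys. 0) xs"
          proof (rule pick_sum_cong)
            fix r ys assume "(r, ys) \<in> set (picks xs)"
            from picks_cases(1)[OF this] have "length ys \<ge> 2"
              by (simp add: xs1 \<open>xs' = p # xs''\<close> Cons)
            from 0[OF this] show "real r / \<beta> * ((if r = k then 2 * conv_unit ys else 0)
              + (if k < r then q0_value (r - k) ys else 0) - q0_value (k + r) ys) = 0"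
              by simp
          qed
          then show ?thesis
            by (simp add: pick_sum_const) (simp add: xs1 \<open>xs' = p # xs''\<close> q0_value_def)
        qed
      next
        case Nil
        show ?thesis
          unfolding xs1 Nil pick_sum_Cons pick_sum_Nil by (simp add: q0_value_def conv_unit_def)
      qed
    next
      case Nil
      then show ?thesis
        by (simp add: q0_value_def)
    qed
    finally show ?case .
  qed
qed

text \<open>The correction from the products turns \<open>\<bar>k - m\<bar>\<close> into an extension that is odd in \<open>k - m\<close>.\<close>

lemma q_recursion_odd_extension:
  assumes "k \<ge> 1" "0 \<notin> set xs" "i > 0"
  shows "pick_sum (\<lambda>m ys. real m / \<beta> * (q i ((k - m) + (m - k)) ys - q i (k + m) ys)) xs
      - (\<Sum>a\<in>{1..<k}. conv (q 0 a) (q i (k - a)) xs)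
    = - pick_sum (\<lambda>m ys. real m / \<beta> * (q i (k + m) ys + (if m < k then q i (k - m) ys else - q i (m - k) ys))) xs"
proof -
  have "(\<Sum>a\<in>{1..<k}. conv (q 0 a) (q i (k - a)) xs) = (\<Sum>a\<in>{1..<k}. conv (q0_value a) (q i (k - a)) xs)"
  proof (intro sum.cong refl conv_cong)
    fix a ys zs assume a: "a \<in> {1..<k}" and p: "(ys, zs) \<in> set (splits xs)"
    have "0 \<notin> set ys"
      using splits_cases(2)[OF p] assms(2) by auto
    then show "q 0 a ys * q i (k - a) zs = q0_value a ys * q i (k - a) zs"
      using q0_eq[of a ys] a by simp
  qed
  also have "\<dots> = pick_sum (\<lambda>m ys. if m < k then 2 * real m / \<beta> * q i (k - m) ys else 0) xs"
    by (rule sum_conv_q0_value[OF assms(2)])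
  finally have "pick_sum (\<lambda>m ys. real m / \<beta> * (q i ((k - m) + (m - k)) ys - q i (k + m) ys)) xs
      - (\<Sum>a\<in>{1..<k}. conv (q 0 a) (q i (k - a)) xs)
    = pick_sum (\<lambda>m ys. real m / \<beta> * (q i ((k - m) + (m - k)) ys - q i (k + m) ys)
        - (if m < k then 2 * real m / \<beta> * q i (k - m) ys else 0)) xs"
    by (simp only: pick_sum_diff)
  also have "\<dots> = pick_sum (\<lambda>m ys. - (real m / \<beta> * (q i (k + m) ys
      + (if m < k then q i (k - m) ys else - q i (m - k) ys)))) xs"
  proof (rule pick_sum_cong)
    fix m ys
    show "real m / \<beta> * (q i ((k - m) + (m - k)) ys - q i (k + m) ys)
        - (if m < k then 2 * real m / \<beta> * q i (k - m) ys else 0)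
      = - (real m / \<beta> * (q i (k + m) ys + (if m < k then q i (k - m) ys else - q i (m - k) ys)))"
    proof (cases "m < k")
      case True
      then have "(k - m) + (m - k) = k - m"
        by simp
      with True show ?thesis
        by (simp only: if_True) argo
    next
      case False
      then have "(k - m) + (m - k) = m - k"
        by simp
      with False show ?thesis
        by (simp only: if_False) argo
    qed
  qed
  finally show ?thesis
    by (simp only: pick_sum_uminus)
qed

text \<open>First correction to the mean: nothing can be removed and the order 0 vanishes, so only
  the source \<open>\<gamma> k * q 0 0 []\<close> remains.\<close>

lemma q1_Nil:
  assumes "k \<ge> 1"
  shows "q 1 k [] = 2 * \<gamma> k"
proof -
  have z: "q 0 j [] = 0" if "j \<in> {1..<Suc k}" for j
    using q0_eq[of j "[]"] that by (simp add: q0_value_def)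
  have s: "(\<Sum>j\<in>{1..<k}. \<gamma> (k - j) * q 0 j []) = 0"
    by (intro sum.neutral) (simp add: z)
  have k: "q 0 k [] = 0"
    by (rule z) (use assms in auto)
  have "q 1 k [] = - pick_sum (\<lambda>m ys. real m / \<beta> * (q 1 (k + m) ys + (if m < k then q 1 (k - m) ys else - q 1 (m - k) ys))) []
    - ((real k * \<rho> - g) * q 0 k [] - 2 * (\<Sum>j\<in>{1..<k}. \<gamma> (k - j) * q 0 j []) - \<gamma> k * q 0 0 [])"
    by (subst q_recursion(2)[OF assms], simp, subst q_recursion_odd_extension[OF assms]) simp_all
  then show ?thesis
    unfolding pick_sum_Nil s k q_index_0(1) by (simp add: conv_unit_def)
qed

text \<open>The index is an integer so that the formula can be odd in it, matching the odd extension
  in the recursion.\<close>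

definition q1_value :: "int \<Rightarrow> nat list \<Rightarrow> real" where
  "q1_value k xs = - 2 * \<rho> * (-1) ^ (length xs - 1) * fact (length xs - 1) / \<beta> ^ length xs
     * real (prod_list xs) * of_int k * coeff_Laurent k xs"

lemma q1_value_minus: "q1_value (- k) xs = - q1_value k xs"
  by (simp add: q1_value_def coeff_Laurent_minus)

text \<open>With one entry the \<gamma> terms cancel by parity, leaving -\<rho> k times the order 0.
  With more entries the order 0 vanishes and the recursion is the product rule for u d/du, whose
  factor length - 1 builds up the factorial.\<close>

lemma q1_eq:
  assumes "k \<ge> 1" "0 \<notin> set xs" "xs \<noteq> []" "\<beta> > 0"
  shows "q 1 k xs = q1_value (int k) xs"
  using assms(1-3)
proof (induction "length xs" arbitrary: k xs rule: less_induct)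
  case (less xs)
  have eq: "q 1 k xs = - pick_sum (\<lambda>m ys. real m / \<beta> * (q 1 (k + m) ys + (if m < k then q 1 (k - m) ys else - q 1 (m - k) ys))) xs
    - ((real k * \<rho> - g) * q0_value k xs - 2 * (\<Sum>j\<in>{1..<k}. \<gamma> (k - j) * q0_value j xs))"
  proof -
    have "(\<Sum>j\<in>{1..<k}. \<gamma> (k - j) * q 0 j xs) = (\<Sum>j\<in>{1..<k}. \<gamma> (k - j) * q0_value j xs)"
      by (intro sum.cong) (use q0_eq less.prems in auto)
    moreover have "q 0 0 xs = 0"
      using less.prems(3) by (simp add: q_index_0 conv_unit_def)
    ultimately show ?thesis
      by (subst q_recursion(2)[OF less.prems(1,2)], subst q_recursion_odd_extension[OF less.prems(1,2)])
        (simp_all only: q0_eq[OF less.prems(1,2)] mult_zero_right diff_zero less_one)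
  qed
  show ?case
  proof (cases "length xs = 1")
    case True
    then obtain m where xs: "xs = [m]"
      by (auto simp: length_Suc_conv)
    have m: "m \<ge> 1"
      using less.prems by (auto simp: xs)
    have s: "(\<Sum>j\<in>{1..<k}. \<gamma> (k - j) * q0_value j xs) = (if m < k then \<gamma> (k - m) * (2 * real m / \<beta>) else 0)"
    proof -
      have "(\<Sum>j\<in>{1..<k}. \<gamma> (k - j) * q0_value j xs) = (\<Sum>j\<in>{1..<k}. if j = m then \<gamma> (k - m) * (2 * real m / \<beta>) else 0)"
        by (intro sum.cong) (auto simp: q0_value_def xs)
      then show ?thesis
        using m by (simp add: sum.delta)
    qed
    define r where "r = real m / \<beta>"
    have r2: "2 * real m / \<beta> = 2 * r"
      by (simp add: r_def)
    have nil: "q 1 j [] = 2 * \<gamma> j" if "j > 0" for j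
      using q1_Nil[of j] that by simp
    have km: "q 1 (k + m) [] = 2 * \<gamma> (k + m)"
      by (rule nil) (use m in simp)
    have eq1: "q 1 k xs = - (r * (2 * \<gamma> (k + m) + (if m < k then q 1 (k - m) [] else - q 1 (m - k) [])))
      - ((real k * \<rho> - g) * q0_value k xs - 2 * (if m < k then \<gamma> (k - m) * (2 * r) else 0))"
      unfolding eq s unfolding xs pick_sum_Cons pick_sum_Nil r_def[symmetric] r2 km by simp
    have v: "q1_value (int k) xs = (if k = m then - 2 * \<rho> * (r * real k) else 0)"
      by (auto simp: xs q1_value_def r_def)
    have v0: "q0_value k xs = (if k = m then 2 * r else 0)"
      by (auto simp: xs q0_value_def r_def)
    consider "m < k" | "m > k" | "m = k" by linarith
    then show ?thesis
    proof cases
      case 1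
      then have "\<gamma> (k + m) = \<gamma> (k - m)" "q 1 (k - m) [] = 2 * \<gamma> (k - m)" "k \<noteq> m"
        by (simp_all only: \<gamma> nil zero_less_diff) simp_all
      with 1 show ?thesis
        unfolding eq1 v v0 by (simp only: if_True if_False) (simp add: algebra_simps)
    next
      case 2
      then have "\<gamma> (k + m) = \<gamma> (m - k)" "q 1 (m - k) [] = 2 * \<gamma> (m - k)" "k \<noteq> m" "\<not> m < k"
        by (simp_all only: \<gamma> nil zero_less_diff) simp_all
      then show ?thesis
        unfolding eq1 v v0 by (simp only: if_True if_False) (simp add: algebra_simps)
    next
      case 3
      then have "\<gamma> (k + m) = g" "q 1 (m - k) [] = 0"
        by (simp_all add: \<gamma> q_index_0)
      with 3 show ?thesis
        unfolding eq1 v v0 by (simp only: if_True if_False) (simp add: algebra_simps)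
    qed
  next
    case False
    define N where "N = length xs"
    have N: "N \<ge> 2"
      using False less.prems(3) by (metis N_def One_nat_def less_2_cases_iff length_0_conv not_le)
    have q0: "q0_value j xs = 0" for j
      using False by (auto simp: q0_value_def)
    define d where "d = - 2 * \<rho> * (-1) ^ (N - 2) * fact (N - 2) / \<beta> ^ (N - 1)"
    define c where "c = d / \<beta> * real (prod_list xs)"
    have "q 1 k xs = - pick_sum (\<lambda>m ys. real m / \<beta> * (q 1 (k + m) ys + (if m < k then q 1 (k - m) ys else - q 1 (m - k) ys))) xs"
      using eq by (simp add: q0)
    also have "\<dots> = - pick_sum (\<lambda>m ys. c * (of_int (int k + int m) * coeff_Laurent (int k + int m) ys
       + of_int (int k - int m) * coeff_Laurent (int k - int m) ys)) xs"
    proof (intro arg_cong[of _ _ uminus] pick_sum_cong)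
      fix m ys assume p: "(m, ys) \<in> set (picks xs)"
      have ys: "length ys < length xs" "0 \<notin> set ys" "ys \<noteq> []" "length ys = N - 1" "m \<ge> 1"
        using picks_cases[OF p] less.prems N by (auto simp: N_def Suc_le_eq intro: gr0I)
      have pr: "real (prod_list xs) = real m * real (prod_list ys)"
        using picks_prod_list[OF p, of "\<lambda>x. x"] by simp
      have 1: "q 1 j ys = q1_value (int j) ys" for j
        using less.hyps[OF ys(1) _ ys(2,3), of j] by (cases "j = 0") (auto simp: q_index_0 q1_value_def)
      have sgn: "(if m < k then q 1 (k - m) ys else - q 1 (m - k) ys) = q1_value (int k - int m) ys"
      proof (cases "m < k")
        case False
        then show ?thesis
          using 1[of "m - k"] q1_value_minus[of "int k - int m" ys] by (simp add: of_nat_diff)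
      qed (use 1[of "k - m"] in \<open>simp add: of_nat_diff\<close>)
      show "real m / \<beta> * (q 1 (k + m) ys + (if m < k then q 1 (k - m) ys else - q 1 (m - k) ys))
        = c * (of_int (int k + int m) * coeff_Laurent (int k + int m) ys
          + of_int (int k - int m) * coeff_Laurent (int k - int m) ys)"
      proof -
        have v: "q1_value j ys = d * (real (prod_list ys) * (of_int j * coeff_Laurent j ys))" for j
          by (simp add: q1_value_def d_def ys(4) numeral_2_eq_2)
        have alg: "r / \<beta> * (d * (p * A) + d * (p * B)) = d / \<beta> * (r * p) * (A + B)" for r p A B
          by (simp add: algebra_simps add_divide_distrib)
        show ?thesis
          unfolding sgn unfolding 1 of_nat_add v c_def pr by (rule alg)
      qed
    qed
    also have "\<dots> = - (c * ((real N - 1) * of_int (int k) * coeff_Laurent (int k) xs))"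
      by (simp only: pick_sum_cmult coeff_Laurent_pick_sum_deriv N_def)
    also have "\<dots> = q1_value (int k) xs"
    proof -
      obtain M where M: "N = Suc (Suc M)"
        using N by (metis add_2_eq_Suc le_Suc_ex)
      have d: "d = - 2 * \<rho> * (-1) ^ M * fact M / \<beta> ^ Suc M"
        by (simp add: d_def M)
      have alg: "- (x * s * f / b / y * p * ((m + 1) * l * e)) = x * (- 1 * s) * ((m + 1) * f) / (y * b) * p * l * e"
        for x s f b y p m l e :: real
        by (simp add: divide_inverse ac_simps)
      have e: "real (Suc (Suc M)) - 1 = real M + 1" "Suc (Suc M) - 1 = Suc M"
          "(-1 :: real) ^ Suc M = -1 * (-1) ^ M" "fact (Suc M) = (real M + 1) * fact M"
          "\<beta> ^ Suc (Suc M) = \<beta> * \<beta> ^ Suc M"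
        by simp_all
      show ?thesis
        unfolding q1_value_def c_def N_def[symmetric] M d e by (rule alg)
    qed
    finally show ?thesis .
  qed
qed

text \<open>For nonempty \<open>xs\<close> of odd total, all sources vanish or cancel: the order 1
  is 0, so of the products only those with an empty part survive, and they cancel the \<gamma> sum.
  The homogeneous recursion is solved by functions linear in k, because (k + m) + (k - m) = 2 k; the
  number of picks builds up the factorial.\<close>

lemma q2_eq:
  assumes "k \<ge> 1" "0 \<notin> set xs" "odd (k + sum_list xs)" "\<beta> > 0"
  shows "q 2 k xs = - 2 * h * (\<rho> - g) * real k * (-1) ^ length xs * fact (length xs) * (2 / \<beta>) ^ length xs
    * real (prod_list xs)"
  using assms(1-3)
proof (induction "length xs" arbitrary: k xs rule: less_induct)
  case (less xs)
  note xs = less.prems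
  have q1_parity: "q 1 a ys = 0" if "odd (a + sum_list ys)" "0 \<notin> set ys" "ys \<noteq> []" for a ys
    using q1_eq[OF _ that(2,3) assms(4), of a] coeff_Laurent_parity[of "int a" ys] that(1)
    by (cases "a = 0") (auto simp: q_index_0 q1_value_def)
  have q0_split: "q 0 a ((k - a) # xs) = 0" if a: "a \<in> {1..<k}" for a
  proof -
    have "(k - a) # xs \<noteq> [a]"
    proof
      assume "(k - a) # xs = [a]"
      then have "k = 2 * a" "xs = []"
        using a by auto
      then show False
        using xs(3) by simp
    qed
    then show ?thesis
      using q0_eq[of a "(k - a) # xs"] a xs by (auto simp: q0_value_def)
  qed
  have eq: "q 2 k xs = - pick_sum (\<lambda>m ys. real m / \<beta> * (q 2 (k + m) ys + (if m < k then q 2 (k - m) ys else - q 2 (m - k) ys))) xs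
      - 1 / 2 * (\<Sum>a\<in>{1..<k}. conv (q 1 a) (q 1 (k - a)) xs)
      - ((real k * \<rho> - g) * q 1 k xs - 2 * (\<Sum>j\<in>{1..<k}. \<gamma> (k - j) * q 1 j xs))"
  proof -
    have "(\<Sum>a\<in>{1..<k}. q 0 a ((k - a) # xs) + conv (q 1 a) (q 1 (k - a)) xs)
        = (\<Sum>a\<in>{1..<k}. conv (q 1 a) (q 1 (k - a)) xs)"
      by (intro sum.cong) (simp_all add: q0_split)
    moreover have "q 1 0 xs = 0"
      by (simp add: q_index_0)
    ultimately show ?thesis
      by (subst q_recursion(3)[OF xs(1,2)], subst q_recursion_odd_extension[OF xs(1,2)])
        (simp_all only: mult_zero_right diff_zero zero_less_numeral)
  qed
  show ?case
  proof (cases "xs = []")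
    case True
    \<comment> \<open>As k is odd here, exactly one of a and k - a is even.\<close>
    have *: "\<gamma> a * \<gamma> (k - a) = g * h" "\<gamma> (k - a) * \<gamma> a = g * h" if "a \<in> {1..<k}" for a
      using that xs(3) by (auto simp: True \<gamma>)
    have nil: "q 1 a xs = 2 * \<gamma> a" if "a \<ge> 1" for a
      using q1_Nil[OF that] by (simp add: True)
    have "conv (q 1 a) (q 1 (k - a)) xs = 4 * (g * h)" if a: "a \<in> {1..<k}" for a
    proof -
      have "conv (q 1 a) (q 1 (k - a)) xs = q 1 a xs * q 1 (k - a) xs"
        by (simp add: True)
      also have "\<dots> = (2 * \<gamma> a) * (2 * \<gamma> (k - a))"
        using a by (subst (1 2) nil) auto
      finally show ?thesis
        using *(1)[OF a] by simp
    qed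
    then have c: "(\<Sum>a\<in>{1..<k}. conv (q 1 a) (q 1 (k - a)) xs) = (real k - 1) * (4 * (g * h))"
      using xs(1) by (simp add: of_nat_diff)
    have "\<gamma> (k - j) * q 1 j xs = 2 * (g * h)" if j: "j \<in> {1..<k}" for j
      using *(2)[OF j] nil[of j] j by simp
    then have d: "(\<Sum>j\<in>{1..<k}. \<gamma> (k - j) * q 1 j xs) = (real k - 1) * (2 * (g * h))"
      using xs(1) by (simp add: of_nat_diff)
    have n: "q 1 k xs = 2 * h"
      using nil[OF xs(1)] xs(3) by (simp add: True \<gamma>)
    show ?thesis
      unfolding eq c d n by (simp add: True algebra_simps)
  next
    case False
    have "conv (q 1 a) (q 1 (k - a)) xs = 2 * (\<gamma> a * q 1 (k - a) xs) + 2 * (\<gamma> (k - a) * q 1 a xs)"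
      if a: "a \<in> {1..<k}" for a
    proof -
      have "conv (q 1 a) (q 1 (k - a)) xs = q 1 a [] * q 1 (k - a) xs + q 1 a xs * q 1 (k - a) []"
      proof (rule conv_empty_ends[OF _ False])
        fix ys zs assume p: "(ys, zs) \<in> set (splits xs)" and ne: "ys \<noteq> []" "zs \<noteq> []"
        have nz: "0 \<notin> set ys" "0 \<notin> set zs"
          using splits_cases(2)[OF p] xs(2) by auto
        have "(a + sum_list ys) + (k - a + sum_list zs) = k + sum_list xs"
          using splits_sum_list[OF p] a by simp
        then have "odd (a + sum_list ys) \<or> odd (k - a + sum_list zs)"
          using xs(3) by (metis even_add)
        then show "q 1 a ys * q 1 (k - a) zs = 0"
        proof
          assume "odd (a + sum_list ys)"
          from q1_parity[OF this nz(1) ne(1)] show ?thesis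
            by simp
        next
          assume "odd (k - a + sum_list zs)"
          from q1_parity[OF this nz(2) ne(2)] show ?thesis
            by simp
        qed
      qed
      moreover have "q 1 a [] = 2 * \<gamma> a" "q 1 (k - a) [] = 2 * \<gamma> (k - a)"
        using a by (auto intro!: q1_Nil simp del: One_nat_def)
      moreover have "(2 * x) * u + v * (2 * y) = 2 * (x * u) + 2 * (y * v)" for x y u v :: real
        by simp
      ultimately show ?thesis
        by metis
    qed
    then have "(\<Sum>a\<in>{1..<k}. conv (q 1 a) (q 1 (k - a)) xs)
        = (\<Sum>a\<in>{1..<k}. 2 * (\<gamma> a * q 1 (k - a) xs) + 2 * (\<gamma> (k - a) * q 1 a xs))"
      by (intro sum.cong refl)
    also have "\<dots> = 2 * (\<Sum>a\<in>{1..<k}. \<gamma> a * q 1 (k - a) xs) + 2 * (\<Sum>a\<in>{1..<k}. \<gamma> (k - a) * q 1 a xs)"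
      by (simp only: sum.distrib sum_distrib_left)
    also have "(\<Sum>a\<in>{1..<k}. \<gamma> a * q 1 (k - a) xs) = (\<Sum>a\<in>{1..<k}. \<gamma> (k - a) * q 1 a xs)"
      by (rule sum.reindex_bij_witness[where i = "\<lambda>a. k - a" and j = "\<lambda>a. k - a"]) auto
    finally have "q 2 k xs = - pick_sum (\<lambda>m ys. real m / \<beta> * (q 2 (k + m) ys + (if m < k then q 2 (k - m) ys else - q 2 (m - k) ys))) xs"
      unfolding eq q1_parity[OF xs(3,2) False] by simp
    also have "\<dots> = - pick_sum (\<lambda>m ys. - 2 * h * (\<rho> - g) * real k * (-1) ^ length ys * fact (length xs - 1)
        * (2 / \<beta>) ^ length xs * real (prod_list xs)) xs"
    proof (intro arg_cong[of _ _ uminus] pick_sum_cong)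
      fix m ys assume p: "(m, ys) \<in> set (picks xs)"
      have ys: "length ys < length xs" "0 \<notin> set ys" "length xs = Suc (length ys)"
        using picks_cases[OF p] xs by auto
      have pr: "real (prod_list xs) = real m * real (prod_list ys)"
        using picks_prod_list[OF p, of "\<lambda>x. x"] by simp
      let ?c = "- 2 * h * (\<rho> - g) * (-1) ^ length ys * fact (length ys) * (2 / \<beta>) ^ length ys * real (prod_list ys)"
      have 2: "q 2 j ys = ?c * real j" if "odd (j + sum_list ys) \<or> j = 0" for j
        using that less.hyps[OF ys(1) _ ys(2), of j] by (cases "j = 0") (auto simp: q_index_0)
      have o: "odd (k + m + sum_list ys)"
        using picks_sum_list[OF p] xs(3) by (simp add: add.assoc)
      have "(if m < k then q 2 (k - m) ys else - q 2 (m - k) ys) = ?c * (real k - real m)"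
        using 2[of "k - m"] 2[of "m - k"] o by (auto simp: of_nat_diff algebra_simps)
      then have "q 2 (k + m) ys + (if m < k then q 2 (k - m) ys else - q 2 (m - k) ys) = ?c * (2 * real k)"
        using 2[of "k + m"] o by (simp add: algebra_simps)
      then show "real m / \<beta> * (q 2 (k + m) ys + (if m < k then q 2 (k - m) ys else - q 2 (m - k) ys))
        = - 2 * h * (\<rho> - g) * real k * (-1) ^ length ys * fact (length xs - 1)
        * (2 / \<beta>) ^ length xs * real (prod_list xs)"
        by (simp add: ys(3) pr)
    qed
    also have "\<dots> = - pick_sum (\<lambda>m ys. - 2 * h * (\<rho> - g) * real k * (-1) ^ (length xs - 1) * fact (length xs - 1)
        * (2 / \<beta>) ^ length xs * real (prod_list xs)) xs"
    proof (intro arg_cong[of _ _ uminus] pick_sum_cong)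
      fix m ys assume "(m, ys) \<in> set (picks xs)"
      from picks_cases(1)[OF this] have "length ys = length xs - 1"
        by simp
      then show "- 2 * h * (\<rho> - g) * real k * (-1) ^ length ys * fact (length xs - 1)
          * (2 / \<beta>) ^ length xs * real (prod_list xs)
        = - 2 * h * (\<rho> - g) * real k * (-1) ^ (length xs - 1) * fact (length xs - 1)
          * (2 / \<beta>) ^ length xs * real (prod_list xs)"
        by (simp only:)
    qed
    also have "\<dots> = - 2 * h * (\<rho> - g) * real k * (-1) ^ length xs * fact (length xs) * (2 / \<beta>) ^ length xs
        * real (prod_list xs)"
    proof -
      obtain L where L: "length xs = Suc L"
        using False by (cases xs) auto
      have "- ((1 + l) * (x * s * f * p * r)) = x * (- 1 * s) * ((1 + l) * f) * p * r" for l x s f p r :: real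
        by simp
      then show ?thesis
        unfolding pick_sum_const L diff_Suc_1 power_Suc[of "-1 :: real" L] fact_Suc of_nat_Suc .
    qed
    finally show ?thesis .
  qed
qed

end

section \<open>Limits of the rescaled cumulants\<close>

lemma (in cumulant_hierarchy_parity) Q_tendsto_first_order:
  assumes "k \<ge> 1" "0 \<notin> set xs" "length xs \<ge> 2" "\<beta> > 0"
  shows "(\<lambda>n. real n * Q n k xs) \<longlonglongrightarrow> q1_value (int k) xs"
proof -
  have "xs \<noteq> []" "xs \<noteq> [k]"
    using assms(3) by auto
  then have "coeff (P k xs) 0 = 0" "coeff (P k xs) 1 = q1_value (int k) xs"
    using q0_eq[OF assms(1,2)] q1_eq[OF assms(1,2) _ assms(4)] by (simp_all add: q_def q0_value_def)
  then show ?thesis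
    using expansion_tendsto[OF expansion_mono[OF P[OF assms(2), of k]], of 1]
    by (simp add: numeral_2_eq_2[symmetric])
qed

text \<open>The odd total rules out the variances, which carry the order 0. For a nonempty list it
  also kills the order 1, while the mean may have one.\<close>

lemma (in cumulant_hierarchy_parity) Q_tendsto_second_order:
  assumes "k \<ge> 1" "0 \<notin> set xs" "xs \<noteq> []" "odd (k + sum_list xs)" "\<beta> > 0"
  shows "(\<lambda>n. real n ^ 2 * Q n k xs) \<longlonglongrightarrow>
    - 2 * h * (\<rho> - g) * real k * (-1) ^ length xs * fact (length xs) * (2 / \<beta>) ^ length xs * real (prod_list xs)"
proof -
  have "xs \<noteq> [k]"
    using assms(4) by auto
  then have 0: "coeff (P k xs) 0 = 0"
    using q0_eq[OF assms(1,2)] by (simp add: q_def q0_value_def)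
  have 1: "coeff (P k xs) 1 = 0"
    using q1_eq[OF assms(1,2,3,5)] coeff_Laurent_parity[of "int k" xs] assms(4) by (simp add: q_def q1_value_def)
  have z: "coeff (P k xs) j = 0" if "j < 2" for j
    using 0 1 that by (auto simp: less_2_cases_iff)
  have "expansion (Suc 2) (\<lambda>n. Q n k xs) (P k xs)"
    using P[OF assms(2), of k] by (simp add: numeral_3_eq_3 numeral_2_eq_2)
  from expansion_tendsto[OF this z] show ?thesis
    using q2_eq[OF assms(1,2,4,5)] by (simp add: q_def)
qed

section \<open>Chebyshev polynomials on the unit interval\<close>

text \<open>With \<open>t = (1 + cos \<theta>) / 2\<close> we have \<open>cheb k t = 2 cos (k \<theta>)\<close> and
  \<open>chebU k t = sin (k \<theta>) / sin \<theta>\<close>; note the value 2 at index 0 and the shifted index of \<open>chebU\<close>.\<close>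

fun cheb :: "nat \<Rightarrow> real \<Rightarrow> real" where
  "cheb 0 t = 2"
| "cheb (Suc 0) t = 4 * t - 2"
| "cheb (Suc (Suc k)) t = (4 * t - 2) * cheb (Suc k) t - cheb k t"

fun chebU :: "nat \<Rightarrow> real \<Rightarrow> real" where
  "chebU 0 t = 0"
| "chebU (Suc 0) t = 1"
| "chebU (Suc (Suc k)) t = (4 * t - 2) * chebU (Suc k) t - chebU k t"

text \<open>In angles: 2 cos((k+1)\<theta>) sin \<theta> = sin((k+2)\<theta>) -
  sin(k\<theta>).\<close>

lemma cheb_eq_chebU: "cheb (Suc k) t = chebU (Suc (Suc k)) t - chebU k t"
proof (induction k t rule: cheb.induct)
  case (3 k t)
  show ?case
    by (simp only: cheb.simps(3)[of "Suc k"] 3) (simp add: algebra_simps)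
qed (simp_all add: algebra_simps)

lemma DERIV_cheb: "(cheb k has_real_derivative 4 * real k * chebU k t) (at t)"
proof (induction k t rule: cheb.induct)
  case (3 k t)
  have "((\<lambda>t. (4 * t - 2) * cheb (Suc k) t - cheb k t) has_real_derivative
      4 * cheb (Suc k) t + (4 * t - 2) * (4 * real (Suc k) * chebU (Suc k) t) - 4 * real k * chebU k t) (at t)"
    by (rule derivative_eq_intros 3 refl | simp)+
  also have "4 * cheb (Suc k) t + (4 * t - 2) * (4 * real (Suc k) * chebU (Suc k) t) - 4 * real k * chebU k t
      = 4 * real (Suc (Suc k)) * chebU (Suc (Suc k)) t"
    by (simp add: cheb_eq_chebU algebra_simps)
  finally show ?case
    by (simp add: fun_eq_iff[symmetric] del: chebU.simps)
next
  case (2 t)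
  show ?case
    by (auto intro!: derivative_eq_intros)
qed simp

lemma continuous_on_cheb [continuous_intros]:
  "continuous_on A f \<Longrightarrow> continuous_on A (\<lambda>x. cheb k (f x))"
  by (rule continuous_on_compose2[of UNIV "cheb k"])
    (auto intro!: continuous_at_imp_continuous_on DERIV_isCont DERIV_cheb)

lemma continuous_on_chebU [continuous_intros]:
  assumes "continuous_on A f"
  shows "continuous_on A (\<lambda>x. chebU k (f x))"
proof -
  have "continuous_on UNIV (chebU k)"
  proof (induction k rule: induct_nat_012)
    case (ge2 k)
    then show ?case
      by (auto intro!: continuous_intros simp: chebU.simps(3)[abs_def])
  qed (simp_all add: chebU.simps(1,2)[abs_def])
  then show ?thesis
    by (rule continuous_on_compose2[OF _ assms]) auto
qed

lemma measurable_cheb [measurable]: "cheb k \<in> borel_measurable borel"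
  by (intro borel_measurable_continuous_onI continuous_on_cheb continuous_on_id)

lemma measurable_chebU [measurable]: "chebU k \<in> borel_measurable borel"
  by (intro borel_measurable_continuous_onI continuous_on_chebU continuous_on_id)

text \<open>The field sin(k\<theta>) d/d\<theta> written in t: here dt/d\<theta> = -(sin \<theta>)/2
  and (sin \<theta>)^2 = 4t(1 - t).\<close>

definition phi :: "nat \<Rightarrow> real \<Rightarrow> real" where
  "phi k t = - 2 * t * (1 - t) * chebU k t"

lemma phi_eq_cheb: "8 * phi (Suc k) t = cheb (Suc (Suc k)) t - cheb k t"
proof (induction k t rule: cheb.induct)
  case (3 k t)
  have "8 * phi (Suc (Suc (Suc k))) t = (4 * t - 2) * (8 * phi (Suc (Suc k)) t) - 8 * phi (Suc k) t"
    by (simp add: phi_def algebra_simps)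
  then show ?case
    by (simp only: 3) (simp add: algebra_simps)
qed (simp_all add: phi_def power2_eq_square algebra_simps)

lemma DERIV_phi:
  assumes "k \<ge> 1"
  shows "(phi k has_real_derivative (real k / 2 * cheb k t + (2 * t - 1) * chebU k t)) (at t)"
proof -
  obtain j where k: "k = Suc j"
    using assms by (cases k) auto
  have "((\<lambda>t. (cheb (Suc (Suc j)) t - cheb j t) / 8) has_real_derivative
      (4 * real (Suc (Suc j)) * chebU (Suc (Suc j)) t - 4 * real j * chebU j t) / 8) (at t)"
    by (rule derivative_eq_intros DERIV_cheb refl | simp del: cheb.simps chebU.simps)+
  moreover have "(\<lambda>t. (cheb (Suc (Suc j)) t - cheb j t) / 8) = phi k"
    by (simp add: fun_eq_iff k phi_eq_cheb[symmetric] del: cheb.simps)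
  moreover have "(4 * real (Suc (Suc j)) * chebU (Suc (Suc j)) t - 4 * real j * chebU j t) / 8
      = real k / 2 * cheb k t + (2 * t - 1) * chebU k t"
    by (simp only: k cheb_eq_chebU) (simp add: field_simps)
  ultimately show ?thesis
    by (simp only:)
qed

text \<open>Equals cot(\<theta>/2) sin(k\<theta>), which is \<open>phi k\<close> times the
  logarithmic derivative of (1 - t)^b, divided by b. So the exponent at 1 enters the loop equations
  through the x_j only, with half weights at j = 0 and j = k.\<close>

lemma sum_cheb:
  assumes "k \<ge> 1"
  shows "(cheb 0 t + cheb k t) / 2 + (\<Sum>j\<in>{1..<k}. cheb j t) = 2 * t * chebU k t"
  using assms
proof (induction k rule: dec_induct)
  case (step k)
  have "cheb k t + cheb (Suc k) t = 4 * t * (chebU (Suc k) t - chebU k t)"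
    using step.hyps by (cases k) (simp_all only: cheb_eq_chebU chebU.simps, simp_all add: algebra_simps)
  moreover have "(\<Sum>j\<in>{1..<Suc k}. cheb j t) = (\<Sum>j\<in>{1..<k}. cheb j t) + cheb k t"
    using step.hyps by simp
  ultimately show ?case
    using step.IH by (simp add: field_simps del: cheb.simps chebU.simps sum.op_ivl_Suc)
qed simp

text \<open>The counterpart for t^a, equal to -tan(\<theta>/2) sin(k\<theta>). Constant and
  alternating signs together are why \<open>\<gamma>\<close> depends only on parity.\<close>

lemma sum_alternating_cheb:
  assumes "k \<ge> 1"
  shows "((-1) ^ k * cheb 0 t + cheb k t) / 2 + (\<Sum>j\<in>{1..<k}. (-1) ^ (k - j) * cheb j t) = - 2 * (1 - t) * chebU k t"
  using assms
proof (induction k rule: dec_induct)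
  case (step k)
  have 1: "cheb (Suc k) t - cheb k t = - (4 * (1 - t) * (chebU (Suc k) t + chebU k t))"
    using step.hyps by (cases k) (simp_all only: cheb_eq_chebU chebU.simps, simp_all add: algebra_simps)
  have 2: "(\<Sum>j\<in>{1..<Suc k}. (-1) ^ (Suc k - j) * cheb j t) = - (\<Sum>j\<in>{1..<k}. (-1) ^ (k - j) * cheb j t) - cheb k t"
    using step.hyps by (simp add: Suc_diff_le sum_negf)
  have "((-1) ^ Suc k * cheb 0 t + cheb (Suc k) t) / 2 + (\<Sum>j\<in>{1..<Suc k}. (-1) ^ (Suc k - j) * cheb j t)
      = - (((-1) ^ k * cheb 0 t + cheb k t) / 2 + (\<Sum>j\<in>{1..<k}. (-1) ^ (k - j) * cheb j t))
        + (cheb (Suc k) t - cheb k t) / 2"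
    unfolding 2 by (simp add: field_simps del: cheb.simps)
  also have "\<dots> = - 2 * (1 - t) * chebU (Suc k) t"
    unfolding step.IH 1 by (simp add: field_simps del: chebU.simps)
  finally show ?case .
qed simp

lemma unit_interval_cos:
  assumes "t \<in> {0..1}"
  obtains \<theta> :: real where "t = (1 + cos \<theta>) / 2"
proof
  show "t = (1 + cos (arccos (2 * t - 1))) / 2"
    using assms by (subst cos_arccos) auto
qed

lemma cheb_cos: "cheb k ((1 + cos \<theta>) / 2) = 2 * cos (real k * \<theta>)"
proof (induction k rule: induct_nat_012)
  case (ge2 k)
  have "cos (real (Suc (Suc k)) * \<theta>) + cos (real k * \<theta>) = 2 * cos \<theta> * cos (real (Suc k) * \<theta>)"
    using cos_add[of "real (Suc k) * \<theta>" \<theta>] cos_diff[of "real (Suc k) * \<theta>" \<theta>]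
    by (simp add: algebra_simps)
  with ge2 show ?case
    by (simp add: field_simps)
qed (simp_all add: field_simps)

lemma chebU_sin: "chebU k ((1 + cos \<theta>) / 2) * sin \<theta> = sin (real k * \<theta>)"
proof (induction k rule: induct_nat_012)
  case (ge2 k)
  have "sin (real (Suc (Suc k)) * \<theta>) + sin (real k * \<theta>) = 2 * cos \<theta> * sin (real (Suc k) * \<theta>)"
    using sin_add[of "real (Suc k) * \<theta>" \<theta>] sin_diff[of "real (Suc k) * \<theta>" \<theta>]
    by (simp add: algebra_simps)
  with ge2 show ?case
    by (simp add: field_simps)
qed simp_all

lemma abs_cheb_le: "t \<in> {0..1} \<Longrightarrow> \<bar>cheb k t\<bar> \<le> 2"
  using abs_cos_le_one by (force elim!: unit_interval_cos simp: cheb_cos abs_mult)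

text \<open>The product formula for two sines. With \<open>DERIV_cheb\<close> it gives the action of
  the field on x_m: a multiple of the difference of the sums with indices k + m and |k - m|.\<close>

lemma phi_mult_chebU:
  assumes "t \<in> {0..1}"
  shows "8 * phi k t * chebU m t = cheb (k + m) t - cheb ((k - m) + (m - k)) t"
proof -
  obtain \<theta> where t: "t = (1 + cos \<theta>) / 2"
    using assms by (rule unit_interval_cos)
  have "t * (1 - t) = (1 - (cos \<theta>)\<^sup>2) / 4"
    by (simp add: t power2_eq_square field_simps)
  then have tt: "t * (1 - t) = sin \<theta> * sin \<theta> / 4"
    by (simp add: sin_squared_eq flip: power2_eq_square)
  have "8 * phi k t * chebU m t = - 16 * (t * (1 - t)) * (chebU k t * chebU m t)"
    by (simp add: phi_def)
  also have "\<dots> = - 4 * ((chebU k t * sin \<theta>) * (chebU m t * sin \<theta>))"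
    unfolding tt by simp
  also have "\<dots> = - 4 * (sin (real k * \<theta>) * sin (real m * \<theta>))"
    by (simp add: t chebU_sin)
  also have "\<dots> = 2 * cos (real k * \<theta> + real m * \<theta>) - 2 * cos (real k * \<theta> - real m * \<theta>)"
    by (simp add: cos_add cos_diff)
  also have "cos (real k * \<theta> - real m * \<theta>) = cos (real ((k - m) + (m - k)) * \<theta>)"
  proof (cases "m \<le> k")
    case False
    have "cos (real k * \<theta> - real m * \<theta>) = cos (real m * \<theta> - real k * \<theta>)"
      by (metis cos_minus minus_diff_eq)
    with False show ?thesis
      by (simp add: of_nat_diff algebra_simps)
  qed (simp add: of_nat_diff algebra_simps)
  finally show ?thesis
    by (simp add: t cheb_cos algebra_simps)
qed

text \<open>Twice the divided difference of \<open>phi k\<close>. It will replace the singular pair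
  interaction, and its sum is the origin of the products x_a x_(k-a).\<close>

definition cheb_kernel :: "nat \<Rightarrow> real \<Rightarrow> real \<Rightarrow> real" where
  "cheb_kernel k x y = cheb k x + cheb k y + (\<Sum>a\<in>{1..<k}. cheb a x * cheb (k - a) y)"

text \<open>A Christoffel-Darboux argument: the factors 4x - 2 and 4y - 2 shift the Chebyshev
  indices by the recurrence, so the sum multiplied by their difference telescopes.\<close>

lemma phi_diff:
  assumes "k \<ge> 1"
  shows "phi k x - phi k y = (x - y) * cheb_kernel k x y / 2"
proof -
  obtain j where k: "k = Suc j"
    using assms by (cases k) auto
  let ?X = "4 * x - 2" and ?Y = "4 * y - 2"
  have shift: "(4 * t - 2) * cheb a t = cheb (a + 1) t + cheb (a - 1) t" if "a \<ge> 1" for a t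
    using that by (cases a) auto
  define u where "u a = cheb a x * cheb (k + 1 - a) y" for a
  define v where "v a = cheb (a - 1) x * cheb (k - a) y" for a
  have "(?X - ?Y) * (\<Sum>a\<in>{1..<k}. cheb a x * cheb (k - a) y)
      = (\<Sum>a\<in>{1..<k}. (?X * cheb a x) * cheb (k - a) y - cheb a x * (?Y * cheb (k - a) y))"
    by (simp add: sum_distrib_left algebra_simps)
  also have "\<dots> = (\<Sum>a\<in>{1..<k}. (u (Suc a) - u a) - (v (Suc a) - v a))"
  proof (rule sum.cong)
    fix a assume a: "a \<in> {1..<k}"
    have "k - a + 1 = k + 1 - a" "k - a - 1 = k - (a + 1)" "1 \<le> k - a"
      using a by auto
    with a shift[of a x] shift[of "k - a" y]
    show "(?X * cheb a x) * cheb (k - a) y - cheb a x * (?Y * cheb (k - a) y)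
      = (u (Suc a) - u a) - (v (Suc a) - v a)"
      by (simp add: u_def v_def algebra_simps)
  qed simp
  also have "\<dots> = (u k - u 1) - (v k - v 1)"
    by (simp only: sum_subtractf[of "\<lambda>a. u (Suc a) - u a" "\<lambda>a. v (Suc a) - v a"] sum_Suc_diff'[OF assms])
  also have "\<dots> = cheb k x * ?Y - ?X * cheb k y - 2 * cheb j x + 2 * cheb j y"
    by (simp add: u_def v_def k)
  finally have "(?X - ?Y) * cheb_kernel k x y
      = ?X * cheb k x - ?Y * cheb k y - 2 * cheb j x + 2 * cheb j y"
    by (simp add: cheb_kernel_def algebra_simps)
  also have "\<dots> = 8 * phi k x - 8 * phi k y"
    using shift[of k x] shift[of k y] by (simp only: k phi_eq_cheb) (simp add: algebra_simps)
  finally show ?thesis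
    by (simp add: field_simps)
qed

text \<open>Half of the coincident value is the derivative of \<open>phi k\<close>, by the
  continuous-quotient form of differentiability; no sum has to be evaluated.\<close>

lemma cheb_kernel_diag:
  assumes "k \<ge> 1"
  shows "cheb_kernel k t t = real k * cheb k t + 2 * (2 * t - 1) * chebU k t"
proof -
  have "(phi k has_real_derivative cheb_kernel k t t / 2) (at t)"
    unfolding CARAT_DERIV
  proof (intro exI conjI allI)
    show "phi k z - phi k t = cheb_kernel k z t / 2 * (z - t)" for z
      using phi_diff[OF assms, of z t] by simp
    have "continuous_on UNIV (\<lambda>z. cheb_kernel k z t / 2)"
      unfolding cheb_kernel_def by (intro continuous_intros) auto
    then show "isCont (\<lambda>z. cheb_kernel k z t / 2) t"
      by (simp add: continuous_on_eq_continuous_at)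
  qed simp
  from DERIV_unique[OF this DERIV_phi[OF assms]] show ?thesis
    by simp
qed

section \<open>Integration by parts for the Jacobi ensemble\<close>

text \<open>Logarithmic derivatives in a form that also covers functions vanishing identically.\<close>

definition has_log_derivative :: "(real \<Rightarrow> real) \<Rightarrow> real \<Rightarrow> real \<Rightarrow> bool" where
  "has_log_derivative f l y \<longleftrightarrow> (f has_real_derivative f y * l) (at y)"

lemma has_log_derivative_mult:
  "has_log_derivative f l y \<Longrightarrow> has_log_derivative g m y \<Longrightarrow>
     has_log_derivative (\<lambda>y. f y * g y) (l + m) y"
  unfolding has_log_derivative_def
  by (drule (1) DERIV_mult) (simp add: algebra_simps)

lemma has_log_derivative_const: "has_log_derivative (\<lambda>_. c) 0 y"
  by (simp add: has_log_derivative_def)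

lemma has_log_derivative_prod:
  assumes "finite I" "\<And>i. i \<in> I \<Longrightarrow> has_log_derivative (f i) (l i) y"
  shows "has_log_derivative (\<lambda>y. \<Prod>i\<in>I. f i y) (\<Sum>i\<in>I. l i) y"
  using assms
  by (induction I rule: finite_induct) (auto intro: has_log_derivative_mult has_log_derivative_const)

lemma has_log_derivative_powr:
  "y > 0 \<Longrightarrow> has_log_derivative (\<lambda>y. y powr a) (a / y) y"
  unfolding has_log_derivative_def
  by (auto intro!: derivative_eq_intros simp: powr_diff)

lemma has_log_derivative_powr_reflect:
  "y < 1 \<Longrightarrow> has_log_derivative (\<lambda>y. (1 - y) powr b) (- b / (1 - y)) y"
  unfolding has_log_derivative_def
  by (auto intro!: derivative_eq_intros simp: powr_diff)

lemma has_log_derivative_abs_power: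
  assumes "y \<noteq> t" "\<beta> \<ge> 1"
  shows "has_log_derivative (\<lambda>y. \<bar>y - t\<bar> ^ \<beta>) (real \<beta> / (y - t)) y"
proof -
  obtain m where m: "\<beta> = Suc m"
    using assms(2) by (cases \<beta>) auto
  have "((\<lambda>y. \<bar>y - t\<bar>) has_real_derivative sgn (y - t)) (at y)"
  proof (cases "y > t")
    case True
    have "((\<lambda>y. y - t) has_real_derivative 1) (at y)"
      by (auto intro!: derivative_eq_intros)
    moreover have "\<forall>\<^sub>F z in nhds y. \<bar>z - t\<bar> = z - t"
      using eventually_nhds_in_open[of "{t<..}" y] True by (auto elim!: eventually_mono)
    ultimately show ?thesis
      using True by (subst DERIV_cong_ev[OF refl _ refl]) auto
  next
    case False
    have "((\<lambda>y. t - y) has_real_derivative -1) (at y)"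
      by (auto intro!: derivative_eq_intros)
    moreover have "\<forall>\<^sub>F z in nhds y. \<bar>z - t\<bar> = t - z"
      using eventually_nhds_in_open[of "{..<t}" y] False assms(1) by (auto elim!: eventually_mono)
    ultimately show ?thesis
      using False assms(1) by (subst DERIV_cong_ev[OF refl _ refl]) auto
  qed
  from DERIV_power[OF this, of \<beta>]
  have "((\<lambda>y. \<bar>y - t\<bar> ^ \<beta>) has_real_derivative real \<beta> * (sgn (y - t) * \<bar>y - t\<bar> ^ m)) (at y)"
    by (simp add: m mult.assoc)
  also have "real \<beta> * (sgn (y - t) * \<bar>y - t\<bar> ^ m) = \<bar>y - t\<bar> ^ \<beta> * (real \<beta> / (y - t))"
    using assms(1) by (simp add: m sgn_if abs_if field_simps)
  finally show ?thesis
    unfolding has_log_derivative_def .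
qed

lemma has_log_derivative_abs_power':
  assumes "y \<noteq> t" "\<beta> \<ge> 1"
  shows "has_log_derivative (\<lambda>y. \<bar>t - y\<bar> ^ \<beta>) (real \<beta> / (y - t)) y"
  using has_log_derivative_abs_power[OF assms] by (simp add: abs_minus_commute)

section \<open>Density, bounds and integration by parts in one coordinate\<close>

locale jacobi_ensemble =
  fixes n \<beta> :: nat and a b :: real
  assumes n: "n \<ge> 1" and \<beta>: "\<beta> \<ge> 1" and a: "a > -1" and b: "b > -1"
begin

abbreviation M :: "(nat \<Rightarrow> real) measure" where
  "M \<equiv> \<Pi>\<^sub>M j\<in>{..<n}. lborel"

text \<open>The indicator is part of the weight, so that integrals run over the whole product space
  and Fubini applies without a domain.\<close>

definition wt :: "real \<Rightarrow> real" where
  "wt t = indicator {0..1} t * (t powr a * (1 - t) powr b)"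

definition wts :: "(nat \<Rightarrow> real) \<Rightarrow> real" where
  "wts T = (\<Prod>j<n. wt (T j))"

definition vdm :: "(nat \<Rightarrow> real) \<Rightarrow> real" where
  "vdm T = (\<Prod>k<n. \<Prod>j<k. \<bar>T k - T j\<bar> ^ \<beta>)"

definition cube :: "(nat \<Rightarrow> real) set" where
  "cube = {T. \<forall>j<n. T j \<in> {0..1}}"

definition wint :: "((nat \<Rightarrow> real) \<Rightarrow> real) \<Rightarrow> real" where
  "wint f = integral\<^sup>L M (\<lambda>T. wts T * vdm T * f T)"

lemma integrable_wt: "integrable lborel wt"
  using integrable_Beta[of "a + 1" "b + 1"] a b
  by (simp add: set_integrable_def wt_def[abs_def])

lemma wt_nonneg: "wt t \<ge> 0"
  by (simp add: wt_def)

lemma wts_nonneg: "wts T \<ge> 0"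
  unfolding wts_def by (intro prod_nonneg) (simp add: wt_nonneg)

lemma measurable_coord: "j < n \<Longrightarrow> (\<lambda>T. T j) \<in> borel_measurable M"
  using measurable_component_singleton[of j "{..<n}" "\<lambda>_. lborel"] by simp

lemma measurable_coord_comp: "f \<in> borel_measurable borel \<Longrightarrow> j < n \<Longrightarrow> (\<lambda>T. f (T j)) \<in> borel_measurable M"
  using measurable_compose[OF measurable_coord] .

lemma measurable_vdm: "vdm \<in> borel_measurable M"
  unfolding vdm_def
  by (intro borel_measurable_prod borel_measurable_power borel_measurable_abs borel_measurable_diff measurable_coord)
    auto

lemma integrable_wts: "integrable M wts"
proof -
  interpret product_sigma_finite "\<lambda>_. lborel :: real measure"
    by standard
  show ?thesis
    unfolding wts_def by (rule product_integrable_prod) (auto intro: integrable_wt)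
qed

lemma wts_outside: "T \<notin> cube \<Longrightarrow> wts T = 0"
  by (force simp: cube_def wts_def wt_def indicator_def not_le)

lemma integrable_wts_mult:
  assumes [measurable]: "f \<in> borel_measurable M" and "\<And>T. T \<in> cube \<Longrightarrow> \<bar>f T\<bar> \<le> C"
  shows "integrable M (\<lambda>T. wts T * f T)"
proof (rule Bochner_Integration.integrable_bound)
  show "integrable M (\<lambda>T. C * wts T)"
    using integrable_wts by simp
  show "(\<lambda>T. wts T * f T) \<in> borel_measurable M"
    using borel_measurable_integrable[OF integrable_wts] by measurable
  show "AE T in M. norm (wts T * f T) \<le> norm (C * wts T)"
  proof (rule AE_I2)
    fix T
    show "norm (wts T * f T) \<le> norm (C * wts T)"
    proof (cases "T \<in> cube")
      case True
      then have "\<bar>f T\<bar> \<le> \<bar>C\<bar>"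
        using assms(2) by force
      then show ?thesis
        using mult_right_mono[of "\<bar>f T\<bar>" "\<bar>C\<bar>" "\<bar>wts T\<bar>"] by (simp add: abs_mult mult.commute)
    qed (simp add: wts_outside)
  qed
qed

lemma coord_diff_le: "T \<in> cube \<Longrightarrow> i < n \<Longrightarrow> j < n \<Longrightarrow> \<bar>T i - T j\<bar> \<le> 1"
  by (simp add: cube_def abs_le_iff) (smt (verit))

lemma vdm_nonneg: "vdm T \<ge> 0"
  unfolding vdm_def by (intro prod_nonneg) auto

text \<open>On the cube every factor is at most 1, and \<beta> \<ge> 1 keeps at least the first
  power of the chosen one. Hence \<open>vdm\<close> compensates a singularity 1/(T_j - T_i), even
  for \<beta> = 1.\<close>

lemma vdm_le_diff:
  assumes "T \<in> cube" "j < k" "k < n"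
  shows "vdm T \<le> \<bar>T k - T j\<bar>"
proof -
  have f: "0 \<le> \<bar>T k - T j\<bar> ^ \<beta> \<and> \<bar>T k - T j\<bar> ^ \<beta> \<le> 1" if "k < n" "j < n" for j k
    using coord_diff_le[OF assms(1) that] by (auto intro: power_le_one)
  have inner: "0 \<le> (\<Prod>j<k. \<bar>T k - T j\<bar> ^ \<beta>) \<and> (\<Prod>j<k. \<bar>T k - T j\<bar> ^ \<beta>) \<le> 1" if "k < n" for k
    using that f by (auto intro!: prod_nonneg prod_le_1)
  have "vdm T = (\<Prod>j<k. \<bar>T k - T j\<bar> ^ \<beta>) * (\<Prod>i\<in>{..<n} - {k}. \<Prod>j<i. \<bar>T i - T j\<bar> ^ \<beta>)"
    unfolding vdm_def using assms by (subst prod.remove[of _ k]) auto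
  also have "\<dots> \<le> (\<Prod>j<k. \<bar>T k - T j\<bar> ^ \<beta>) * 1"
    using inner assms by (intro mult_left_mono prod_le_1) (auto intro!: prod_nonneg)
  also have "\<dots> = \<bar>T k - T j\<bar> ^ \<beta> * (\<Prod>i\<in>{..<k} - {j}. \<bar>T k - T i\<bar> ^ \<beta>)"
    using assms by (simp add: prod.remove[of _ j])
  also have "\<dots> \<le> \<bar>T k - T j\<bar> ^ \<beta> * 1"
    using f assms by (intro mult_left_mono prod_le_1) auto
  also have "\<dots> \<le> \<bar>T k - T j\<bar> ^ 1"
    using coord_diff_le[OF assms(1), of k j] \<beta> assms by (subst mult_1_right, intro power_decreasing) auto
  finally show ?thesis
    by simp
qed

lemma vdm_div_diff:
  assumes "T \<in> cube" "i < n" "j < n" "i \<noteq> j"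
  shows "\<bar>vdm T / (T j - T i)\<bar> \<le> 1"
proof -
  have "vdm T \<le> \<bar>T j - T i\<bar>"
    using vdm_le_diff[OF assms(1), of i j] vdm_le_diff[OF assms(1), of j i] assms
    by (cases i j rule: linorder_cases) (auto simp: abs_minus_commute)
  then show ?thesis
    using vdm_nonneg[of T] by (simp add: abs_divide divide_le_eq_1)
qed

lemma vdm_le_1: "T \<in> cube \<Longrightarrow> \<bar>vdm T\<bar> \<le> 1"
proof -
  assume T: "T \<in> cube"
  have "0 \<le> \<bar>T k - T j\<bar> ^ \<beta> \<and> \<bar>T k - T j\<bar> ^ \<beta> \<le> 1" if "k < n" "j < n" for j k
    using coord_diff_le[OF T that] by (auto intro: power_le_one)
  then have "vdm T \<le> 1"
    unfolding vdm_def by (intro prod_le_1) (auto intro!: prod_nonneg prod_le_1)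
  then show ?thesis
    using vdm_nonneg[of T] by simp
qed

lemma vdm_coincidence:
  assumes "i < n" "j < n" "i \<noteq> j" "T i = T j"
  shows "vdm T = 0"
proof -
  have "vdm T = 0" if "j < k" "k < n" "T k = T j" for j k
    unfolding vdm_def using that \<beta> by (intro prod_zero bexI[of _ k] bexI[of _ j]) auto
  then show ?thesis
    using assms by (cases i j rule: linorder_cases) auto
qed

lemma has_log_derivative_vdm:
  assumes "j < n" "\<And>i. i < n \<Longrightarrow> i \<noteq> j \<Longrightarrow> y \<noteq> T i"
  shows "has_log_derivative (\<lambda>y. vdm (T(j := y))) (\<Sum>i\<in>{..<n} - {j}. real \<beta> / (y - T i)) y"
proof -
  define l where "l k i = (if k = j then real \<beta> / (y - T i) else if i = j then real \<beta> / (y - T k) else 0)" for k i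
  have "has_log_derivative (\<lambda>y. vdm (T(j := y))) (\<Sum>k<n. \<Sum>i<k. l k i) y"
    unfolding vdm_def
  proof (intro has_log_derivative_prod)
    fix k i assume ki: "k \<in> {..<n}" "i \<in> {..<k}"
    show "has_log_derivative (\<lambda>y. \<bar>(T(j := y)) k - (T(j := y)) i\<bar> ^ \<beta>) (l k i) y"
    proof (cases "k = j")
      case True
      then show ?thesis
        using ki assms(1) assms(2)[of i] \<beta> by (auto simp: l_def intro!: has_log_derivative_abs_power)
    next
      case False
      then show ?thesis
        using ki assms(1) assms(2)[of k] \<beta> by (cases "i = j") (auto simp: l_def intro!: has_log_derivative_abs_power' has_log_derivative_const)
    qed
  qed auto
  also have "(\<Sum>k<n. \<Sum>i<k. l k i) = (\<Sum>k<n. if k = j then \<Sum>i<j. real \<beta> / (y - T i)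
      else if j < k then real \<beta> / (y - T k) else 0)"
    by (intro sum.cong) (auto simp: l_def sum.delta)
  also have "\<dots> = (\<Sum>i<j. real \<beta> / (y - T i)) + (\<Sum>k\<in>{..<n} - {j}. if j < k then real \<beta> / (y - T k) else 0)"
    using assms(1) by (subst sum.remove[of _ j]) (auto intro!: sum.cong)
  also have "(\<Sum>i<j. real \<beta> / (y - T i)) = (\<Sum>k\<in>{..<n} - {j}. if k < j then real \<beta> / (y - T k) else 0)"
    using assms(1) by (intro sum.mono_neutral_cong_left) auto
  also have "\<dots> + (\<Sum>k\<in>{..<n} - {j}. if j < k then real \<beta> / (y - T k) else 0)
      = (\<Sum>i\<in>{..<n} - {j}. real \<beta> / (y - T i))"
    unfolding sum.distrib[symmetric] by (intro sum.cong) auto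
  finally show ?thesis .
qed

text \<open>The divergence of the field \<open>phi k\<close> in the coordinate j relative to the
  density: its derivative plus \<open>phi k\<close> times the logarithmic derivative of the density.
  The poles at 0 and 1 are already cancelled by the zeros of \<open>phi k\<close>.\<close>

definition score :: "nat \<Rightarrow> nat \<Rightarrow> (nat \<Rightarrow> real) \<Rightarrow> real" where
  "score k j T = real k / 2 * cheb k (T j) + (2 * T j - 1) * chebU k (T j)
     + a * (- 2 * (1 - T j) * chebU k (T j)) + b * (2 * T j * chebU k (T j))
     + (\<Sum>i\<in>{..<n} - {j}. phi k (T j) * (real \<beta> / (T j - T i)))"

text \<open>The boundary terms vanish because \<open>phi k\<close> has simple zeros at both endpoints and
  \<open>a, b > -1\<close>; the coincidences \<open>y = T i\<close> are finitely many exceptional points.\<close>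

lemma inner_integral_zero:
  assumes "k \<ge> 1" "j < n"
    and dF: "\<And>y. ((\<lambda>y. F (T(j := y))) has_real_derivative F' (T(j := y))) (at y)"
  shows "(LINT y|lborel. wt y * (vdm (T(j := y)) * (score k j (T(j := y)) * F (T(j := y))
           + phi k y * F' (T(j := y))))) = 0" (is "(LINT y|lborel. ?f y) = 0")
\<comment> \<open>Without integrability the Bochner integral is 0 by convention, so the claim holds
  on every slice and not only on almost all of them.\<close>
proof (cases "integrable lborel ?f")
  case True
  define D where "D y = y powr a * (1 - y) powr b * vdm (T(j := y))" for y
  \<comment> \<open>The antiderivative: field times density times \<open>F\<close>, with the factors
    y and 1 - y absorbed into the powers. The exponents a + 1 and b + 1 are positive, so it is
    continuous up to the endpoints and vanishes there.\<close>
  define h where "h y = - 2 * chebU k y * (y powr (a + 1) * (1 - y) powr (b + 1)) * vdm (T(j := y)) * F (T(j := y))" for y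
  define S where "S = T ` ({..<n} - {j})"
  have "(?f has_integral (h 1 - h 0)) {0..1}"
  proof (rule fundamental_theorem_of_calculus_interior_strong[where S = S])
    show "finite S"
      by (simp add: S_def)
    show "continuous_on {0..1} h"
    proof -
      have c1: "continuous_on {0..1} (\<lambda>y. F (T(j := y)))"
        by (intro continuous_at_imp_continuous_on ballI DERIV_isCont[OF dF])
      have c2: "continuous_on {0..1} (\<lambda>y. vdm (T(j := y)))"
      proof -
        have "continuous_on {0..1} (\<lambda>y. (T(j := y)) k)" for k
          by (cases "k = j") (auto intro: continuous_intros)
        then show ?thesis
          unfolding vdm_def by (intro continuous_intros)
      qed
      have c3: "continuous_on {0..1} (\<lambda>y :: real. y powr (a + 1) * (1 - y) powr (b + 1))"
        using a b by (intro continuous_on_mult continuous_on_powr' continuous_intros) auto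
      show ?thesis
        unfolding h_def
        by (intro continuous_on_mult[OF continuous_on_mult[OF continuous_on_mult[OF _ c3] c2] c1] continuous_intros)
    qed
    fix y assume y: "y \<in> {0<..<1} - S"
    have "has_log_derivative D (a / y + - b / (1 - y) + (\<Sum>i\<in>{..<n} - {j}. real \<beta> / (y - T i))) y"
      unfolding D_def
      by (intro has_log_derivative_mult has_log_derivative_powr has_log_derivative_powr_reflect
          has_log_derivative_vdm) (use y assms(2) in \<open>auto simp: S_def\<close>)
    then have dD: "(D has_real_derivative D y * (a / y + - b / (1 - y) + (\<Sum>i\<in>{..<n} - {j}. real \<beta> / (y - T i)))) (at y)"
      by (simp add: has_log_derivative_def)
    have "((\<lambda>y. phi k y * F (T(j := y)) * D y) has_real_derivative
        ((real k / 2 * cheb k y + (2 * y - 1) * chebU k y) * F (T(j := y)) + phi k y * F' (T(j := y))) * D y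
        + phi k y * F (T(j := y)) * (D y * (a / y + - b / (1 - y) + (\<Sum>i\<in>{..<n} - {j}. real \<beta> / (y - T i))))) (at y)"
      by (rule derivative_eq_intros DERIV_phi[OF assms(1)] dF dD refl)+ (simp add: algebra_simps)
    also have "((real k / 2 * cheb k y + (2 * y - 1) * chebU k y) * F (T(j := y)) + phi k y * F' (T(j := y))) * D y
        + phi k y * F (T(j := y)) * (D y * (a / y + - b / (1 - y) + (\<Sum>i\<in>{..<n} - {j}. real \<beta> / (y - T i)))) = ?f y"
    proof -
      have "phi k y * (a / y) = a * (- 2 * (1 - y) * chebU k y)"
        using y by (auto simp: phi_def algebra_simps)
      moreover have "phi k y * (- b / (1 - y)) = b * (2 * y * chebU k y)"
        using y by (auto simp: phi_def)
      moreover have "phi k y * (\<Sum>i\<in>{..<n} - {j}. real \<beta> / (y - T i))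
          = (\<Sum>i\<in>{..<n} - {j}. phi k y * (real \<beta> / (y - (T(j := y)) i)))"
        by (simp add: sum_distrib_left)
      ultimately have sc: "score k j (T(j := y)) = real k / 2 * cheb k y + (2 * y - 1) * chebU k y
          + phi k y * (a / y + - b / (1 - y) + (\<Sum>i\<in>{..<n} - {j}. real \<beta> / (y - T i)))"
        by (simp only: score_def fun_upd_same distrib_left add.assoc)
      show ?thesis
        using y unfolding sc by (simp add: wt_def D_def algebra_simps)
    qed
    finally have "((\<lambda>y. phi k y * F (T(j := y)) * D y) has_real_derivative ?f y) (at y)" .
    moreover have "\<forall>\<^sub>F z in nhds y. phi k z * F (T(j := z)) * D z = h z"
    proof -
      have "\<forall>\<^sub>F z in nhds y. z \<in> {0<..<1}"
        using y by (intro eventually_nhds_in_open) auto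
      then show ?thesis
        by eventually_elim (simp add: h_def D_def phi_def powr_add)
    qed
    ultimately show "(h has_vector_derivative ?f y) (at y)"
      unfolding has_real_derivative_iff_has_vector_derivative[symmetric]
      by (subst (asm) DERIV_cong_ev[OF refl _ refl]) auto
  qed simp
  moreover have "h 1 - h 0 = 0"
    by (simp add: h_def)
  ultimately have "(?f has_integral 0) {0..1}"
    by simp
  then have "(?f has_integral 0) UNIV"
    by (rule has_integral_on_superset) (auto simp: wt_def)
  moreover have "(?f has_integral (LINT y|lborel. ?f y)) UNIV"
    by (rule has_integral_integral_lborel[OF True])
  ultimately show ?thesis
    by (rule has_integral_unique[symmetric])
qed (simp add: not_integrable_integral_eq)

lemma bounded_chebU: "\<exists>C. \<forall>t\<in>{0..1}. \<bar>chebU k t\<bar> \<le> C"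
proof -
  have "bounded (chebU k ` {0..1})"
    by (intro compact_imp_bounded compact_continuous_image continuous_on_chebU continuous_on_id) auto
  then show ?thesis
    by (auto simp: bounded_iff)
qed

lemma measurable_score:
  assumes "j < n"
  shows "score k j \<in> borel_measurable M"
  unfolding score_def phi_def using assms
  by (intro borel_measurable_add borel_measurable_times borel_measurable_sum borel_measurable_divide
      borel_measurable_diff borel_measurable_const measurable_coord measurable_coord_comp measurable_cheb measurable_chebU)
    auto

lemma bounded_vdm_score:
  assumes "j < n"
  shows "\<exists>C. \<forall>T\<in>cube. \<bar>vdm T * score k j T\<bar> \<le> C"
proof -
  obtain C where C: "\<bar>chebU k t\<bar> \<le> C" if "t \<in> {0..1}" for t
    using bounded_chebU[of k] by blast
  have C0: "C \<ge> 0"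
    using C[of 0] by auto
  show ?thesis
  proof (intro exI ballI)
    fix T assume T: "T \<in> cube"
    then have Tj: "T j \<in> {0..1}"
      using assms by (auto simp: cube_def)
    note U = C[OF Tj]
    have U': "\<bar>r * chebU k (T j)\<bar> \<le> 2 * C" if "\<bar>r\<bar> \<le> 2" for r
      using mult_mono[OF that U] by (simp add: abs_mult)
    have p: "\<bar>phi k (T j)\<bar> \<le> 2 * C"
      unfolding phi_def using Tj by (intro U') (auto simp: abs_mult intro!: mult_le_one)
    have t1: "\<bar>real k / 2 * cheb k (T j)\<bar> \<le> real k"
      using abs_cheb_le[OF Tj, of k] by (simp add: abs_mult) (metis mult.commute mult_le_cancel_left_pos mult_left_mono of_nat_0_le_iff)
    have t2: "\<bar>(2 * T j - 1) * chebU k (T j)\<bar> \<le> 2 * C"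
      using Tj by (intro U') auto
    have t3: "\<bar>a * (- 2 * (1 - T j) * chebU k (T j))\<bar> \<le> \<bar>a\<bar> * (2 * C)"
      unfolding abs_mult[of a] using Tj by (intro mult_left_mono U') auto
    have t4: "\<bar>b * (2 * T j * chebU k (T j))\<bar> \<le> \<bar>b\<bar> * (2 * C)"
      unfolding abs_mult[of b] using Tj by (intro mult_left_mono U') auto
    have t5: "\<bar>vdm T * (\<Sum>i\<in>{..<n} - {j}. phi k (T j) * (real \<beta> / (T j - T i)))\<bar> \<le> (\<Sum>i\<in>{..<n} - {j}. real \<beta> * (2 * C))"
    proof -
      have "\<bar>vdm T * (\<Sum>i\<in>{..<n} - {j}. phi k (T j) * (real \<beta> / (T j - T i)))\<bar>
          = \<bar>\<Sum>i\<in>{..<n} - {j}. real \<beta> * (phi k (T j) * (vdm T / (T j - T i)))\<bar>"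
        by (simp add: sum_distrib_left mult_ac)
      also have "\<dots> \<le> (\<Sum>i\<in>{..<n} - {j}. \<bar>real \<beta> * (phi k (T j) * (vdm T / (T j - T i)))\<bar>)"
        by (rule sum_abs)
      also have "\<dots> \<le> (\<Sum>i\<in>{..<n} - {j}. real \<beta> * (2 * C))"
      proof (rule sum_mono)
        fix i assume i: "i \<in> {..<n} - {j}"
        have "\<bar>phi k (T j)\<bar> * \<bar>vdm T / (T j - T i)\<bar> \<le> (2 * C) * 1"
          using i assms T C0 by (intro mult_mono p vdm_div_diff) auto
        then show "\<bar>real \<beta> * (phi k (T j) * (vdm T / (T j - T i)))\<bar> \<le> real \<beta> * (2 * C)"
          by (simp only: abs_mult abs_of_nat mult_1_right) (intro mult_left_mono, auto)
      qed
      finally show ?thesis .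
    qed
    define A where "A = real k / 2 * cheb k (T j) + (2 * T j - 1) * chebU k (T j)
     + a * (- 2 * (1 - T j) * chebU k (T j)) + b * (2 * T j * chebU k (T j))"
    have "\<bar>A\<bar> \<le> real k + 2 * C + \<bar>a\<bar> * (2 * C) + \<bar>b\<bar> * (2 * C)"
      unfolding A_def using t1 t2 t3 t4 by linarith
    then have "\<bar>vdm T * A\<bar> \<le> 1 * (real k + 2 * C + \<bar>a\<bar> * (2 * C) + \<bar>b\<bar> * (2 * C))"
      unfolding abs_mult by (intro mult_mono vdm_le_1 T) auto
    moreover have "vdm T * score k j T = vdm T * A + vdm T * (\<Sum>i\<in>{..<n} - {j}. phi k (T j) * (real \<beta> / (T j - T i)))"
      by (simp only: score_def A_def distrib_left)
    ultimately show "\<bar>vdm T * score k j T\<bar> \<le> 1 * (real k + 2 * C + \<bar>a\<bar> * (2 * C) + \<bar>b\<bar> * (2 * C))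
        + (\<Sum>i\<in>{..<n} - {j}. real \<beta> * (2 * C))"
      by (simp only:) (intro order_trans[OF abs_triangle_ineq] add_mono t5)
  qed
qed

lemma integration_by_parts:
  assumes "k \<ge> 1" "j < n"
    and dF: "\<And>T y. ((\<lambda>y. F (T(j := y))) has_real_derivative F' (T(j := y))) (at y)"
    and F: "F \<in> borel_measurable M" "\<And>T. T \<in> cube \<Longrightarrow> \<bar>F T\<bar> \<le> C"
    and F': "F' \<in> borel_measurable M" "\<And>T. T \<in> cube \<Longrightarrow> \<bar>F' T\<bar> \<le> C'"
  shows "integrable M (\<lambda>T. wts T * (vdm T * (score k j T * F T + phi k (T j) * F' T)))"
    and "integral\<^sup>L M (\<lambda>T. wts T * (vdm T * (score k j T * F T + phi k (T j) * F' T))) = 0"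
proof -
  interpret product_sigma_finite "\<lambda>_. lborel :: real measure"
    by standard
  let ?f = "\<lambda>T. wts T * (vdm T * (score k j T * F T + phi k (T j) * F' T))"
  obtain C1 where C1: "\<bar>vdm T * score k j T\<bar> \<le> C1" if "T \<in> cube" for T
    using bounded_vdm_score[OF assms(2), of k] by blast
  obtain C2 where C2: "\<bar>chebU k t\<bar> \<le> C2" if "t \<in> {0..1}" for t
    using bounded_chebU[of k] by blast
  show int: "integrable M ?f"
  proof (rule integrable_wts_mult[where C = "C1 * C + 2 * C2 * C'"])
    show "(\<lambda>T. vdm T * (score k j T * F T + phi k (T j) * F' T)) \<in> borel_measurable M"
      using F(1) F'(1) measurable_vdm measurable_score[OF assms(2)] measurable_coord[OF assms(2)]
        measurable_coord_comp[OF measurable_chebU assms(2)]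
      unfolding phi_def by (intro borel_measurable_times borel_measurable_add borel_measurable_diff borel_measurable_const)
    fix T assume T: "T \<in> cube"
    then have Tj: "T j \<in> {0..1}"
      using assms(2) by (auto simp: cube_def)
    have "\<bar>(vdm T * score k j T) * F T\<bar> \<le> C1 * C"
      unfolding abs_mult[of _ "F T"] using C1[OF T] F(2)[OF T] by (intro mult_mono) auto
    moreover have "\<bar>vdm T * (phi k (T j) * F' T)\<bar> \<le> 1 * (2 * C2 * C')"
    proof -
      have "\<bar>(2 * (T j * (1 - T j))) * chebU k (T j)\<bar> \<le> 2 * C2"
        unfolding abs_mult[of _ "chebU k (T j)"]
        using Tj C2[OF Tj] by (intro mult_mono) (auto simp: abs_mult intro!: mult_le_one)
      then have "\<bar>phi k (T j)\<bar> \<le> 2 * C2"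
        by (simp add: phi_def abs_mult mult_ac)
      then have "\<bar>phi k (T j) * F' T\<bar> \<le> 2 * C2 * C'"
        unfolding abs_mult using F'(2)[OF T] by (intro mult_mono) auto
      then show ?thesis
        unfolding abs_mult[of "vdm T"] using vdm_le_1[OF T] by (intro mult_mono) auto
    qed
    moreover have "vdm T * (score k j T * F T + phi k (T j) * F' T)
        = (vdm T * score k j T) * F T + vdm T * (phi k (T j) * F' T)"
      by (simp add: algebra_simps)
    ultimately show "\<bar>vdm T * (score k j T * F T + phi k (T j) * F' T)\<bar> \<le> C1 * C + 2 * C2 * C'"
      by linarith
  qed
  \<comment> \<open>Fubini with the coordinate j innermost, where the weights of the other
    coordinates are constants.\<close>
  have ins: "{..<n} = insert j ({..<n} - {j})"
    using assms(2) by auto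
  have "integral\<^sup>L M ?f = (\<integral>T. (\<integral>y. ?f (T(j := y)) \<partial>lborel) \<partial>(\<Pi>\<^sub>M i\<in>{..<n} - {j}. lborel))"
    using product_integral_insert[of "{..<n} - {j}" j ?f] int ins by simp
  also have "\<dots> = (\<integral>T. 0 \<partial>(\<Pi>\<^sub>M i\<in>{..<n} - {j}. (lborel :: real measure)))"
  proof (rule Bochner_Integration.integral_cong[OF refl])
    fix T
    have "wts (T(j := y)) = (\<Prod>i\<in>{..<n} - {j}. wt (T i)) * wt y" for y
      unfolding wts_def using assms(2) by (subst prod.remove[of _ j]) (auto intro!: prod.cong)
    then have "(\<integral>y. ?f (T(j := y)) \<partial>lborel) = (\<integral>y. (\<Prod>i\<in>{..<n} - {j}. wt (T i)) * (wt y * (vdm (T(j := y)) * (score k j (T(j := y)) * F (T(j := y))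
           + phi k y * F' (T(j := y))))) \<partial>lborel)"
      by (simp add: mult.assoc)
    also have "\<dots> = 0"
      using inner_integral_zero[OF assms(1,2), of F T F'] dF by simp
    finally show "(\<integral>y. ?f (T(j := y)) \<partial>lborel) = 0" .
  qed
  finally show "integral\<^sup>L M ?f = 0"
    by simp
qed

end

text \<open>Lengths add over a split, so a factor exponential in the length passes through products;
  this makes the rescaling compatible with the loop equations.\<close>

lemma conv_scale:
  "conv (\<lambda>ys. c ^ length ys * f ys) (\<lambda>zs. c ^ length zs * g zs) xs = c ^ length xs * conv f g xs"
proof -
  have "conv (\<lambda>ys. c ^ length ys * f ys) (\<lambda>zs. c ^ length zs * g zs) xs
      = conv (\<lambda>ys. c ^ length xs * f ys) g xs"
  proof (rule conv_cong)
    fix ys zs assume "(ys, zs) \<in> set (splits xs)"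
    from splits_cases(1)[OF this] have l: "c ^ length xs = c ^ length ys * c ^ length zs"
      by (simp flip: power_add)
    show "c ^ length ys * f ys * (c ^ length zs * g zs) = c ^ length xs * f ys * g zs"
      unfolding l by (simp only: mult_ac)
  qed
  then show ?thesis
    by (simp add: conv_cmult_left)
qed

section \<open>Chebyshev sums and bounded observables\<close>

context jacobi_ensemble
begin

definition X :: "nat \<Rightarrow> (nat \<Rightarrow> real) \<Rightarrow> real" where
  "X k T = (\<Sum>j<n. cheb k (T j))"

definition mon :: "nat list \<Rightarrow> (nat \<Rightarrow> real) \<Rightarrow> real" where
  "mon xs T = (\<Prod>k\<leftarrow>xs. X k T)"

definition dmon :: "nat \<Rightarrow> nat list \<Rightarrow> (nat \<Rightarrow> real) \<Rightarrow> real" where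
  "dmon j xs T = pick_sum (\<lambda>m ys. 4 * real m * chebU m (T j) * mon ys T) xs"

lemma X_0 [simp]: "X 0 T = 2 * real n"
  by (simp add: X_def)

lemma mon_simps [simp]: "mon [] T = 1" "mon (x # xs) T = X x T * mon xs T"
  by (simp_all add: mon_def)

lemma dmon_simps:
  "dmon j [] T = 0"
  "dmon j (x # xs) T = 4 * real x * chebU x (T j) * mon xs T + X x T * dmon j xs T"
proof -
  show "dmon j (x # xs) T = 4 * real x * chebU x (T j) * mon xs T + X x T * dmon j xs T"
    unfolding dmon_def pick_sum_Cons pick_sum_cmult[symmetric]
    by (intro arg_cong2[of _ _ _ _ "(+)"] pick_sum_cong) (simp_all add: mult_ac)
qed (simp add: dmon_def)

lemma DERIV_X:
  assumes "j < n"
  shows "((\<lambda>y. X k (T(j := y))) has_real_derivative 4 * real k * chebU k y) (at y)"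
proof -
  have "X k (T(j := y)) = cheb k y + (\<Sum>i\<in>{..<n} - {j}. cheb k (T i))" for y
    unfolding X_def using assms by (subst sum.remove[of _ j]) (auto intro!: sum.cong)
  then show ?thesis
    by (auto intro!: derivative_eq_intros DERIV_cheb)
qed

lemma DERIV_mon:
  assumes "j < n"
  shows "((\<lambda>y. mon xs (T(j := y))) has_real_derivative dmon j xs (T(j := y))) (at y)"
proof (induction xs)
  case (Cons x xs)
  have "((\<lambda>y. X x (T(j := y)) * mon xs (T(j := y))) has_real_derivative
      (4 * real x * chebU x y) * mon xs (T(j := y)) + dmon j xs (T(j := y)) * X x (T(j := y))) (at y)"
    by (rule DERIV_mult[OF DERIV_X[OF assms] Cons])
  then show ?case
    by (simp only: mon_simps dmon_simps fun_upd_same mult.commute[of "dmon j xs (T(j := y))"])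
qed (simp add: dmon_simps)

definition observable :: "((nat \<Rightarrow> real) \<Rightarrow> real) \<Rightarrow> bool" where
  "observable f \<longleftrightarrow> f \<in> borel_measurable M \<and> (\<exists>C. \<forall>T\<in>cube. \<bar>f T\<bar> \<le> C)"

lemma observable_const: "observable (\<lambda>_. c)"
  by (auto simp: observable_def)

lemma observable_add:
  assumes "observable f" "observable g"
  shows "observable (\<lambda>T. f T + g T)"
proof -
  obtain C D where "\<forall>T\<in>cube. \<bar>f T\<bar> \<le> C" "\<forall>T\<in>cube. \<bar>g T\<bar> \<le> D"
    using assms by (auto simp: observable_def)
  then have "\<forall>T\<in>cube. \<bar>f T + g T\<bar> \<le> C + D"
    by (auto intro: order_trans[OF abs_triangle_ineq] add_mono)
  then show ?thesis
    using assms by (auto simp: observable_def)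
qed

lemma observable_mult:
  assumes "observable f" "observable g"
  shows "observable (\<lambda>T. f T * g T)"
proof -
  obtain C D where CD: "\<forall>T\<in>cube. \<bar>f T\<bar> \<le> C" "\<forall>T\<in>cube. \<bar>g T\<bar> \<le> D"
    using assms by (auto simp: observable_def)
  have "\<bar>f T * g T\<bar> \<le> C * D" if "T \<in> cube" for T
    unfolding abs_mult using CD that by (intro mult_mono) fastforce+
  then show ?thesis
    using assms by (auto simp: observable_def)
qed

lemma observable_cmult: "observable f \<Longrightarrow> observable (\<lambda>T. c * f T)"
  by (intro observable_mult observable_const)

lemma observable_diff: "observable f \<Longrightarrow> observable g \<Longrightarrow> observable (\<lambda>T. f T - g T)"
  using observable_add[of f "\<lambda>T. -1 * g T"] observable_cmult[of g "-1"] by simp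

lemma observable_sum:
  "(\<And>i. i \<in> I \<Longrightarrow> observable (f i)) \<Longrightarrow> observable (\<lambda>T. \<Sum>i\<in>I. f i T)"
  by (induction I rule: infinite_finite_induct) (auto intro: observable_add observable_const)

lemma observable_coord_comp:
  assumes "j < n" "continuous_on UNIV f"
  shows "observable (\<lambda>T. f (T j))"
proof -
  have "bounded (f ` {0..1})"
    using assms(2) by (intro compact_imp_bounded compact_continuous_image) (auto intro: continuous_on_subset)
  then obtain C where C: "\<forall>t\<in>{0..1}. \<bar>f t\<bar> \<le> C"
    by (auto simp: bounded_iff)
  have "(\<lambda>T. f (T j)) \<in> borel_measurable M"
    by (intro measurable_coord_comp borel_measurable_continuous_onI assms)
  with C assms(1) show ?thesis
    by (auto simp: observable_def cube_def intro!: exI[of _ C])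
qed

lemma observable_X: "observable (X k)"
  unfolding X_def
  by (intro observable_sum observable_coord_comp continuous_on_cheb continuous_on_id) auto

lemma observable_mon: "observable (mon xs)"
proof (induction xs)
  case (Cons x xs)
  from observable_mult[OF observable_X Cons] show ?case by simp
qed (simp add: observable_const)

lemma observable_pick_sum:
  "(\<And>y ys. observable (\<lambda>T. G T y ys)) \<Longrightarrow> observable (\<lambda>T. pick_sum (G T) xs)"
  by (induction xs arbitrary: G) (auto simp: pick_sum_Cons intro: observable_add observable_const)

lemma observable_dmon: "j < n \<Longrightarrow> observable (dmon j xs)"
  unfolding dmon_def
  by (intro observable_pick_sum observable_mult observable_mon observable_const
      observable_coord_comp continuous_on_chebU continuous_on_id) auto

lemma integrable_weight:
  assumes "observable f"
  shows "integrable M (\<lambda>T. wts T * vdm T * f T)"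
proof -
  obtain C where C: "\<forall>T\<in>cube. \<bar>f T\<bar> \<le> C" and m: "f \<in> borel_measurable M"
    using assms by (auto simp: observable_def)
  have "integrable M (\<lambda>T. wts T * (vdm T * f T))"
  proof (rule integrable_wts_mult[where C = C])
    show "(\<lambda>T. vdm T * f T) \<in> borel_measurable M"
      using m measurable_vdm by measurable
    show "\<bar>vdm T * f T\<bar> \<le> C" if "T \<in> cube" for T
      using mult_mono[OF vdm_le_1[OF that] C[rule_format, OF that]] by (simp add: abs_mult)
  qed
  then show ?thesis
    by (simp add: mult.assoc)
qed

lemma wint_add: "observable f \<Longrightarrow> observable g \<Longrightarrow> wint (\<lambda>T. f T + g T) = wint f + wint g"
  unfolding wint_def using integrable_weight by (simp add: distrib_left)

lemma wint_cmult: "wint (\<lambda>T. c * f T) = c * wint f"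
  unfolding wint_def by (simp add: mult.left_commute)

lemma wint_one_pos: "wint (\<lambda>_. 1) > 0"
proof -
  interpret product_sigma_finite "\<lambda>_. lborel :: real measure"
    by standard
  have nonneg: "wts T * vdm T \<ge> 0" for T
    by (simp add: wts_nonneg vdm_nonneg)
  have int: "integrable M (\<lambda>T. wts T * vdm T)"
    using integrable_weight[OF observable_const[of 1]] by simp
  have "wint (\<lambda>_. 1) \<noteq> 0"
  proof
    assume "wint (\<lambda>_. 1) = 0"
    then have ae: "AE T in M. wts T * vdm T = 0"
      using integral_nonneg_eq_0_iff_AE[OF int] nonneg by (simp add: wint_def)
    \<comment> \<open>One open interval per coordinate, mutually disjoint: on this box all
      coordinates are interior and distinct, so the density is positive on a set of positive
      volume.\<close>
    define B where "B = Pi\<^sub>E {..<n} (\<lambda>j. {real j / real n <..< real (Suc j) / real n})"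
    have "wts T * vdm T > 0" if T: "T \<in> B" for T
    proof -
      have T': "real j / real n < T j" "T j < real (Suc j) / real n" if "j < n" for j
        using T that by (auto simp: B_def PiE_iff)
      have "wt (T j) > 0" if "j < n" for j
      proof -
        have "0 \<le> real j / real n" "real (Suc j) / real n \<le> 1"
          using that by (auto simp: divide_le_eq_1)
        with T'[OF that] have "0 < T j" "T j < 1"
          by linarith+
        then show ?thesis
          by (simp add: wt_def)
      qed
      moreover have "T k \<noteq> T j" if "j < k" "k < n" for j k
      proof -
        have "real (Suc j) / real n \<le> real k / real n"
          using that by (intro divide_right_mono) auto
        then show ?thesis
          using T'(2)[of j] T'(1)[of k] that by linarith
      qed
      ultimately show ?thesis
        unfolding wts_def vdm_def by (intro mult_pos_pos prod_pos) auto
    qed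
    then have sub: "B \<subseteq> {T \<in> space M. \<not> wts T * vdm T = 0}"
      by (force simp: B_def space_PiM PiE_iff)
    have Bs: "B \<in> sets M"
      unfolding B_def by (intro sets_PiM_I_finite) auto
    have "emeasure M B = 0"
      using ae Bs sub by (auto simp: AE_iff_measurable[OF _ refl] elim!: AE_E intro: emeasure_eq_0)
    moreover have "emeasure M B = (\<Prod>j<n. emeasure lborel {real j / real n <..< real (Suc j) / real n})"
      unfolding B_def by (rule emeasure_PiM) auto
    ultimately show False
      using n by (auto simp: prod_zero_iff divide_strict_right_mono divide_right_mono
          emeasure_lborel_Ioo ennreal_eq_0_iff simp flip: diff_divide_distrib)
  qed
  moreover have "wint (\<lambda>_. 1) \<ge> 0"
    unfolding wint_def using nonneg by (intro Bochner_Integration.integral_nonneg) auto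
  ultimately show ?thesis
    by simp
qed

section \<open>Expectations and loop equations for moments\<close>

definition E :: "((nat \<Rightarrow> real) \<Rightarrow> real) \<Rightarrow> real" where
  "E f = wint f / wint (\<lambda>_. 1)"

lemma E_const: "E (\<lambda>_. c) = c"
  using wint_cmult[of c "\<lambda>_. 1"] wint_one_pos by (simp add: E_def)

lemma E_add: "observable f \<Longrightarrow> observable g \<Longrightarrow> E (\<lambda>T. f T + g T) = E f + E g"
  by (simp add: E_def wint_add add_divide_distrib)

lemma E_cmult: "E (\<lambda>T. c * f T) = c * E f"
  by (simp add: E_def wint_cmult)

lemma E_diff: "observable f \<Longrightarrow> observable g \<Longrightarrow> E (\<lambda>T. f T - g T) = E f - E g"
  using E_add[of f "\<lambda>T. -1 * g T"] observable_cmult[of g "-1"] E_cmult[of "-1" g] by simp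

lemma E_sum:
  "finite I \<Longrightarrow> (\<And>i. i \<in> I \<Longrightarrow> observable (f i)) \<Longrightarrow> E (\<lambda>T. \<Sum>i\<in>I. f i T) = (\<Sum>i\<in>I. E (f i))"
  by (induction I rule: finite_induct) (auto simp: E_const E_add observable_sum)

lemma E_pick_sum:
  "(\<And>y ys. observable (\<lambda>T. G T y ys)) \<Longrightarrow> E (\<lambda>T. pick_sum (G T) xs) = pick_sum (\<lambda>y ys. E (\<lambda>T. G T y ys)) xs"
  by (induction xs arbitrary: G) (auto simp: pick_sum_Cons E_const E_add observable_pick_sum)

text \<open>Determined by dividing the one-coordinate terms by \<beta>/2. The derivative of the
  field and the coincident value of the kernel combine to 1/2 - \<beta>/4, which gives \<rho> and
  also shifts both exponents: g + h carries the exponent b at 1, and g - h the exponent a at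
  0.\<close>

definition \<rho> :: real where "\<rho> = 1 / real \<beta> - 1 / 2"
definition g :: real where "g = - (a + b + 1 - real \<beta> / 2) / real \<beta>"
definition h :: real where "h = (a - b) / real \<beta>"
definition \<gamma> :: "nat \<Rightarrow> real" where "\<gamma> d = (if even d then g else h)"

definition loop_op :: "nat \<Rightarrow> (nat \<Rightarrow> real) \<Rightarrow> real" where
  "loop_op k x = (real k * \<rho> - g) * x k - 2 * (\<Sum>j\<in>{1..<k}. \<gamma> (k - j) * x j) - \<gamma> k * x 0"

text \<open>The contribution of a single coordinate. The coincident value of the kernel is
  subtracted because the pair interaction will be completed to a double sum including i = j.\<close>

lemma loop_op_cheb:
  assumes "k \<ge> 1"
  shows "real k / 2 * cheb k t + (2 * t - 1) * chebU k t + a * (- 2 * (1 - t) * chebU k t) + b * (2 * t * chebU k t)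
      - real \<beta> / 4 * cheb_kernel k t t = real \<beta> / 2 * loop_op k (\<lambda>k. cheb k t)"
proof -
  define s1 where "s1 = 2 * t * chebU k t"
  define s2 where "s2 = - 2 * (1 - t) * chebU k t"
  define S1 where "S1 = (\<Sum>j\<in>{1..<k}. cheb j t)"
  define S2 where "S2 = (\<Sum>j\<in>{1..<k}. (-1) ^ (k - j) * cheb j t)"
  have e1: "s1 = (cheb 0 t + cheb k t) / 2 + S1" and e2: "s2 = ((-1) ^ k * cheb 0 t + cheb k t) / 2 + S2"
    using sum_cheb[OF assms, of t] sum_alternating_cheb[OF assms, of t] by (simp_all only: s1_def s2_def S1_def S2_def)
  have \<gamma>': "\<gamma> d = (g + h) / 2 + (g - h) / 2 * (-1) ^ d" for d
    by (simp add: \<gamma>_def field_simps)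
  have "2 * (\<Sum>j\<in>{1..<k}. \<gamma> (k - j) * cheb j t) = (g + h) * S1 + (g - h) * S2"
    unfolding S1_def S2_def sum_distrib_left sum.distrib[symmetric]
    by (intro sum.cong) (simp_all add: \<gamma>' field_simps)
  moreover have "\<gamma> k * cheb 0 t = (g + h) * (cheb 0 t / 2) + (g - h) * ((-1) ^ k * cheb 0 t / 2)"
    by (simp add: \<gamma>' field_simps)
  ultimately have L: "loop_op k (\<lambda>k. cheb k t) = real k * \<rho> * cheb k t - (g + h) * s1 - (g - h) * s2"
    unfolding loop_op_def e1 e2 by (simp add: field_simps del: cheb.simps)
  have U: "(2 * t - 1) * chebU k t = (s1 + s2) / 2"
    by (simp add: s1_def s2_def field_simps)
  have D: "cheb_kernel k t t = real k * cheb k t + (s1 + s2)"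
    unfolding cheb_kernel_diag[OF assms] mult.assoc[of 2] U by simp
  have \<beta>0: "real \<beta> \<noteq> 0"
    using \<beta> by simp
  have r: "real \<beta> / 2 * \<rho> = 1 / 2 - real \<beta> / 4" "real \<beta> / 2 * (g + h) = - (b + 1 / 2 - real \<beta> / 4)"
      "real \<beta> / 2 * (g - h) = - (a + 1 / 2 - real \<beta> / 4)"
    using \<beta>0 by (simp_all add: \<rho>_def g_def h_def field_simps)
  have "real \<beta> / 2 * loop_op k (\<lambda>k. cheb k t)
      = (real \<beta> / 2 * \<rho>) * (real k * cheb k t) - (real \<beta> / 2 * (g + h)) * s1 - (real \<beta> / 2 * (g - h)) * s2"
    unfolding L by (simp only: algebra_simps)
  also have "\<dots> = real k / 2 * cheb k t + (s1 + s2) / 2 + a * s2 + b * s1 - real \<beta> / 4 * (real k * cheb k t + (s1 + s2))"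
    unfolding r by (simp add: field_simps)
  finally show ?thesis
    unfolding U D by (simp only: s1_def s2_def)
qed

text \<open>Exchanging i and j turns the interaction into divided differences of
  \<open>phi k\<close>, that is, half the sum of \<open>cheb_kernel\<close> over pairs. The factor
  \<open>vdm\<close> reduces the claim to distinct coordinates, where the divisions are
  genuine.\<close>

lemma sum_score:
  assumes "k \<ge> 1"
  shows "wts T * (vdm T * (\<Sum>j<n. score k j T)) = wts T * (vdm T * (real \<beta> / 2 *
      (real n * X k T + 1 / 2 * (\<Sum>m\<in>{1..<k}. X m T * X (k - m) T) + loop_op k (\<lambda>k. X k T))))"
proof (cases "vdm T = 0")
  case False
  then have dist: "T j - T i \<noteq> 0" if "i < n" "j < n" "i \<noteq> j" for i j
    using vdm_coincidence[of i j T] that by auto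
  define D where "D = (\<Sum>j<n. \<Sum>i<n. cheb_kernel k (T j) (T i))"
  define Dd where "Dd = (\<Sum>j<n. cheb_kernel k (T j) (T j))"
  let ?A = "\<Sum>j<n. \<Sum>i\<in>{..<n} - {j}. phi k (T j) * (real \<beta> / (T j - T i))"
  have ind: "(\<Sum>i\<in>{..<n} - {j}. f i) = (\<Sum>i<n. if i = j then 0 else f i)" for f :: "nat \<Rightarrow> real" and j
    by (intro sum.mono_neutral_cong_left) auto
  have "?A = (\<Sum>j<n. \<Sum>i<n. if i = j then 0 else phi k (T j) * (real \<beta> / (T j - T i)))"
    by (simp only: ind)
  moreover have "\<dots> = (\<Sum>j<n. \<Sum>i<n. if i = j then 0 else phi k (T i) * (real \<beta> / (T i - T j)))"
    by (subst sum.swap) (intro sum.cong, auto)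
  ultimately have "2 * ?A = (\<Sum>j<n. \<Sum>i<n. (if i = j then 0 else phi k (T j) * (real \<beta> / (T j - T i)))
      + (if i = j then 0 else phi k (T i) * (real \<beta> / (T i - T j))))"
    by (simp add: sum.distrib)
  also have "\<dots> = (\<Sum>j<n. \<Sum>i<n. if i = j then 0 else real \<beta> / 2 * cheb_kernel k (T j) (T i))"
  proof (intro sum.cong refl)
    fix j i assume ji: "j \<in> {..<n}" "i \<in> {..<n}"
    show "(if i = j then 0 else phi k (T j) * (real \<beta> / (T j - T i)))
      + (if i = j then 0 else phi k (T i) * (real \<beta> / (T i - T j)))
      = (if i = j then 0 else real \<beta> / 2 * cheb_kernel k (T j) (T i))"
    proof (cases "i = j")
      case False
      then have d: "T j - T i \<noteq> 0"
        using dist[of i j] ji by auto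
      have "phi k (T j) * (real \<beta> / (T j - T i)) + phi k (T i) * (real \<beta> / (T i - T j))
          = real \<beta> * ((phi k (T j) - phi k (T i)) / (T j - T i))"
      proof -
        have "p * (r / d) + q * (r / (- d)) = r * ((p - q) / d)" for p q r d :: real
          by (simp add: diff_divide_distrib algebra_simps)
        from this[of "phi k (T j)" "real \<beta>" "T j - T i" "phi k (T i)"] show ?thesis
          by (simp only: minus_diff_eq)
      qed
      also have "(phi k (T j) - phi k (T i)) / (T j - T i) = cheb_kernel k (T j) (T i) / 2"
      proof -
        have "d \<noteq> 0 \<Longrightarrow> d * K / 2 / d = K / 2" for d K :: real
          by simp
        from this[OF d] show ?thesis
          unfolding phi_diff[OF assms] .
      qed
      finally show ?thesis
        using False by simp
    qed simp
  qed
  also have "\<dots> = (\<Sum>j<n. (\<Sum>i<n. real \<beta> / 2 * cheb_kernel k (T j) (T i)) - real \<beta> / 2 * cheb_kernel k (T j) (T j))"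
  proof (intro sum.cong refl)
    fix j assume "j \<in> {..<n}"
    then show "(\<Sum>i<n. if i = j then 0 else real \<beta> / 2 * cheb_kernel k (T j) (T i))
      = (\<Sum>i<n. real \<beta> / 2 * cheb_kernel k (T j) (T i)) - real \<beta> / 2 * cheb_kernel k (T j) (T j)"
      by (subst ind[symmetric], subst sum_diff1) auto
  qed
  also have "\<dots> = real \<beta> / 2 * (D - Dd)"
    by (simp add: D_def Dd_def sum_subtractf sum_distrib_left right_diff_distrib)
  finally have A: "?A = real \<beta> / 4 * D - real \<beta> / 4 * Dd"
    by (simp add: field_simps)
  have D': "D = 2 * (real n * X k T) + (\<Sum>m\<in>{1..<k}. X m T * X (k - m) T)"
  proof -
    have "(\<Sum>j<n. \<Sum>i<n. \<Sum>m\<in>{1..<k}. cheb m (T j) * cheb (k - m) (T i))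
        = (\<Sum>m\<in>{1..<k}. X m T * X (k - m) T)"
      by (subst sum.swap[of _ "{1..<k}"], subst sum.swap[of _ "{1..<k}"])
        (simp only: X_def sum_product)
    moreover have "(\<Sum>j<n. \<Sum>i<n. cheb k (T j)) = real n * X k T" "(\<Sum>j<n. \<Sum>i<n. cheb k (T i)) = real n * X k T"
      by (simp_all add: X_def sum_distrib_left)
    ultimately show ?thesis
      by (simp only: D_def cheb_kernel_def sum.distrib mult_2)
  qed
  have L: "loop_op k (\<lambda>k. X k T) = (\<Sum>j<n. loop_op k (\<lambda>k. cheb k (T j)))"
  proof -
    have "(\<Sum>m\<in>{1..<k}. \<gamma> (k - m) * (\<Sum>j<n. cheb m (T j)))
        = (\<Sum>j<n. \<Sum>m\<in>{1..<k}. \<gamma> (k - m) * cheb m (T j))"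
      unfolding sum_distrib_left by (rule sum.swap)
    then show ?thesis
      unfolding loop_op_def X_def by (simp only: sum_subtractf sum_distrib_left[symmetric])
  qed
  have "(\<Sum>j<n. score k j T) = (\<Sum>j<n. real \<beta> / 2 * loop_op k (\<lambda>k. cheb k (T j))
      + real \<beta> / 4 * cheb_kernel k (T j) (T j) + (\<Sum>i\<in>{..<n} - {j}. phi k (T j) * (real \<beta> / (T j - T i))))"
  proof (intro sum.cong refl)
    fix j
    have alg: "x - y = z \<Longrightarrow> x + s = z + y + s" for x y z s :: real
      by simp
    show "score k j T = real \<beta> / 2 * loop_op k (\<lambda>k. cheb k (T j))
      + real \<beta> / 4 * cheb_kernel k (T j) (T j) + (\<Sum>i\<in>{..<n} - {j}. phi k (T j) * (real \<beta> / (T j - T i)))"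
      unfolding score_def by (rule alg[OF loop_op_cheb[OF assms]])
  qed
  also have "\<dots> = real \<beta> / 2 * loop_op k (\<lambda>k. X k T) + real \<beta> / 4 * Dd + ?A"
    by (simp only: sum.distrib sum_distrib_left[symmetric] L Dd_def)
  also have "\<dots> = real \<beta> / 2 * (real n * X k T + 1 / 2 * (\<Sum>m\<in>{1..<k}. X m T * X (k - m) T) + loop_op k (\<lambda>k. X k T))"
  proof -
    have "c / 2 * l + c / 4 * d + (c / 4 * (2 * x + s) - c / 4 * d) = c / 2 * (x + 1 / 2 * s + l)" for c l d x s :: real
      by (simp add: field_simps)
    then show ?thesis
      unfolding A D' .
  qed
  finally show ?thesis
    by (simp only:)
qed simp

lemma sum_phi_dmon:
  assumes "T \<in> cube"
  shows "(\<Sum>j<n. phi k (T j) * dmon j xs T)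
    = pick_sum (\<lambda>m ys. real m / 2 * (X (k + m) T - X ((k - m) + (m - k)) T) * mon ys T) xs"
proof -
  have "(\<Sum>j<n. phi k (T j) * dmon j xs T)
      = pick_sum (\<lambda>m ys. \<Sum>j<n. phi k (T j) * (4 * real m * chebU m (T j) * mon ys T)) xs"
    unfolding dmon_def by (simp add: pick_sum_sum pick_sum_cmult)
  also have "\<dots> = pick_sum (\<lambda>m ys. real m / 2 * (X (k + m) T - X ((k - m) + (m - k)) T) * mon ys T) xs"
  proof (rule pick_sum_cong)
    fix m ys
    have "(\<Sum>j<n. phi k (T j) * (4 * real m * chebU m (T j) * mon ys T))
        = (\<Sum>j<n. real m / 2 * (cheb (k + m) (T j) - cheb ((k - m) + (m - k)) (T j)) * mon ys T)"
    proof (intro sum.cong refl)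
      fix j assume "j \<in> {..<n}"
      then have "T j \<in> {0..1}"
        using assms by (auto simp: cube_def)
      from phi_mult_chebU[OF this, of k m, symmetric]
      show "phi k (T j) * (4 * real m * chebU m (T j) * mon ys T)
        = real m / 2 * (cheb (k + m) (T j) - cheb ((k - m) + (m - k)) (T j)) * mon ys T"
        by simp
    qed
    also have "\<dots> = real m / 2 * (X (k + m) T - X ((k - m) + (m - k)) T) * mon ys T"
      unfolding X_def by (simp only: sum_subtractf[symmetric] sum_distrib_left sum_distrib_right)
    finally show "(\<Sum>j<n. phi k (T j) * (4 * real m * chebU m (T j) * mon ys T))
        = real m / 2 * (X (k + m) T - X ((k - m) + (m - k)) T) * mon ys T" .
  qed
  finally show ?thesis .
qed

text \<open>Sum over all coordinates of the integrations by parts with test function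
  \<open>mon xs\<close>, divided by \<beta>/2.\<close>

lemma loop_equation:
  assumes "k \<ge> 1"
  shows "E (\<lambda>T. (real n * X k T + 1 / 2 * (\<Sum>m\<in>{1..<k}. X m T * X (k - m) T) + loop_op k (\<lambda>k. X k T)) * mon xs T
     - pick_sum (\<lambda>m ys. real m / real \<beta> * (X ((k - m) + (m - k)) T - X (k + m) T) * mon ys T) xs) = 0"
proof -
  let ?f = "\<lambda>j T. wts T * (vdm T * (score k j T * mon xs T + phi k (T j) * dmon j xs T))"
  let ?R = "\<lambda>T. (real n * X k T + 1 / 2 * (\<Sum>m\<in>{1..<k}. X m T * X (k - m) T) + loop_op k (\<lambda>k. X k T)) * mon xs T
     - pick_sum (\<lambda>m ys. real m / real \<beta> * (X ((k - m) + (m - k)) T - X (k + m) T) * mon ys T) xs"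
  have ibp: "integrable M (?f j)" "integral\<^sup>L M (?f j) = 0" if j: "j < n" for j
  proof -
    obtain C where C: "\<forall>T\<in>cube. \<bar>mon xs T\<bar> \<le> C"
      using observable_mon[of xs] unfolding observable_def by (elim conjE exE)
    obtain C' where C': "\<forall>T\<in>cube. \<bar>dmon j xs T\<bar> \<le> C'"
      using observable_dmon[OF j, of xs] unfolding observable_def by (elim conjE exE)
    have m: "mon xs \<in> borel_measurable M" "dmon j xs \<in> borel_measurable M"
      using observable_mon[of xs] observable_dmon[OF j, of xs] by (simp_all add: observable_def)
    show "integrable M (?f j)" "integral\<^sup>L M (?f j) = 0"
      using integration_by_parts[OF assms j DERIV_mon[OF j] m(1) _ m(2), of C C'] bspec[OF C] bspec[OF C'] by simp_all
  qed
  have "0 = integral\<^sup>L M (\<lambda>T. \<Sum>j<n. ?f j T)"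
    using ibp by simp
  also have "\<dots> = integral\<^sup>L M (\<lambda>T. real \<beta> / 2 * (wts T * vdm T * ?R T))"
  proof (rule Bochner_Integration.integral_cong[OF refl])
    fix T
    show "(\<Sum>j<n. ?f j T) = real \<beta> / 2 * (wts T * vdm T * ?R T)"
    proof (cases "T \<in> cube")
      case True
      have "(\<Sum>j<n. ?f j T) = wts T * (vdm T * (\<Sum>j<n. score k j T)) * mon xs T
          + wts T * (vdm T * (\<Sum>j<n. phi k (T j) * dmon j xs T))"
        by (simp add: sum.distrib sum_distrib_left sum_distrib_right distrib_left mult_ac)
      also have "(\<Sum>j<n. phi k (T j) * dmon j xs T)
          = - (real \<beta> / 2) * pick_sum (\<lambda>m ys. real m / real \<beta> * (X ((k - m) + (m - k)) T - X (k + m) T) * mon ys T) xs"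
        unfolding sum_phi_dmon[OF True] pick_sum_cmult[symmetric]
        by (rule pick_sum_cong) (use \<beta> in \<open>simp add: field_simps\<close>)
      finally show ?thesis
        unfolding sum_score[OF assms] by (simp add: algebra_simps)
    next
      case False
      then show ?thesis
        by (simp add: wts_outside)
    qed
  qed
  also have "\<dots> = real \<beta> / 2 * wint ?R"
    by (simp add: wint_def)
  finally show ?thesis
    using \<beta> by (simp add: E_def)
qed

section \<open>From moments to cumulants\<close>

definition mom :: "((nat \<Rightarrow> real) \<Rightarrow> real) \<Rightarrow> nat list \<Rightarrow> real" where
  "mom f xs = E (\<lambda>T. f T * mon xs T)"

text \<open>\<open>mom f\<close> is the derivative of the moment generating function in a variable
  dual to f. Its quotient by that function is the derivative of the logarithm, hence the joint
  cumulant of f with the x_m for m in \<open>xs\<close>.\<close>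

definition cumul :: "((nat \<Rightarrow> real) \<Rightarrow> real) \<Rightarrow> nat list \<Rightarrow> real" where
  "cumul f = conv_quot (mom f) (mom (\<lambda>_. 1))"

lemma mom_one_Nil: "mom (\<lambda>_. 1) [] = 1"
  by (simp add: mom_def E_const)

lemma conv_cumul: "conv (cumul f) (mom (\<lambda>_. 1)) xs = mom f xs"
  unfolding cumul_def by (rule conv_conv_quot) (rule mom_one_Nil)

lemma cumul_const: "cumul (\<lambda>_. c) xs = c * conv_unit xs"
  unfolding cumul_def
  by (rule conv_quot_unique, rule mom_one_Nil)
    (simp add: conv_cmult_left conv_unit_left mom_def E_cmult)

lemma mom_X_Cons: "mom (\<lambda>_. 1) (x # xs) = mom (X x) xs"
  by (simp add: mom_def)

text \<open>For a generating function F = exp L: the second derivative divided by F is the second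
  derivative of L plus the product of the two first ones.\<close>

lemma conv_cumul_X_mult:
  "conv (\<lambda>ys. cumul (X c) (d # ys) + conv (cumul (X c)) (cumul (X d)) ys) (mom (\<lambda>_. 1)) xs
     = mom (\<lambda>T. X c T * X d T) xs"
proof -
  have "mom (\<lambda>T. X c T * X d T) xs = mom (X c) (d # xs)"
    by (simp add: mom_def mult.assoc)
  also have "\<dots> = conv (cumul (X c)) (mom (\<lambda>_. 1)) (d # xs)"
    by (rule conv_cumul[symmetric])
  also have "\<dots> = conv (\<lambda>ys. cumul (X c) (d # ys)) (mom (\<lambda>_. 1)) xs
      + conv (cumul (X c)) (\<lambda>zs. mom (\<lambda>_. 1) (d # zs)) xs"
    by (rule conv_Cons)
  also have "(\<lambda>zs. mom (\<lambda>_. 1) (d # zs)) = conv (cumul (X d)) (mom (\<lambda>_. 1))"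
    by (simp add: fun_eq_iff mom_X_Cons conv_cumul)
  finally show ?thesis
    by (simp add: conv_add_left conv_assoc)
qed

text \<open>Multiplied by the moment function, the left side becomes the loop equation for moments;
  that factor has value 1 at the empty list and can be cancelled.\<close>

lemma cumulant_loop_equation:
  assumes "k \<ge> 1"
  shows "real n * cumul (X k) xs
     + 1 / 2 * (\<Sum>m\<in>{1..<k}. cumul (X m) ((k - m) # xs) + conv (cumul (X m)) (cumul (X (k - m))) xs)
     + loop_op k (\<lambda>k. cumul (X k) xs)
     - pick_sum (\<lambda>m ys. real m / real \<beta> * (cumul (X ((k - m) + (m - k))) ys - cumul (X (k + m)) ys)) xs = 0"
    (is "?R xs = 0")
proof (rule conv_eq_cancel[where f = ?R and g = "\<lambda>_. 0" and m = "mom (\<lambda>_. 1)"])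
  show "mom (\<lambda>_. 1) [] = 1"
    by (rule mom_one_Nil)
  fix xs
  let ?m = "mom (\<lambda>_. 1)"
  have diff: "conv (\<lambda>xs. f xs - g xs) ?m xs = conv f ?m xs - conv g ?m xs" for f g :: "nat list \<Rightarrow> real" and xs
    using conv_add_left[of f "\<lambda>xs. -1 * g xs" ?m xs] conv_cmult_left[of "-1" g ?m xs] by simp
  have "conv ?R ?m xs = real n * mom (X k) xs + 1 / 2 * (\<Sum>m\<in>{1..<k}. mom (\<lambda>T. X m T * X (k - m) T) xs)
     + loop_op k (\<lambda>k. mom (X k) xs)
     - pick_sum (\<lambda>m ys. real m / real \<beta> * (mom (X ((k - m) + (m - k))) ys - mom (X (k + m)) ys)) xs"
    unfolding loop_op_def
    by (simp only: conv_add_left diff conv_cmult_left conv_sum_left conv_cumul conv_cumul_X_mult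
        pick_sum_conv[symmetric])
      (simp only: conv_cmult_left diff conv_cumul conv_cumul_X_mult[unfolded conv_add_left])
  also have "\<dots> = E (\<lambda>T. (real n * X k T + 1 / 2 * (\<Sum>m\<in>{1..<k}. X m T * X (k - m) T) + loop_op k (\<lambda>k. X k T)) * mon xs T
     - pick_sum (\<lambda>m ys. real m / real \<beta> * (X ((k - m) + (m - k)) T - X (k + m) T) * mon ys T) xs)"
  proof -
    have mom_lin: "mom (\<lambda>T. f T + g T) xs = mom f xs + mom g xs" "mom (\<lambda>T. f T - g T) xs = mom f xs - mom g xs"
      if "observable f" "observable g" for f g xs
      unfolding mom_def distrib_right left_diff_distrib
      using that by (auto intro!: E_add E_diff observable_mult observable_mon)
    have mom_cmult: "mom (\<lambda>T. c * f T) xs = c * mom f xs" for c f xs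
      unfolding mom_def mult.assoc by (rule E_cmult)
    have mom_sum: "mom (\<lambda>T. \<Sum>i\<in>I. f i T) xs = (\<Sum>i\<in>I. mom (f i) xs)"
      if "finite I" "\<And>i. observable (f i)" for f xs and I :: "nat set"
      unfolding mom_def sum_distrib_right
      using that by (auto intro!: E_sum observable_mult observable_mon)
    note obs = observable_mult observable_X observable_cmult observable_sum observable_add observable_diff
      observable_pick_sum observable_mon
    let ?A = "\<lambda>T. real n * X k T + 1 / 2 * (\<Sum>m\<in>{1..<k}. X m T * X (k - m) T) + loop_op k (\<lambda>k. X k T)"
    have m1: "mom ?A xs = real n * mom (X k) xs + 1 / 2 * (\<Sum>m\<in>{1..<k}. mom (\<lambda>T. X m T * X (k - m) T) xs)
       + loop_op k (\<lambda>k. mom (X k) xs)"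
      unfolding loop_op_def
      by (simp only: mom_lin obs mom_cmult mom_sum finite_atLeastLessThan)
    have m2: "pick_sum (\<lambda>m ys. real m / real \<beta> * (mom (X ((k - m) + (m - k))) ys - mom (X (k + m)) ys)) xs
      = E (\<lambda>T. pick_sum (\<lambda>m ys. real m / real \<beta> * (X ((k - m) + (m - k)) T - X (k + m) T) * mon ys T) xs)"
      by (subst E_pick_sum, intro obs, rule pick_sum_cong)
        (simp only: mult.assoc E_cmult mom_lin(2)[symmetric] obs, simp only: mom_def)
    have o1: "observable (\<lambda>T. ?A T * mon xs T)"
      unfolding loop_op_def
      by (intro observable_mult[OF _ observable_mon] observable_add observable_diff observable_sum
          observable_mult observable_const observable_X)
    have o2: "observable (\<lambda>T. pick_sum (\<lambda>m ys. real m / real \<beta> * (X ((k - m) + (m - k)) T - X (k + m) T) * mon ys T) xs)"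
      by (intro observable_pick_sum observable_mult observable_mon observable_diff observable_const observable_X)
    show ?thesis
      unfolding E_diff[OF o1 o2] m2 by (simp only: m1[symmetric] mom_def[of ?A])
  qed
  also have "\<dots> = 0"
    by (rule loop_equation[OF assms])
  finally show "conv ?R ?m xs = conv (\<lambda>_. 0) ?m xs"
    by (simp add: conv_zero_left)
qed

text \<open>Written as a quotient so that the empty list gets the exponent -1, where natural
  subtraction would give 0.\<close>

definition scaled_cumulant :: "nat \<Rightarrow> nat list \<Rightarrow> real" where
  "scaled_cumulant k xs = real n ^ length xs * (cumul (X k) xs / real n)"

lemma scaled_cumulant_0: "scaled_cumulant 0 = (\<lambda>xs. 2 * conv_unit xs)"
proof
  fix xs :: "nat list"
  have "cumul (X 0) xs = 2 * real n * conv_unit xs"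
  proof -
    have "X 0 = (\<lambda>_. 2 * real n)"
      by (rule ext) (rule X_0)
    then show ?thesis
      by (simp only: cumul_const)
  qed
  then show "scaled_cumulant 0 xs = 2 * conv_unit xs"
    using n by (auto simp: scaled_cumulant_def conv_unit_def)
qed

lemma scaled_cumulant_recursion:
  assumes "k \<ge> 1"
  shows "scaled_cumulant k xs
      + 1 / 2 * (\<Sum>m\<in>{1..<k}. 1 / real n * (1 / real n * scaled_cumulant m ((k - m) # xs))
          + conv (scaled_cumulant m) (scaled_cumulant (k - m)) xs)
      + 1 / real n * ((real k * \<rho> - g) * scaled_cumulant k xs
          - 2 * (\<Sum>j\<in>{1..<k}. \<gamma> (k - j) * scaled_cumulant j xs) - \<gamma> k * scaled_cumulant 0 xs)
      - pick_sum (\<lambda>m ys. real m / real \<beta> * (scaled_cumulant ((k - m) + (m - k)) ys - scaled_cumulant (k + m) ys)) xs = 0"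
proof -
  define N where "N = real n"
  have N: "N \<noteq> 0"
    using n by (simp add: N_def)
  \<comment> \<open>The common factor n^(length - 2): one power of n is present in the leading term,
    one is lost by removing an entry, and each factor of a product carries its own 1/n.\<close>
  define s where "s = N ^ length xs / N / N"
  have 1: "scaled_cumulant k xs = s * (N * cumul (X k) xs)"
    using N by (simp add: scaled_cumulant_def s_def N_def)
  have 2: "(\<Sum>m\<in>{1..<k}. 1 / real n * (1 / real n * scaled_cumulant m ((k - m) # xs))
          + conv (scaled_cumulant m) (scaled_cumulant (k - m)) xs)
      = s * (\<Sum>m\<in>{1..<k}. cumul (X m) ((k - m) # xs) + conv (cumul (X m)) (cumul (X (k - m))) xs)"
    unfolding sum_distrib_left
  proof (intro sum.cong refl)
    fix m
    have "conv (scaled_cumulant m) (scaled_cumulant (k - m)) xs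
        = N ^ length xs * conv (\<lambda>ys. 1 / N * cumul (X m) ys) (\<lambda>ys. 1 / N * cumul (X (k - m)) ys) xs"
      unfolding conv_scale[symmetric] by (simp add: scaled_cumulant_def[abs_def] N_def)
    also have "\<dots> = s * conv (cumul (X m)) (cumul (X (k - m))) xs"
      by (simp only: conv_cmult_left conv_cmult_right) (simp add: s_def)
    finally show "1 / real n * (1 / real n * scaled_cumulant m ((k - m) # xs))
          + conv (scaled_cumulant m) (scaled_cumulant (k - m)) xs
        = s * (cumul (X m) ((k - m) # xs) + conv (cumul (X m)) (cumul (X (k - m))) xs)"
      using N by (simp add: scaled_cumulant_def s_def N_def distrib_left)
  qed
  have sc: "1 / N * scaled_cumulant j xs = s * cumul (X j) xs" for j
    using N by (simp add: scaled_cumulant_def s_def N_def)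
  have 3: "1 / real n * ((real k * \<rho> - g) * scaled_cumulant k xs
          - 2 * (\<Sum>j\<in>{1..<k}. \<gamma> (k - j) * scaled_cumulant j xs) - \<gamma> k * scaled_cumulant 0 xs)
      = s * loop_op k (\<lambda>k. cumul (X k) xs)"
  proof -
    have "1 / N * ((real k * \<rho> - g) * scaled_cumulant k xs
          - 2 * (\<Sum>j\<in>{1..<k}. \<gamma> (k - j) * scaled_cumulant j xs) - \<gamma> k * scaled_cumulant 0 xs)
        = (real k * \<rho> - g) * (1 / N * scaled_cumulant k xs)
          - 2 * (\<Sum>j\<in>{1..<k}. \<gamma> (k - j) * (1 / N * scaled_cumulant j xs)) - \<gamma> k * (1 / N * scaled_cumulant 0 xs)"
      by (simp only: right_diff_distrib sum_distrib_left mult_ac)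
    also have "\<dots> = s * loop_op k (\<lambda>k. cumul (X k) xs)"
      unfolding sc loop_op_def by (simp only: right_diff_distrib sum_distrib_left mult_ac)
    finally show ?thesis
      by (simp only: N_def)
  qed
  have 4: "pick_sum (\<lambda>m ys. real m / real \<beta> * (scaled_cumulant ((k - m) + (m - k)) ys - scaled_cumulant (k + m) ys)) xs
      = s * pick_sum (\<lambda>m ys. real m / real \<beta> * (cumul (X ((k - m) + (m - k))) ys - cumul (X (k + m)) ys)) xs"
    unfolding pick_sum_cmult[symmetric]
  proof (rule pick_sum_cong)
    fix m ys assume "(m, ys) \<in> set (picks xs)"
    then have l: "length xs = Suc (length ys)"
      by (rule picks_cases)
    have "scaled_cumulant j ys = s * cumul (X j) ys" for j
      using N by (simp add: scaled_cumulant_def s_def l N_def[symmetric])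
    then show "real m / real \<beta> * (scaled_cumulant ((k - m) + (m - k)) ys - scaled_cumulant (k + m) ys)
      = s * (real m / real \<beta> * (cumul (X ((k - m) + (m - k))) ys - cumul (X (k + m)) ys))"
      by (simp only: right_diff_distrib mult_ac)
  qed
  have "s * (N * cumul (X k) xs
     + 1 / 2 * (\<Sum>m\<in>{1..<k}. cumul (X m) ((k - m) # xs) + conv (cumul (X m)) (cumul (X (k - m))) xs)
     + loop_op k (\<lambda>k. cumul (X k) xs)
     - pick_sum (\<lambda>m ys. real m / real \<beta> * (cumul (X ((k - m) + (m - k))) ys - cumul (X (k + m)) ys)) xs) = 0"
    using cumulant_loop_equation[OF assms, of xs] by (simp only: N_def mult_zero_right)
  then show ?thesis
    unfolding 2 3 4 unfolding 1 by (simp only: right_diff_distrib distrib_left mult.left_commute[of s "1 / 2"])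
qed

end

section \<open>Logarithms of double power series\<close>

text \<open>All derivatives vanish near 0 as well, hence all Taylor coefficients do.\<close>

lemma has_fps_expansion_zero_real:
  assumes "f has_fps_expansion F" "\<forall>\<^sub>F x in nhds (0 :: real). f x = (0 :: real)"
  shows "F = 0"
proof -
  have "fps_nth F n = 0" for n
    using assms
  proof (induction n arbitrary: f F)
    case 0
    have "eval_fps F 0 = f 0"
      using 0(1) eventually_nhds_x_imp_x by (fastforce simp: has_fps_expansion_def)
    moreover have "f 0 = 0"
      using 0(2) eventually_nhds_x_imp_x by fastforce
    ultimately show ?case
      by (simp add: eval_fps_at_0)
  next
    case (Suc n)
    have "\<forall>\<^sub>F x in nhds 0. \<forall>\<^sub>F y in nhds x. f y = 0"
      using Suc.prems(2) by (simp add: eventually_eventually)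
    then have "\<forall>\<^sub>F x in nhds 0. deriv f x = 0"
    proof eventually_elim
      case (elim x)
      then have "deriv f x = deriv (\<lambda>_. 0) x"
        by (intro deriv_cong_ev) auto
      then show ?case by simp
    qed
    from Suc.IH[OF has_fps_expansion_deriv[OF Suc.prems(1)] this] show ?case
      by (simp del: of_nat_Suc)
  qed
  then show ?thesis
    by (simp add: fps_eq_iff)
qed

lemma has_fps_expansion_unique_real:
  fixes f g :: "real \<Rightarrow> real"
  assumes "f has_fps_expansion F" "g has_fps_expansion G" "\<forall>\<^sub>F x in nhds 0. f x = g x"
  shows "F = G"
proof -
  have "(\<lambda>x. f x - g x) has_fps_expansion F - G"
    by (intro has_fps_expansion_diff assms)
  moreover have "\<forall>\<^sub>F x in nhds 0. f x - g x = 0"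
    using assms(3) by eventually_elim simp
  ultimately show ?thesis
    using has_fps_expansion_zero_real by fastforce
qed

text \<open>The same unconditional summation as in \<open>is_joint_cumulants\<close>, which permits
  taking slices and regrouping.\<close>

definition double_series :: "(nat \<Rightarrow> nat \<Rightarrow> real) \<Rightarrow> (real \<Rightarrow> real \<Rightarrow> real) \<Rightarrow> real \<Rightarrow> bool" where
  "double_series c F r \<longleftrightarrow> r > 0 \<and>
     (\<forall>s t. \<bar>s\<bar> < r \<longrightarrow> \<bar>t\<bar> < r \<longrightarrow> ((\<lambda>(l, k). c l k * s ^ l * t ^ k) has_sum F s t) UNIV)"

lemma double_series_swap:
  assumes "double_series c F r"
  shows "double_series (\<lambda>l k. c k l) (\<lambda>s t. F t s) r"
  unfolding double_series_def
proof (intro conjI allI impI)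
  show "r > 0"
    using assms by (simp add: double_series_def)
  fix s t :: real assume "\<bar>s\<bar> < r" "\<bar>t\<bar> < r"
  then have "((\<lambda>(l, k). c l k * t ^ l * s ^ k) has_sum F t s) UNIV"
    using assms by (simp add: double_series_def)
  also have "?this \<longleftrightarrow> ((\<lambda>(l, k). c k l * s ^ l * t ^ k) has_sum F t s) UNIV"
    by (rule has_sum_reindex_bij_witness[where i = "\<lambda>(x, y). (y, x)" and j = "\<lambda>(x, y). (y, x)"]) auto
  finally show "((\<lambda>(l, k). c k l * s ^ l * t ^ k) has_sum F t s) UNIV" .
qed

lemma double_series_slices:
  assumes c: "double_series c F r"
  defines "C \<equiv> \<lambda>l t. \<Sum>\<^sub>\<infinity>k. c l k * t ^ k"
  shows "\<bar>t\<bar> < r \<Longrightarrow> (\<lambda>s. F s t) has_fps_expansion Abs_fps (\<lambda>l. C l t)"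
    and "C l has_fps_expansion Abs_fps (c l)"
proof -
  have r: "r > 0"
    using c by (simp add: double_series_def)
  have sum: "((\<lambda>(l, k). c l k * s ^ l * t ^ k) has_sum F s t) (UNIV \<times> UNIV)" if "\<bar>s\<bar> < r" "\<bar>t\<bar> < r" for s t
    using c that by (simp add: double_series_def)
  have inner: "((\<lambda>k. c l k * t ^ k) has_sum C l t) UNIV" if t: "\<bar>t\<bar> < r" for l t
  proof -
    \<comment> \<open>Taking s = r/2, which is nonzero, makes each row summable after division by
      (r/2)^l.\<close>
    have "(\<lambda>(l, k). c l k * (r / 2) ^ l * t ^ k) summable_on UNIV \<times> UNIV"
      using sum[of "r / 2" t] t r by (auto simp: has_sum_imp_summable)
    then have "(\<lambda>k. c l k * (r / 2) ^ l * t ^ k) summable_on UNIV"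
      by (rule summable_on_SigmaD1) simp
    then have "(\<lambda>k. c l k * (r / 2) ^ l * t ^ k * inverse ((r / 2) ^ l)) summable_on UNIV"
      by (rule summable_on_cmult_left)
    then have "(\<lambda>k. c l k * t ^ k) summable_on UNIV"
      using r by (simp add: field_simps)
    then show ?thesis
      unfolding C_def by (rule has_sum_infsum)
  qed
  have near: "\<forall>\<^sub>F u in nhds (0 :: real). \<bar>u\<bar> < r"
    using r eventually_nhds_in_open[of "ball 0 r" "0 :: real"] by (simp add: dist_real_def)
  show "(\<lambda>s. F s t) has_fps_expansion Abs_fps (\<lambda>l. C l t)" if t: "\<bar>t\<bar> < r"
  proof (rule has_fps_expansionI)
    show "\<forall>\<^sub>F u in nhds 0. (\<lambda>l. fps_nth (Abs_fps (\<lambda>l. C l t)) l * u ^ l) sums F u t"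
      using near
    proof eventually_elim
      case (elim s)
      have "((\<lambda>l. C l t * s ^ l) has_sum F s t) UNIV"
      proof (rule has_sum_SigmaD[OF sum[OF elim t]])
        fix l
        show "((\<lambda>k. case (l, k) of (l, k) \<Rightarrow> c l k * s ^ l * t ^ k) has_sum C l t * s ^ l) UNIV"
          using has_sum_cmult_left[OF inner[OF t, of l], of "s ^ l"] by (simp add: mult_ac)
      qed
      then show ?case
        by (simp add: has_sum_imp_sums)
    qed
  qed
  show "C l has_fps_expansion Abs_fps (c l)"
    by (rule has_fps_expansionI)
      (use near in eventually_elim, simp add: has_sum_imp_sums[OF inner])
qed

lemma double_series_unique:
  assumes "double_series c F r" "double_series d F r'"
  shows "c = d"
proof (intro ext)
  fix l k
  define R where "R = min r r'"
  have R: "R > 0" "R \<le> r" "R \<le> r'"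
    using assms by (auto simp: R_def double_series_def)
  have eq: "(\<Sum>\<^sub>\<infinity>k. c l k * t ^ k) = (\<Sum>\<^sub>\<infinity>k. d l k * t ^ k)" if "\<bar>t\<bar> < R" for t l
  proof -
    have "Abs_fps (\<lambda>l. \<Sum>\<^sub>\<infinity>k. c l k * t ^ k) = Abs_fps (\<lambda>l. \<Sum>\<^sub>\<infinity>k. d l k * t ^ k)"
      by (rule has_fps_expansion_unique_real[OF double_series_slices(1)[OF assms(1)] double_series_slices(1)[OF assms(2)]])
        (use that R in auto)
    then show ?thesis
      by (simp add: fps_eq_iff)
  qed
  have "\<forall>\<^sub>F t in nhds (0 :: real). \<bar>t\<bar> < R"
    using R eventually_nhds_in_open[of "ball 0 R" "0 :: real"] by (simp add: dist_real_def)
  then have "\<forall>\<^sub>F t in nhds 0. (\<Sum>\<^sub>\<infinity>k. c l k * t ^ k) = (\<Sum>\<^sub>\<infinity>k. d l k * t ^ k)"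
    by eventually_elim (rule eq)
  from has_fps_expansion_unique_real[OF double_series_slices(2)[OF assms(1)] double_series_slices(2)[OF assms(2)] this]
  show "c l k = d l k"
    by (simp add: fps_eq_iff)
qed

text \<open>The coefficients of df/ds = f dL/ds, compared first in s for fixed t and then in t. This
  is the recursion between moments and cumulants.\<close>

lemma double_series_exp_deriv:
  assumes a: "double_series a f r" and b: "double_series b L r"
    and exp: "\<And>s t. \<bar>s\<bar> < r \<Longrightarrow> \<bar>t\<bar> < r \<Longrightarrow> f s t = exp (L s t)"
  shows "real (Suc l) * a (Suc l) k = (\<Sum>i\<le>l. \<Sum>j\<le>k. real (Suc i) * b (Suc i) j * a (l - i) (k - j))"
proof -
  have r: "r > 0"
    using a by (simp add: double_series_def)
  have near: "\<forall>\<^sub>F u in nhds (0 :: real). \<bar>u\<bar> < r"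
    using r eventually_nhds_in_open[of "ball 0 r" "0 :: real"] by (simp add: dist_real_def)
  define A where "A l t = (\<Sum>\<^sub>\<infinity>k. a l k * t ^ k)" for l t
  define B where "B l t = (\<Sum>\<^sub>\<infinity>k. b l k * t ^ k)" for l t
  note sA = double_series_slices[OF a, folded A_def]
  note sB = double_series_slices[OF b, folded B_def]
  have AB: "real (Suc l) * A (Suc l) t = (\<Sum>i\<le>l. real (Suc i) * B (Suc i) t * A (l - i) t)" if t: "\<bar>t\<bar> < r" for t
  proof -
    have "\<forall>\<^sub>F s in nhds 0. \<forall>\<^sub>F s' in nhds s. f s' t = exp (L s' t)"
      unfolding eventually_eventually using near by eventually_elim (simp add: exp t)
    moreover have "\<forall>\<^sub>F s in nhds 0. (\<lambda>s. L s t) field_differentiable (at s)"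
    proof -
      have e: "(\<lambda>s. L s t) has_fps_expansion Abs_fps (\<lambda>l. B l t)"
        by (rule sB(1)[OF t])
      let ?G = "Abs_fps (\<lambda>l. B l t)"
      have "\<forall>\<^sub>F s in nhds 0. \<forall>\<^sub>F s' in nhds s. eval_fps ?G s' = L s' t"
        unfolding eventually_eventually using e by (simp add: has_fps_expansion_def)
      moreover have "\<forall>\<^sub>F s in nhds 0. s \<in> eball 0 (fps_conv_radius ?G)"
        using e by (intro eventually_nhds_in_open) (auto simp: has_fps_expansion_def zero_ereal_def)
      ultimately show ?thesis
      proof eventually_elim
        case (elim s)
        have "(eval_fps ?G has_field_derivative eval_fps (fps_deriv ?G) s) (at s)"
          using elim(2) by (intro has_field_derivative_eval_fps) (simp add: eball_def dist_norm)
        then have "((\<lambda>s. L s t) has_field_derivative eval_fps (fps_deriv ?G) s) (at s)"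
          by (subst (asm) DERIV_cong_ev[OF refl _ refl]) (use elim(1) in auto)
        then show ?case
          by (auto simp: field_differentiable_def)
      qed
    qed
    ultimately have "\<forall>\<^sub>F s in nhds 0. deriv (\<lambda>s. f s t) s = deriv (\<lambda>s. L s t) s * f s t"
    proof eventually_elim
      case (elim s)
      have "deriv (\<lambda>s. f s t) s = deriv (\<lambda>s. exp (L s t)) s"
        by (rule deriv_cong_ev[OF elim(1)]) simp
      also have "\<dots> = exp (L s t) * deriv (\<lambda>s. L s t) s"
        using field_differentiable_derivI[OF elim(2)]
        by (intro DERIV_imp_deriv) (auto intro!: derivative_eq_intros)
      also have "exp (L s t) = f s t"
        using eventually_nhds_x_imp_x[OF elim(1)] by simp
      finally show ?case
        by (simp add: mult.commute)
    qed
    from has_fps_expansion_unique_real[OF has_fps_expansion_deriv[OF sA(1)[OF t]]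
        has_fps_expansion_mult[OF has_fps_expansion_deriv[OF sB(1)[OF t]] sA(1)[OF t]] this]
    have "fps_nth (fps_deriv (Abs_fps (\<lambda>l. A l t))) l
        = fps_nth (fps_deriv (Abs_fps (\<lambda>l. B l t)) * Abs_fps (\<lambda>l. A l t)) l"
      by (rule arg_cong)
    then show ?thesis
      by (simp add: fps_mult_nth atMost_atLeast0 add.commute)
  qed
  have 1: "(\<lambda>t. real (Suc l) * A (Suc l) t) has_fps_expansion fps_const (real (Suc l)) * Abs_fps (a (Suc l))"
    by (intro has_fps_expansion_cmult_left sA(2))
  have 2: "(\<lambda>t. \<Sum>i\<le>l. real (Suc i) * B (Suc i) t * A (l - i) t) has_fps_expansion
      (\<Sum>i\<le>l. fps_const (real (Suc i)) * Abs_fps (b (Suc i)) * Abs_fps (a (l - i)))"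
    by (intro has_fps_expansion_sum has_fps_expansion_mult has_fps_expansion_cmult_left sA(2) sB(2))
  have "\<forall>\<^sub>F t in nhds 0. real (Suc l) * A (Suc l) t = (\<Sum>i\<le>l. real (Suc i) * B (Suc i) t * A (l - i) t)"
    using near by eventually_elim (rule AB)
  from has_fps_expansion_unique_real[OF 1 2 this]
  have "fps_nth (fps_const (real (Suc l)) * Abs_fps (a (Suc l))) k
      = fps_nth (\<Sum>i\<le>l. fps_const (real (Suc i)) * Abs_fps (b (Suc i)) * Abs_fps (a (l - i))) k"
    by (rule arg_cong)
  then show ?thesis
    by (simp only: fps_sum_nth mult.assoc fps_mult_left_const_nth)
      (simp add: fps_mult_nth sum_distrib_left mult.assoc atMost_atLeast0)
qed

section \<open>Existence of the logarithm as a double series\<close>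

lemma has_sum_times:
  fixes f g :: "_ \<Rightarrow> real"
  assumes f: "(f has_sum F) A" and g: "(g has_sum G) B"
  shows "((\<lambda>(x, y). f x * g y) has_sum F * G) (A \<times> B)"
proof (rule has_sum_SigmaI)
  show "((\<lambda>y. case (x, y) of (x, y) \<Rightarrow> f x * g y) has_sum f x * G) B" for x
    using has_sum_cmult_right[OF g, of "f x"] by simp
  show "((\<lambda>x. f x * G) has_sum F * G) A"
    by (rule has_sum_cmult_left[OF f])
  have fa: "(\<lambda>x. norm (f x)) summable_on A" and ga: "(\<lambda>x. norm (g x)) summable_on B"
    using has_sum_imp_summable[OF f] has_sum_imp_summable[OF g] summable_on_iff_abs_summable_on_real by blast+
  have "(\<lambda>p. norm (case p of (x, y) \<Rightarrow> f x * g y)) summable_on A \<times> B"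
    unfolding Infinite_Sum.abs_summable_on_Sigma_iff
  proof (intro conjI ballI)
    show "(\<lambda>y. norm (case (x, y) of (x, y) \<Rightarrow> f x * g y)) summable_on B" for x
      using summable_on_cmult_right[OF ga, of "norm (f x)"] by (simp add: abs_mult)
    show "(\<lambda>x. norm (\<Sum>\<^sub>\<infinity>y\<in>B. norm (case (x, y) of (x, y) \<Rightarrow> f x * g y))) summable_on A"
      using summable_on_cmult_left[OF fa, of "\<bar>\<Sum>\<^sub>\<infinity>y\<in>B. \<bar>g y\<bar>\<bar>"]
      by (simp add: abs_mult infsum_cmult_right')
  qed
  then show "(\<lambda>(x, y). f x * g y) summable_on A \<times> B"
    by (rule abs_summable_summable)
qed

lemma has_sum_prod_list:
  fixes f :: "'a \<Rightarrow> real"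
  assumes "(f has_sum u) A"
  shows "((\<lambda>xs. \<Prod>x\<leftarrow>xs. f x) has_sum u ^ j) {xs. set xs \<subseteq> A \<and> length xs = j}"
proof (induction j)
  case 0
  have "{xs. set xs \<subseteq> A \<and> length xs = 0} = {[]}"
    by auto
  then show ?case
    by (simp add: has_sum_finiteI)
next
  case (Suc j)
  have "((\<lambda>(x, xs). f x * (\<Prod>x\<leftarrow>xs. f x)) has_sum u * u ^ j) (A \<times> {xs. set xs \<subseteq> A \<and> length xs = j})"
    by (rule has_sum_times[OF assms Suc])
  also have "?this \<longleftrightarrow> ((\<lambda>xs. \<Prod>x\<leftarrow>xs. f x) has_sum u ^ Suc j) {xs. set xs \<subseteq> A \<and> length xs = Suc j}"
    by (rule has_sum_reindex_bij_witness[where i = "\<lambda>xs. (hd xs, tl xs)" and j = "\<lambda>(x, xs). x # xs"])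
      (auto simp: length_Suc_conv)
  finally show ?case .
qed

text \<open>The series of \<open>ln (1 + u)\<close> with \<open>u\<close> itself an absolutely convergent sum: expand all powers
  into sums over lists, which stay absolutely summable because the sum of \<open>\<bar>f x\<bar>\<close> is less than one.\<close>

lemma has_sum_ln_lists:
  fixes f :: "'a \<Rightarrow> real"
  assumes f: "(f has_sum u) A" and n: "((\<lambda>x. \<bar>f x\<bar>) has_sum v) A" and "v < 1"
  shows "((\<lambda>xs. (-1) ^ (length xs - 1) / real (length xs) * (\<Prod>x\<leftarrow>xs. f x)) has_sum ln (1 + u))
           {xs. set xs \<subseteq> A \<and> xs \<noteq> []}"
proof -
  have uv: "\<bar>u\<bar> \<le> v"
    by (rule norm_infsum_bound[of f A, simplified, folded infsumI[OF f] infsumI[OF n]] | 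
        (use norm_infsum_le[OF f n] in simp))
  then have u1: "\<bar>u\<bar> < 1" and v0: "v \<ge> 0"
    using assms(3) by auto
  define Ls where "Ls j = {xs. set xs \<subseteq> A \<and> length xs = Suc j}" for j
  define G where "G = (\<lambda>(j, xs). (-1) ^ j / real (Suc j) * (\<Prod>x\<leftarrow>xs. f x))"
  have inner: "((\<lambda>xs. G (j, xs)) has_sum (-1) ^ j / real (Suc j) * u ^ Suc j) (Ls j)" for j
    unfolding G_def Ls_def prod.case by (intro has_sum_cmult_right has_sum_prod_list f)
  have inner_abs: "((\<lambda>xs. \<bar>G (j, xs)\<bar>) has_sum 1 / real (Suc j) * v ^ Suc j) (Ls j)" for j
  proof -
    have "((\<lambda>xs. 1 / real (Suc j) * (\<Prod>x\<leftarrow>xs. \<bar>f x\<bar>)) has_sum 1 / real (Suc j) * v ^ Suc j) (Ls j)"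
      unfolding Ls_def by (intro has_sum_cmult_right has_sum_prod_list n)
    moreover have "\<bar>\<Prod>x\<leftarrow>xs. f x\<bar> = (\<Prod>x\<leftarrow>xs. \<bar>f x\<bar>)" for xs
      by (induction xs) (auto simp: abs_mult)
    ultimately show ?thesis
      by (simp add: G_def abs_mult power_abs)
  qed
  have geo: "summable (\<lambda>j. norm (1 / real (Suc j) * w ^ Suc j))" if "\<bar>w\<bar> < 1" for w :: real
  proof (rule summable_comparison_test'[of "\<lambda>j. \<bar>w\<bar> ^ j" 0])
    show "summable (\<lambda>j. \<bar>w\<bar> ^ j)"
      using that by (intro summable_geometric) simp
    fix j
    have "1 / real (Suc j) * \<bar>w\<bar> ^ Suc j \<le> 1 * \<bar>w\<bar> ^ j"
      using that by (intro mult_mono) (auto simp: mult_le_cancel_right1 intro!: mult_left_le_one_le)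
    then show "norm (norm (1 / real (Suc j) * w ^ Suc j)) \<le> \<bar>w\<bar> ^ j"
      by (simp add: abs_mult power_abs)
  qed
  have summ: "G summable_on Sigma UNIV Ls"
  proof -
    have "(\<lambda>j. 1 / real (Suc j) * v ^ Suc j) summable_on UNIV"
    proof -
      have v: "\<bar>v\<bar> < 1"
        using v0 assms(3) by simp
      show ?thesis
        by (rule has_sum_imp_summable[OF norm_summable_imp_has_sum[OF geo[OF v]
              summable_sums[OF summable_norm_cancel[OF geo[OF v]]]]])
    qed
    then have "(\<lambda>p. \<bar>G p\<bar>) summable_on Sigma UNIV Ls"
      using inner_abs by (intro summable_on_SigmaI[where g = "\<lambda>j. 1 / real (Suc j) * v ^ Suc j"]) auto
    then show ?thesis
      by (subst summable_on_iff_abs_summable_on_real) simp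
  qed
  have outer: "((\<lambda>j. (-1) ^ j / real (Suc j) * u ^ Suc j) has_sum ln (1 + u)) UNIV"
  proof -
    have nm: "norm ((-1) ^ j / real (Suc j) * u ^ Suc j) = norm (1 / real (Suc j) * u ^ Suc j)" for j
      by (simp add: abs_mult power_abs)
    have s: "summable (\<lambda>j. norm ((-1) ^ j / real (Suc j) * u ^ Suc j))"
      unfolding nm by (rule geo[OF u1])
    have "ln (1 + u) = (\<Sum>j. (-1) ^ j / real (Suc j) * u ^ Suc j)"
      using ln_series[of "1 + u"] u1 by (simp add: field_simps)
    then have "(\<lambda>j. (-1) ^ j / real (Suc j) * u ^ Suc j) sums ln (1 + u)"
      using summable_sums[OF summable_norm_cancel[OF s]] by simp
    with s show ?thesis
      by (rule norm_summable_imp_has_sum)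
  qed
  have "(G has_sum ln (1 + u)) (Sigma UNIV Ls)"
    by (rule has_sum_SigmaI[OF inner outer summ])
  also have "?this \<longleftrightarrow> ?thesis"
    by (rule has_sum_reindex_bij_witness[where i = "\<lambda>xs. (length xs - 1, xs)" and j = snd])
      (auto simp: Ls_def G_def)
  finally show ?thesis .
qed

text \<open>Lists of nonconstant monomials are regrouped by their total exponents. The bound r > 1
  allows evaluation at s = t = 1, so the coefficients themselves are absolutely summable and a
  radius can be chosen from their sum.\<close>

lemma ln_double_series:
  assumes a00: "a 0 0 = 1" and a: "double_series a f r" and r: "r > 1"
  obtains b R where "double_series b (\<lambda>s t. ln (f s t)) R" "R \<le> r"
    "\<And>s t. \<bar>s\<bar> < R \<Longrightarrow> \<bar>t\<bar> < R \<Longrightarrow> f s t > 0"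
proof -
  define P where "P = UNIV - {(0 :: nat, 0 :: nat)}"
  have sum_a: "((\<lambda>(l, k). a l k * s ^ l * t ^ k) has_sum f s t) UNIV" if "\<bar>s\<bar> < r" "\<bar>t\<bar> < r" for s t
    using a that by (simp add: double_series_def)
  have "(\<lambda>(l, k). a l k * 1 ^ l * 1 ^ k) summable_on UNIV"
    using sum_a[of 1 1] r by (simp add: has_sum_imp_summable)
  then have abs1: "(\<lambda>(l, k). \<bar>a l k\<bar>) summable_on UNIV"
    by (subst (asm) summable_on_iff_abs_summable_on_real) (simp add: case_prod_unfold)
  then have absP: "(\<lambda>(l, k). \<bar>a l k\<bar>) summable_on P"
    by (rule summable_on_subset_banach) simp
  define K where "K = (\<Sum>\<^sub>\<infinity>(l, k)\<in>P. \<bar>a l k\<bar>)"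
  have K0: "K \<ge> 0"
    unfolding K_def by (rule infsum_nonneg) auto
  have absK: "((\<lambda>(l, k). \<bar>a l k\<bar>) has_sum K) P"
    unfolding K_def by (rule has_sum_infsum[OF absP])
  \<comment> \<open>Every nonconstant monomial has degree at least 1, so with R at most 1 the
    absolute values sum to at most R K < 1.\<close>
  define R where "R = 1 / (2 * K + 1)"
  have R: "0 < R" "R \<le> 1" "R * K < 1"
    using K0 by (auto simp: R_def field_simps)
  define c where "c = (\<lambda>xs. (-1) ^ (length xs - 1) / real (length xs) * (\<Prod>(l, k)\<leftarrow>xs. a l k))"
  define tot where "tot xs = (sum_list (map fst xs), sum_list (map snd xs))" for xs :: "(nat \<times> nat) list"
  define Lp where "Lp p = {xs. set xs \<subseteq> P \<and> xs \<noteq> [] \<and> tot xs = p}" for p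
  define b where "b l k = (\<Sum>\<^sub>\<infinity>xs\<in>Lp (l, k). c xs)" for l k
  have main: "f s t > 0 \<and> ((\<lambda>(l, k). b l k * s ^ l * t ^ k) has_sum ln (f s t)) UNIV"
    if st: "\<bar>s\<bar> < R" "\<bar>t\<bar> < R" for s t
  proof -
    define w where "w = (\<lambda>(l, k). a l k * s ^ l * t ^ k)"
    have hs: "(w has_sum f s t - 1) P"
    proof -
      have "(w has_sum f s t - w (0, 0)) (UNIV - {(0, 0)})"
      proof (rule has_sum_Diff)
        show "(w has_sum f s t) UNIV"
          unfolding w_def by (rule sum_a) (use st R r in auto)
        show "(w has_sum w (0, 0)) {(0, 0)}"
          by (rule has_sum_finiteI) auto
      qed simp
      then show ?thesis
        by (simp add: P_def w_def a00)
    qed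
    have wle: "\<bar>w p\<bar> \<le> R * (case p of (l, k) \<Rightarrow> \<bar>a l k\<bar>)" if p: "p \<in> P" for p
    proof -
      obtain l k where lk: "p = (l, k)" by (cases p)
      have "\<bar>s\<bar> ^ l \<le> R ^ l" "\<bar>t\<bar> ^ k \<le> R ^ k"
        using st by (auto intro: power_mono)
      then have "\<bar>s\<bar> ^ l * \<bar>t\<bar> ^ k \<le> R ^ l * R ^ k"
        using R by (intro mult_mono) auto
      also have "\<dots> = R ^ (l + k)"
        by (simp add: power_add)
      also have "\<dots> \<le> R ^ 1"
        using R p by (intro power_decreasing) (auto simp: lk P_def)
      finally have "\<bar>a l k\<bar> * (\<bar>s\<bar> ^ l * \<bar>t\<bar> ^ k) \<le> \<bar>a l k\<bar> * R"
        by (intro mult_left_mono) auto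
      then show ?thesis
        by (simp add: lk w_def abs_mult power_abs mult_ac)
    qed
    have absw: "(\<lambda>p. \<bar>w p\<bar>) summable_on P"
      using hs by (simp add: has_sum_imp_summable flip: summable_on_iff_abs_summable_on_real real_norm_def)
    define v where "v = (\<Sum>\<^sub>\<infinity>p\<in>P. \<bar>w p\<bar>)"
    have hv: "((\<lambda>p. \<bar>w p\<bar>) has_sum v) P"
      unfolding v_def by (rule has_sum_infsum[OF absw])
    have "v \<le> R * K"
      by (rule has_sum_mono[OF hv has_sum_cmult_right[OF absK, of R]]) (use wle in auto)
    then have v1: "v < 1"
      using R by simp
    have uv: "\<bar>f s t - 1\<bar> \<le> v"
      using norm_infsum_bound[of w P] infsumI[OF hs] infsumI[OF hv] absw by simp
    have pos: "f s t > 0"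
      using uv v1 by linarith
    have "((\<lambda>xs. (-1) ^ (length xs - 1) / real (length xs) * (\<Prod>x\<leftarrow>xs. w x)) has_sum ln (1 + (f s t - 1)))
           {xs. set xs \<subseteq> P \<and> xs \<noteq> []}"
      by (rule has_sum_ln_lists[OF hs hv v1])
    moreover have "(-1) ^ (length xs - 1) / real (length xs) * (\<Prod>x\<leftarrow>xs. w x)
        = (case tot xs of (l, k) \<Rightarrow> c xs * s ^ l * t ^ k)" for xs
    proof -
      have "(\<Prod>x\<leftarrow>xs. w x) = (\<Prod>(l, k)\<leftarrow>xs. a l k) * s ^ fst (tot xs) * t ^ snd (tot xs)"
        by (induction xs) (auto simp: w_def tot_def power_add mult_ac)
      then show ?thesis
        by (simp add: c_def case_prod_unfold)
    qed
    ultimately have "((\<lambda>xs. case tot xs of (l, k) \<Rightarrow> c xs * s ^ l * t ^ k) has_sum ln (f s t)) {xs. set xs \<subseteq> P \<and> xs \<noteq> []}"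
      by simp
    also have "?this \<longleftrightarrow> ((\<lambda>(p, xs). case p of (l, k) \<Rightarrow> c xs * s ^ l * t ^ k) has_sum ln (f s t)) (Sigma UNIV Lp)"
      by (rule has_sum_reindex_bij_witness[where j = "\<lambda>xs. (tot xs, xs)" and i = snd]) (auto simp: Lp_def)
    finally have total: "((\<lambda>(p, xs). case p of (l, k) \<Rightarrow> c xs * s ^ l * t ^ k) has_sum ln (f s t)) (Sigma UNIV Lp)" .
    have "((\<lambda>(l, k). b l k * s ^ l * t ^ k) has_sum ln (f s t)) UNIV"
    proof (rule has_sum_SigmaD[OF total])
      fix p :: "nat \<times> nat"
      obtain l k where p: "p = (l, k)" by (cases p)
      have "(\<lambda>xs. c xs * s ^ l * t ^ k) summable_on Lp p"
        using summable_on_SigmaD1[OF has_sum_imp_summable[OF total], of p]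
        by (simp add: p)
      then have "((\<lambda>xs. c xs * (s ^ l * t ^ k)) has_sum (\<Sum>\<^sub>\<infinity>xs\<in>Lp p. c xs * (s ^ l * t ^ k))) (Lp p)"
        by (simp add: mult.assoc)
      then show "((\<lambda>xs. case (p, xs) of (p, xs) \<Rightarrow> case p of (l, k) \<Rightarrow> c xs * s ^ l * t ^ k) has_sum
          (case p of (l, k) \<Rightarrow> b l k * s ^ l * t ^ k)) (Lp p)"
        by (simp add: p infsum_cmult_left' b_def mult.assoc)
    qed
    with pos show ?thesis
      by blast
  qed
  show ?thesis
  proof (rule that)
    show "double_series b (\<lambda>s t. ln (f s t)) R"
      using main R by (simp add: double_series_def)
    show "R \<le> r"
      using R r by simp
    show "f s t > 0" if "\<bar>s\<bar> < R" "\<bar>t\<bar> < R" for s t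
      using main[OF that] by blast
  qed
qed

section \<open>Convolution and Laurent coefficients on two-letter lists\<close>

text \<open>Pascal's rule in the shape in which the Leibniz rule \<open>conv_Cons\<close> produces
  the two sums.\<close>

lemma sum_choose_Pascal:
  fixes \<phi> :: "nat \<Rightarrow> nat \<Rightarrow> real"
  shows "(\<Sum>i\<le>l. real (l choose i) * \<phi> (Suc i) (l - i)) + (\<Sum>i\<le>l. real (l choose i) * \<phi> i (Suc (l - i)))
    = (\<Sum>i\<le>Suc l. real (Suc l choose i) * \<phi> i (Suc l - i))"
proof -
  have "(\<Sum>i\<le>Suc l. real (Suc l choose i) * \<phi> i (Suc l - i))
      = \<phi> 0 (Suc l) + (\<Sum>i\<le>l. real (Suc l choose Suc i) * \<phi> (Suc i) (l - i))"
    by (subst sum.atMost_Suc_shift) simp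
  also have "(\<Sum>i\<le>l. real (Suc l choose Suc i) * \<phi> (Suc i) (l - i))
      = (\<Sum>i\<le>l. real (l choose i) * \<phi> (Suc i) (l - i)) + (\<Sum>i\<le>l. real (l choose Suc i) * \<phi> (Suc i) (l - i))"
    by (simp add: distrib_right sum.distrib)
  also have "(\<Sum>i\<le>l. real (l choose Suc i) * \<phi> (Suc i) (l - i)) = (\<Sum>i<l. real (l choose Suc i) * \<phi> (Suc i) (l - i))"
    by (rule sum.mono_neutral_right) auto
  also have "\<dots> = (\<Sum>i<l. real (l choose Suc i) * \<phi> (Suc i) (Suc (l - Suc i)))"
    by (intro sum.cong) (auto simp: Suc_diff_Suc)
  finally have "(\<Sum>i\<le>Suc l. real (Suc l choose i) * \<phi> i (Suc l - i))
      = (\<Sum>i\<le>l. real (l choose i) * \<phi> (Suc i) (l - i))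
        + (\<phi> 0 (Suc l) + (\<Sum>i<l. real (l choose Suc i) * \<phi> (Suc i) (Suc (l - Suc i))))"
    by simp
  also have "\<phi> 0 (Suc l) + (\<Sum>i<l. real (l choose Suc i) * \<phi> (Suc i) (Suc (l - Suc i)))
      = (\<Sum>i<Suc l. real (l choose i) * \<phi> i (Suc (l - i)))"
    by (subst sum.lessThan_Suc_shift) simp
  finally show ?thesis
    by (simp add: lessThan_Suc_atMost)
qed

lemma conv_replicate:
  fixes f g :: "'a list \<Rightarrow> real"
  shows "conv f g (replicate k y) = (\<Sum>j\<le>k. real (k choose j) * (f (replicate j y) * g (replicate (k - j) y)))"
proof (induction k arbitrary: f g)
  case (Suc k)
  have "conv f g (replicate (Suc k) y)
      = (\<Sum>j\<le>k. real (k choose j) * (f (replicate (Suc j) y) * g (replicate (k - j) y)))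
       + (\<Sum>j\<le>k. real (k choose j) * (f (replicate j y) * g (replicate (Suc (k - j)) y)))"
    by (simp add: conv_Cons Suc)
  then show ?case
    using sum_choose_Pascal[of k "\<lambda>i j. f (replicate i y) * g (replicate j y)"] by simp
qed simp

text \<open>Binomial coefficients count the splits with given numbers of letters, so
  \<open>conv\<close> becomes the product of exponential generating functions in two
  variables.\<close>

lemma conv_replicate2:
  fixes f g :: "'a list \<Rightarrow> real"
  shows "conv f g (replicate l x @ replicate k y) = (\<Sum>i\<le>l. \<Sum>j\<le>k. real (l choose i) * real (k choose j)
     * (f (replicate i x @ replicate j y) * g (replicate (l - i) x @ replicate (k - j) y)))"
proof (induction l arbitrary: f g)
  case 0
  show ?case by (simp add: conv_replicate)
next
  case (Suc l)
  define \<phi> where "\<phi> i i' = (\<Sum>j\<le>k. real (k choose j)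
     * (f (replicate i x @ replicate j y) * g (replicate i' x @ replicate (k - j) y)))" for i i'
  have "conv f g (replicate (Suc l) x @ replicate k y)
      = (\<Sum>i\<le>l. real (l choose i) * \<phi> (Suc i) (l - i)) + (\<Sum>i\<le>l. real (l choose i) * \<phi> i (Suc (l - i)))"
    by (simp add: conv_Cons Suc \<phi>_def sum_distrib_left mult.assoc)
  also have "\<dots> = (\<Sum>i\<le>Suc l. real (Suc l choose i) * \<phi> i (Suc l - i))"
    by (rule sum_choose_Pascal)
  also have "\<dots> = (\<Sum>i\<le>Suc l. \<Sum>j\<le>k. real (Suc l choose i) * real (k choose j)
     * (f (replicate i x @ replicate j y) * g (replicate (Suc l - i) x @ replicate (k - j) y)))"
    by (simp only: \<phi>_def sum_distrib_left mult.assoc)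
  finally show ?case .
qed

lemma binomial_convolution_unique:
  fixes u v m :: "nat \<Rightarrow> nat \<Rightarrow> real"
  assumes "m 0 0 = 1"
    and "\<And>l k. (\<Sum>i\<le>l. \<Sum>j\<le>k. real (l choose i) * real (k choose j) * (u i j * m (l - i) (k - j)))
       = (\<Sum>i\<le>l. \<Sum>j\<le>k. real (l choose i) * real (k choose j) * (v i j * m (l - i) (k - j)))"
  shows "u l k = v l k"
proof (induction "l + k" arbitrary: l k rule: less_induct)
  case less
  have split: "(\<Sum>i\<le>l. \<Sum>j\<le>k. real (l choose i) * real (k choose j) * (w i j * m (l - i) (k - j)))
      = w l k + (\<Sum>p\<in>{..l} \<times> {..k} - {(l, k)}. case p of (i, j) \<Rightarrow> real (l choose i) * real (k choose j) * (w i j * m (l - i) (k - j)))"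
    for w :: "nat \<Rightarrow> nat \<Rightarrow> real"
    unfolding sum.cartesian_product by (subst sum.remove[of _ "(l, k)"]) (auto simp: assms(1))
  have "(\<Sum>p\<in>{..l} \<times> {..k} - {(l, k)}. case p of (i, j) \<Rightarrow> real (l choose i) * real (k choose j) * (u i j * m (l - i) (k - j)))
      = (\<Sum>p\<in>{..l} \<times> {..k} - {(l, k)}. case p of (i, j) \<Rightarrow> real (l choose i) * real (k choose j) * (v i j * m (l - i) (k - j)))"
  proof (rule sum.cong[OF refl])
    fix p assume p: "p \<in> {..l} \<times> {..k} - {(l, k)}"
    obtain i j where ij: "p = (i, j)" by (cases p)
    have "i + j < l + k"
      using p ij by auto
    from less[OF this] show "(case p of (i, j) \<Rightarrow> real (l choose i) * real (k choose j) * (u i j * m (l - i) (k - j)))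
        = (case p of (i, j) \<Rightarrow> real (l choose i) * real (k choose j) * (v i j * m (l - i) (k - j)))"
      by (simp add: ij)
  qed
  with assms(2)[of l k] split[of u] split[of v] show ?case
    by linarith
qed

section \<open>Laurent coefficients for the entries 1 and 2\<close>

lemma coeff_Laurent_append_Cons: "coeff_Laurent c (xs @ y # ys) = coeff_Laurent c (y # xs @ ys)"
proof (induction xs arbitrary: c)
  case (Cons x xs)
  then show ?case
    by (simp add: algebra_simps)
qed simp

lemma coeff_Laurent_append_commute: "coeff_Laurent c (xs @ ys) = coeff_Laurent c (ys @ xs)"
proof (induction ys arbitrary: xs c)
  case (Cons y ys)
  have "coeff_Laurent c (xs @ y # ys) = coeff_Laurent c (y # xs @ ys)"
    by (rule coeff_Laurent_append_Cons)
  then show ?case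
    by (simp add: Cons)
qed simp

lemma coeff_Laurent_beyond_degree: "c > int (sum_list xs) \<Longrightarrow> coeff_Laurent c xs = 0"
  by (induction xs arbitrary: c) auto

text \<open>The binomial theorem for powers of u + u^-1.\<close>

lemma coeff_Laurent_replicate_1: "coeff_Laurent (int m - 2 * int i) (replicate m 1) = real (m choose i)"
proof (induction m arbitrary: i)
  case 0
  then show ?case
    by (cases i) auto
next
  case (Suc m)
  have e: "int (Suc m) - 2 * int i - 1 = int m - 2 * int i"
    by simp
  show ?case
  proof (cases i)
    case 0
    have "coeff_Laurent (int (Suc m) + 1) (replicate m 1) = 0"
      by (rule coeff_Laurent_beyond_degree) (simp add: sum_list_replicate)
    with Suc[of 0] show ?thesis
      by (simp add: 0)
  next
    case (Suc i')
    have e2: "int (Suc m) - 2 * int i + 1 = int m - 2 * int i'"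
      by (simp add: Suc)
    have "coeff_Laurent (int (Suc m) - 2 * int i) (replicate (Suc m) 1) = real (m choose i) + real (m choose i')"
      by (simp only: replicate_Suc coeff_Laurent.simps of_nat_1 e e2 Suc.IH)
    then show ?thesis
      by (simp add: Suc)
  qed
qed

text \<open>From u^2 + u^-2 = (u + u^-1)^2 - 2, expanded binomially.\<close>

lemma coeff_Laurent_replicate_2:
  "coeff_Laurent c (replicate k 2 @ xs)
     = (\<Sum>j\<le>k. real (k choose j) * ((-2) ^ (k - j) * coeff_Laurent c (replicate (2 * j) 1 @ xs)))"
proof (induction k arbitrary: xs)
  case (Suc k)
  have two: "coeff_Laurent c (2 # ys) = coeff_Laurent c (1 # 1 # ys) - 2 * coeff_Laurent c ys" for c ys
    by (simp add: algebra_simps)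
  have pull: "coeff_Laurent c (replicate m 1 @ 1 # 1 # xs) = coeff_Laurent c (replicate (Suc (Suc m)) 1 @ xs)" for m
    by (simp only: replicate_app_Cons_same replicate_Suc append_Cons)
  have "coeff_Laurent c (replicate (Suc k) 2 @ xs) = coeff_Laurent c (2 # replicate k 2 @ xs)"
    by simp
  also have "\<dots> = coeff_Laurent c (replicate k 2 @ 1 # 1 # xs) - 2 * coeff_Laurent c (replicate k 2 @ xs)"
  proof -
    have "coeff_Laurent c (1 # 1 # replicate k 2 @ xs) = coeff_Laurent c (replicate k 2 @ 1 # 1 # xs)"
      using coeff_Laurent_append_Cons[of c "replicate k 2" 1 "1 # xs"]
        coeff_Laurent_append_Cons[of "c - 1" "replicate k 2" 1 xs] coeff_Laurent_append_Cons[of "c + 1" "replicate k 2" 1 xs]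
      by simp
    then show ?thesis
      by (simp only: two)
  qed
  also have "\<dots> = (\<Sum>j\<le>k. real (k choose j) * ((-2) ^ (k - j) * coeff_Laurent c (replicate (2 * Suc j) 1 @ xs)))
      + (\<Sum>j\<le>k. real (k choose j) * ((-2) ^ Suc (k - j) * coeff_Laurent c (replicate (2 * j) 1 @ xs)))"
    unfolding Suc pull sum_distrib_left
    by (simp only: diff_conv_add_uminus sum_negf[symmetric]) (simp add: algebra_simps)
  also have "\<dots> = (\<Sum>j\<le>Suc k. real (Suc k choose j) * ((-2) ^ (Suc k - j) * coeff_Laurent c (replicate (2 * j) 1 @ xs)))"
    using sum_choose_Pascal[of k "\<lambda>i j. (-2) ^ j * coeff_Laurent c (replicate (2 * i) 1 @ xs)"] by simp
  finally show ?case .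
qed simp

text \<open>For even l only even powers of u + u^-1 occur, and their constant terms are the middle
  binomial coefficients. Extracting (-2)^k produces the sum of the theorem.\<close>

lemma coeff_Laurent_central:
  assumes "even l"
  shows "coeff_Laurent 0 (replicate l 1 @ replicate k 2)
    = (-2) ^ k * (\<Sum>j=0..k. real ((2 * j + l) choose (j + l div 2)) * real (k choose j) * (-2) powi (- int j))"
proof -
  have "coeff_Laurent 0 (replicate l 1 @ replicate k 2) = coeff_Laurent 0 (replicate k 2 @ replicate l 1)"
    by (rule coeff_Laurent_append_commute)
  also have "\<dots> = (\<Sum>j\<le>k. real (k choose j) * ((-2) ^ (k - j) * coeff_Laurent 0 (replicate (2 * j) 1 @ replicate l 1)))"
    by (rule coeff_Laurent_replicate_2)
  also have "\<dots> = (\<Sum>j\<le>k. (-2) ^ k * (real ((2 * j + l) choose (j + l div 2)) * real (k choose j) * (-2) powi (- int j)))"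
  proof (rule sum.cong[OF refl])
    fix j assume j: "j \<in> {..k}"
    have "int (2 * j + l) - 2 * int (j + l div 2) = 0"
      using assms by (auto elim!: evenE)
    then have "coeff_Laurent 0 (replicate (2 * j) 1 @ replicate l 1) = real ((2 * j + l) choose (j + l div 2))"
      using coeff_Laurent_replicate_1[of "2 * j + l" "j + l div 2"] by (simp add: replicate_add)
    moreover have "(-2 :: real) ^ (k - j) = (-2) ^ k * (-2) powi (- int j)"
      using j by (simp add: power_diff power_int_minus field_simps)
    ultimately show "real (k choose j) * ((-2) ^ (k - j) * coeff_Laurent 0 (replicate (2 * j) 1 @ replicate l 1))
      = (-2) ^ k * (real ((2 * j + l) choose (j + l div 2)) * real (k choose j) * (-2) powi (- int j))"
      by simp
  qed
  finally show ?thesis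
    by (simp add: sum_distrib_left atMost_atLeast0)
qed

section \<open>The moment generating function\<close>

context jacobi_ensemble
begin

definition mgf_X :: "real \<Rightarrow> real \<Rightarrow> real" where
  "mgf_X s t = E (\<lambda>T. exp (s * X 1 T + t * X 2 T))"

definition moment :: "nat \<Rightarrow> nat \<Rightarrow> real" where
  "moment l k = E (\<lambda>T. X 1 T ^ l * X 2 T ^ k)"

lemma abs_X_le:
  assumes "T \<in> cube"
  shows "\<bar>X k T\<bar> \<le> 2 * real n"
proof -
  have "\<bar>X k T\<bar> \<le> (\<Sum>j<n. \<bar>cheb k (T j)\<bar>)"
    unfolding X_def by (rule sum_abs)
  also have "\<dots> \<le> (\<Sum>j<n. 2)"
    using assms by (intro sum_mono abs_cheb_le) (auto simp: cube_def)
  finally show ?thesis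
    by simp
qed

lemma observable_power: "observable f \<Longrightarrow> observable (\<lambda>T. f T ^ k)"
  by (induction k) (auto intro: observable_const observable_mult)

lemma abs_E_le:
  assumes "observable f" "\<And>T. T \<in> cube \<Longrightarrow> \<bar>f T\<bar> \<le> C"
  shows "\<bar>E f\<bar> \<le> C"
proof -
  have "\<bar>wint f\<bar> \<le> integral\<^sup>L M (\<lambda>T. \<bar>wts T * vdm T * f T\<bar>)"
    unfolding wint_def by (rule integral_abs_bound)
  also have "\<dots> \<le> integral\<^sup>L M (\<lambda>T. wts T * vdm T * C)"
  proof (rule integral_mono)
    show "integrable M (\<lambda>T. \<bar>wts T * vdm T * f T\<bar>)"
      by (intro integrable_abs integrable_weight assms)
    show "integrable M (\<lambda>T. wts T * vdm T * C)"
      by (intro integrable_weight observable_const)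
    show "\<bar>wts T * vdm T * f T\<bar> \<le> wts T * vdm T * C" for T
    proof (cases "T \<in> cube")
      case True
      then show ?thesis
        using assms(2)[OF True] wts_nonneg[of T] vdm_nonneg[of T]
        by (simp add: abs_mult mult_left_mono)
    qed (simp add: wts_outside)
  qed
  also have "\<dots> = C * wint (\<lambda>_. 1)"
    by (simp add: wint_def)
  finally show ?thesis
    using wint_one_pos by (simp add: E_def abs_divide pos_divide_le_eq)
qed

lemma E_exp_sums:
  assumes f: "observable f"
  shows "(\<lambda>N. E (\<lambda>T. f T ^ N / fact N)) sums E (\<lambda>T. exp (f T))"
proof -
  obtain C where C: "\<And>T. T \<in> cube \<Longrightarrow> \<bar>f T\<bar> \<le> C"
    using f unfolding observable_def by (elim conjE exE) blast
  define g where "g N T = wts T * vdm T * (f T ^ N / fact N)" for N T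
  have obs: "observable (\<lambda>T. f T ^ N / fact N)" for N
    using observable_cmult[OF observable_power[OF f], of "1 / fact N" N] by simp
  have int: "integrable M (g N)" for N
    unfolding g_def by (rule integrable_weight[OF obs])
  have "summable (\<lambda>N. norm (g N T))" for T
    using summable_mult[OF summable_norm_exp[of "f T"], of "norm (wts T * vdm T)"]
    by (simp add: g_def abs_mult divide_inverse mult_ac)
  moreover have "summable (\<lambda>N. \<integral>T. norm (g N T) \<partial>M)"
  proof (rule summable_comparison_test'[of "\<lambda>N. wint (\<lambda>_. 1) * (\<bar>C\<bar> ^ N / fact N)" 0])
    show "summable (\<lambda>N. wint (\<lambda>_. 1) * (\<bar>C\<bar> ^ N / fact N))"
      using summable_mult[OF summable_exp[of "\<bar>C\<bar>"]] by (simp add: divide_inverse mult.commute)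
    fix N
    have "(\<integral>T. norm (g N T) \<partial>M) \<le> (\<integral>T. wts T * vdm T * (\<bar>C\<bar> ^ N / fact N) \<partial>M)"
    proof (rule integral_mono)
      show "integrable M (\<lambda>T. norm (g N T))"
        by (intro integrable_norm int)
      show "integrable M (\<lambda>T. wts T * vdm T * (\<bar>C\<bar> ^ N / fact N))"
        by (intro integrable_weight observable_const)
      show "norm (g N T) \<le> wts T * vdm T * (\<bar>C\<bar> ^ N / fact N)" for T
      proof (cases "T \<in> cube")
        case True
        have "\<bar>f T\<bar> ^ N \<le> \<bar>C\<bar> ^ N"
          using C[OF True] by (intro power_mono) auto
        then show ?thesis
          using wts_nonneg[of T] vdm_nonneg[of T]
          by (simp add: g_def abs_mult power_abs mult_left_mono divide_right_mono)
      qed (simp add: g_def wts_outside)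
    qed
    also have "\<dots> = wint (\<lambda>_. 1) * (\<bar>C\<bar> ^ N / fact N)"
      by (simp add: wint_def)
    finally show "norm (\<integral>T. norm (g N T) \<partial>M) \<le> wint (\<lambda>_. 1) * (\<bar>C\<bar> ^ N / fact N)"
      by simp
  qed
  ultimately have "(\<lambda>N. integral\<^sup>L M (g N)) sums (\<integral>T. (\<Sum>N. g N T) \<partial>M)"
    by (intro sums_integral int) auto
  moreover have "(\<Sum>N. g N T) = wts T * vdm T * exp (f T)" for T
  proof -
    have "(\<lambda>N. f T ^ N / fact N) sums exp (f T)"
      using exp_converges[of "f T"] by (simp add: divide_inverse mult.commute)
    from sums_mult[OF this, of "wts T * vdm T"] show ?thesis
      by (simp add: g_def sums_iff)
  qed
  ultimately have "(\<lambda>N. wint (\<lambda>T. f T ^ N / fact N)) sums wint (\<lambda>T. exp (f T))"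
    by (simp only: wint_def g_def[abs_def])
  from sums_divide[OF this] show ?thesis
    by (simp add: E_def)
qed

text \<open>Moments are bounded by (2n)^(l+k), so the series converges absolutely everywhere; summed
  along l + k = N it is the exponential series under the expectation.\<close>

lemma double_series_mgf_X:
  assumes "r > 0"
  shows "double_series (\<lambda>l k. moment l k / (fact l * fact k)) mgf_X r"
  unfolding double_series_def
proof (intro conjI allI impI)
  fix s t :: real
  define a where "a l k = moment l k / (fact l * fact k)" for l k
  define B where "B = 2 * real n"
  have obsX: "observable (\<lambda>T. X 1 T ^ l * X 2 T ^ k)" for l k
    by (intro observable_mult observable_power observable_X)
  have mb: "\<bar>moment l k\<bar> \<le> B ^ l * B ^ k" for l k
    unfolding moment_def
  proof (rule abs_E_le[OF obsX])
    fix T assume "T \<in> cube"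
    then show "\<bar>X 1 T ^ l * X 2 T ^ k\<bar> \<le> B ^ l * B ^ k"
      unfolding abs_mult power_abs B_def by (intro mult_mono power_mono abs_X_le) auto
  qed
  have ex: "((\<lambda>l. \<bar>x\<bar> ^ l / fact l) has_sum exp \<bar>x\<bar>) UNIV" for x :: real
    using exp_converges[of "\<bar>x\<bar>"] by (intro sums_nonneg_imp_has_sum) (auto simp: divide_inverse mult.commute)
  have "(\<lambda>(l, k). \<bar>B * s\<bar> ^ l / fact l * (\<bar>B * t\<bar> ^ k / fact k)) summable_on UNIV \<times> UNIV"
    by (rule has_sum_imp_summable[OF has_sum_times[OF ex ex]])
  then have "(\<lambda>(l, k). a l k * s ^ l * t ^ k) summable_on UNIV \<times> UNIV"
  proof (subst summable_on_iff_abs_summable_on_real, elim summable_on_comparison_test)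
    fix p :: "nat \<times> nat"
    obtain l k where p: "p = (l, k)" by (cases p)
    have "\<bar>moment l k\<bar> * (\<bar>s\<bar> ^ l * \<bar>t\<bar> ^ k) / (fact l * fact k) \<le> (B ^ l * B ^ k) * (\<bar>s\<bar> ^ l * \<bar>t\<bar> ^ k) / (fact l * fact k)"
      by (intro divide_right_mono mult_right_mono mb) auto
    then show "norm (case p of (l, k) \<Rightarrow> a l k * s ^ l * t ^ k)
        \<le> (case p of (l, k) \<Rightarrow> \<bar>B * s\<bar> ^ l / fact l * (\<bar>B * t\<bar> ^ k / fact k))"
      by (simp add: p a_def abs_mult power_abs power_mult_distrib B_def mult_ac)
  qed auto
  then obtain S where S: "((\<lambda>(l, k). a l k * s ^ l * t ^ k) has_sum S) UNIV"
    by (auto simp: summable_on_def)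
  also have "?this \<longleftrightarrow> ((\<lambda>(N, l). a l (N - l) * s ^ l * t ^ (N - l)) has_sum S) (Sigma UNIV (\<lambda>N. {..N}))"
    by (rule has_sum_reindex_bij_witness[where i = "\<lambda>(N, l). (l, N - l)" and j = "\<lambda>(l, k). (l + k, l)"]) auto
  finally have "((\<lambda>N. \<Sum>l\<le>N. a l (N - l) * s ^ l * t ^ (N - l)) has_sum S) UNIV"
    by (rule has_sum_SigmaD) (auto intro: has_sum_finiteI)
  then have sums1: "(\<lambda>N. \<Sum>l\<le>N. a l (N - l) * s ^ l * t ^ (N - l)) sums S"
    by (rule has_sum_imp_sums)
  have expand: "E (\<lambda>T. (s * X 1 T + t * X 2 T) ^ N / fact N) = (\<Sum>l\<le>N. a l (N - l) * s ^ l * t ^ (N - l))" for N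
  proof -
    have "E (\<lambda>T. (s * X 1 T + t * X 2 T) ^ N / fact N)
        = E (\<lambda>T. \<Sum>l\<le>N. (s ^ l * t ^ (N - l) / (fact l * fact (N - l))) * (X 1 T ^ l * X 2 T ^ (N - l)))"
    proof (rule arg_cong[where f = E], rule ext)
      fix T
      show "(s * X 1 T + t * X 2 T) ^ N / fact N
        = (\<Sum>l\<le>N. (s ^ l * t ^ (N - l) / (fact l * fact (N - l))) * (X 1 T ^ l * X 2 T ^ (N - l)))"
        unfolding binomial_ring sum_divide_distrib
        by (intro sum.cong) (auto simp: binomial_fact power_mult_distrib field_simps)
    qed
    also have "\<dots> = (\<Sum>l\<le>N. E (\<lambda>T. (s ^ l * t ^ (N - l) / (fact l * fact (N - l))) * (X 1 T ^ l * X 2 T ^ (N - l))))"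
      by (intro E_sum observable_cmult obsX) auto
    also have "\<dots> = (\<Sum>l\<le>N. a l (N - l) * s ^ l * t ^ (N - l))"
      unfolding E_cmult by (intro sum.cong) (auto simp: a_def moment_def)
    finally show ?thesis .
  qed
  have "observable (\<lambda>T. s * X 1 T + t * X 2 T)"
    by (intro observable_add observable_cmult observable_X)
  from E_exp_sums[OF this] have "(\<lambda>N. \<Sum>l\<le>N. a l (N - l) * s ^ l * t ^ (N - l)) sums mgf_X s t"
    unfolding mgf_X_def expand .
  with sums1 have "S = mgf_X s t"
    by (rule sums_unique2)
  with S show "((\<lambda>(l, k). moment l k / (fact l * fact k) * s ^ l * t ^ k) has_sum mgf_X s t) UNIV"
    by (simp add: a_def)
qed (rule assms)

lemma mom_replicate: "mom (\<lambda>_. 1) (replicate l 1 @ replicate k 2) = moment l k"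
proof -
  have "mon (replicate l 1 @ replicate k 2) T = X 1 T ^ l * X 2 T ^ k" for T
    by (simp add: mon_def prod_list_replicate)
  then show ?thesis
    by (simp add: mom_def moment_def)
qed

text \<open>Two families are needed because \<open>cumul\<close> has a distinguished entry: positive
  powers of s come from differentiating in s, pure powers of t from differentiating in t.\<close>

lemma log_mgf_X:
  obtains c R where "double_series c (\<lambda>s t. ln (mgf_X s t)) R"
    "\<And>s t. \<bar>s\<bar> < R \<Longrightarrow> \<bar>t\<bar> < R \<Longrightarrow> mgf_X s t > 0"
    "\<And>l k. fact (Suc l) * fact k * c (Suc l) k = cumul (X 1) (replicate l 1 @ replicate k 2)"
    "\<And>k. fact (Suc k) * c 0 (Suc k) = cumul (X 2) (replicate k 2)"
proof -
  let ?a = "\<lambda>l k. moment l k / (fact l * fact k)"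
  have a: "double_series ?a mgf_X 2"
    by (rule double_series_mgf_X) simp
  have m00: "moment 0 0 = 1"
    by (simp add: moment_def E_const)
  then obtain c R where c: "double_series c (\<lambda>s t. ln (mgf_X s t)) R" and R: "R \<le> 2"
    and pos: "\<And>s t. \<bar>s\<bar> < R \<Longrightarrow> \<bar>t\<bar> < R \<Longrightarrow> mgf_X s t > 0"
    using ln_double_series[OF _ a] by auto
  have aR: "double_series ?a mgf_X R"
    using c by (intro double_series_mgf_X) (auto simp: double_series_def)
  have ex: "mgf_X s t = exp (ln (mgf_X s t))" if "\<bar>s\<bar> < R" "\<bar>t\<bar> < R" for s t
    using pos[OF that] by simp
  have fb: "(fact n :: real) / (fact i * fact (n - i)) = real (n choose i)" if "i \<le> n" for i n
    using that by (simp add: binomial_fact)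
  \<comment> \<open>Both sides solve the same binomial recursion against the moments: one by the
    differential equation of the exponential, the other by \<open>conv_cumul\<close>.\<close>
  have k1: "fact (Suc l) * fact k * c (Suc l) k = cumul (X 1) (replicate l 1 @ replicate k 2)" for l k
  proof (rule binomial_convolution_unique[where m = moment and u = "\<lambda>l k. fact (Suc l) * fact k * c (Suc l) k"
        and v = "\<lambda>l k. cumul (X 1) (replicate l 1 @ replicate k 2)", OF m00])
    fix l k
    have "moment (Suc l) k = fact l * fact k * (real (Suc l) * ?a (Suc l) k)"
      by (simp del: of_nat_Suc)
    also have "\<dots> = fact l * fact k * (\<Sum>i\<le>l. \<Sum>j\<le>k. real (Suc i) * c (Suc i) j * ?a (l - i) (k - j))"
      by (subst double_series_exp_deriv[OF aR c ex]) auto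
    also have "\<dots> = (\<Sum>i\<le>l. \<Sum>j\<le>k. real (l choose i) * real (k choose j)
        * (fact (Suc i) * fact j * c (Suc i) j * moment (l - i) (k - j)))"
      unfolding sum_distrib_left
      by (intro sum.cong refl) (simp add: fb[symmetric] field_simps)
    finally have 1: "moment (Suc l) k = \<dots>" .
    have "moment (Suc l) k = mom (X 1) (replicate l 1 @ replicate k 2)"
      using mom_X_Cons[of 1 "replicate l 1 @ replicate k 2"] mom_replicate[of "Suc l" k] by simp
    also have "\<dots> = conv (cumul (X 1)) (mom (\<lambda>_. 1)) (replicate l 1 @ replicate k 2)"
      by (rule conv_cumul[symmetric])
    also have "\<dots> = (\<Sum>i\<le>l. \<Sum>j\<le>k. real (l choose i) * real (k choose j)
        * (cumul (X 1) (replicate i 1 @ replicate j 2) * moment (l - i) (k - j)))"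
      by (simp only: conv_replicate2 mom_replicate)
    finally show "(\<Sum>i\<le>l. \<Sum>j\<le>k. real (l choose i) * real (k choose j)
        * (fact (Suc i) * fact j * c (Suc i) j * moment (l - i) (k - j)))
      = (\<Sum>i\<le>l. \<Sum>j\<le>k. real (l choose i) * real (k choose j)
        * (cumul (X 1) (replicate i 1 @ replicate j 2) * moment (l - i) (k - j)))"
      using 1 by simp
  qed
  have k2: "fact (Suc k) * c 0 (Suc k) = cumul (X 2) (replicate k 2)" for k
  proof -
    define u where "u l k = (if l = 0 then fact (Suc k) * c 0 (Suc k) else 0 :: real)" for l k :: nat
    define v where "v l k = (if l = 0 then cumul (X 2) (replicate k 2) else 0)" for l k :: nat
    have m: "real (Suc l) * ?a 0 (Suc l) = (\<Sum>i\<le>l. real (Suc i) * c 0 (Suc i) * ?a 0 (l - i))" for l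
      using double_series_exp_deriv[OF double_series_swap[OF aR] double_series_swap[OF c], of l 0] ex by simp
    have one: "(\<Sum>j\<le>k. real (k choose j) * (u 0 j * moment 0 (k - j)))
        = (\<Sum>j\<le>k. real (k choose j) * (v 0 j * moment 0 (k - j)))" for k
    proof -
      have "moment 0 (Suc k) = fact k * (real (Suc k) * ?a 0 (Suc k))"
        by (simp del: of_nat_Suc)
      also have "\<dots> = (\<Sum>j\<le>k. real (k choose j) * (u 0 j * moment 0 (k - j)))"
        unfolding m sum_distrib_left u_def
        by (intro sum.cong refl) (simp add: fb[symmetric] field_simps)
      finally have 1: "moment 0 (Suc k) = \<dots>" .
      have "moment 0 (Suc k) = mom (X 2) (replicate k 2)"
        using mom_X_Cons[of 2 "replicate k 2"] mom_replicate[of 0 "Suc k"] by simp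
      also have "\<dots> = conv (cumul (X 2)) (mom (\<lambda>_. 1)) (replicate k 2)"
        by (rule conv_cumul[symmetric])
      also have "\<dots> = (\<Sum>j\<le>k. real (k choose j) * (v 0 j * moment 0 (k - j)))"
        using mom_replicate[of 0] by (simp add: conv_replicate v_def)
      finally show ?thesis
        using 1 by simp
    qed
    have "u 0 k = v 0 k"
    proof (induction k rule: less_induct)
      case (less k)
      have "(\<Sum>j<k. real (k choose j) * (u 0 j * moment 0 (k - j))) = (\<Sum>j<k. real (k choose j) * (v 0 j * moment 0 (k - j)))"
        using less by (intro sum.cong) auto
      with one[of k] show ?case
        by (simp add: m00 flip: lessThan_Suc_atMost)
    qed
    then show ?thesis
      by (simp add: u_def v_def)
  qed
  show ?thesis
    by (rule that[OF c pos k1 k2])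
qed

section \<open>Passage to conductance and shot noise\<close>

lemma set_integral_eq_wint:
  assumes "\<And>T. f T = (\<Prod>j<n. T j powr a * (1 - T j) powr b) * vdm T * u T"
  shows "(LINT T : (\<Pi>\<^sub>E j\<in>{..<n}. {0..1}) | M. f T) = wint u"
  unfolding set_lebesgue_integral_def wint_def
proof (rule Bochner_Integration.integral_cong[OF refl])
  fix T assume "T \<in> space M"
  then have "indicator (\<Pi>\<^sub>E j\<in>{..<n}. {0..1}) T = (\<Prod>j<n. indicator {0..1} (T j) :: real)"
    by (auto simp: space_PiM PiE_iff indicator_def)
  then show "indicator (\<Pi>\<^sub>E j\<in>{..<n}. {0..1}) T *\<^sub>R f T = wts T * vdm T * u T"
    by (simp add: assms wts_def wt_def prod.distrib mult_ac)
qed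

lemma sum_coord: "(\<Sum>j<n. T j) = real n / 2 + X 1 T / 4"
proof -
  have "(\<Sum>j<n. T j) = (\<Sum>j<n. 1 / 2 + cheb 1 (T j) / 4)"
    by (intro sum.cong) (simp_all add: field_simps)
  then show ?thesis
    by (simp only: X_def sum.distrib sum_divide_distrib) simp
qed

lemma sum_coord_reflect: "(\<Sum>j<n. T j * (1 - T j)) = real n / 8 - X 2 T / 16"
proof -
  have "t * (1 - t) = 1 / 8 - cheb 2 t / 16" for t
    by (simp add: numeral_2_eq_2 power2_eq_square field_simps)
  then show ?thesis
    by (simp add: X_def sum_subtractf sum_divide_distrib)
qed

text \<open>Conductance and shot noise are affine in \<open>X 1\<close> and \<open>X 2\<close>: the
  constants become the prefactor, the slopes rescale the arguments.\<close>

lemma joint_mgf_eq: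
  assumes "b = of_int \<delta> / 2"
  shows "joint_mgf \<beta> \<delta> a n z w = exp (- z * real n / 2 - w * real n / 8) * mgf_X (- z / 4) (w / 16)"
proof -
  have "unnormalized_mgf \<beta> \<delta> a n z w = wint (\<lambda>T. exp (- z * (\<Sum>j<n. T j) - w * (\<Sum>j<n. T j * (1 - T j))))"
    unfolding unnormalized_mgf_def
  proof (rule set_integral_eq_wint)
    fix T :: "nat \<Rightarrow> real"
    have "(\<Prod>j<n. exp (- z * T j - w * (T j * (1 - T j))))
        = exp (- z * (\<Sum>j<n. T j) - w * (\<Sum>j<n. T j * (1 - T j)))"
      by (simp add: exp_sum[symmetric] sum_subtractf sum_negf sum_distrib_left)
    then show "(\<Prod>j<n. T j powr a * (1 - T j) powr (of_int \<delta> / 2)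
                 * exp (- z * T j - w * (T j * (1 - T j))))
        * (\<Prod>k<n. \<Prod>j<k. \<bar>T k - T j\<bar> ^ \<beta>)
      = (\<Prod>j<n. T j powr a * (1 - T j) powr b) * vdm T
        * exp (- z * (\<Sum>j<n. T j) - w * (\<Sum>j<n. T j * (1 - T j)))"
      by (simp add: prod.distrib vdm_def assms mult_ac)
  qed
  moreover have "normalization_constant \<beta> \<delta> a n = wint (\<lambda>_. 1)"
    unfolding normalization_constant_def
    by (rule set_integral_eq_wint) (simp add: vdm_def assms)
  ultimately have "joint_mgf \<beta> \<delta> a n z w = E (\<lambda>T. exp (- z * (\<Sum>j<n. T j) - w * (\<Sum>j<n. T j * (1 - T j))))"
    by (simp add: joint_mgf_def E_def)
  also have "\<dots> = E (\<lambda>T. exp (- z * real n / 2 - w * real n / 8) * exp (- z / 4 * X 1 T + w / 16 * X 2 T))"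
    unfolding sum_coord_reflect unfolding sum_coord exp_add[symmetric] by (simp add: algebra_simps)
  finally show ?thesis
    by (simp add: E_cmult mgf_X_def)
qed

text \<open>After the logarithm the prefactor is linear and affects only the indices (1, 0) and (0,
  1), which the side conditions avoid. Uniqueness of double series makes the description by THE well
  defined.\<close>

lemma joint_cumulant_eq:
  assumes "b = of_int \<delta> / 2"
  shows "l + k \<ge> 1 \<Longrightarrow> joint_cumulant \<beta> \<delta> a n (Suc l) k
      = (1 / 4) ^ Suc l * (- 1 / 16) ^ k * cumul (X 1) (replicate l 1 @ replicate k 2)"
    and "k \<ge> 1 \<Longrightarrow> joint_cumulant \<beta> \<delta> a n 0 (Suc k) = (- 1 / 16) ^ Suc k * cumul (X 2) (replicate k 2)"
proof -
  obtain c R where c: "double_series c (\<lambda>s t. ln (mgf_X s t)) R"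
    and pos: "\<And>s t. \<bar>s\<bar> < R \<Longrightarrow> \<bar>t\<bar> < R \<Longrightarrow> mgf_X s t > 0"
    and c1: "\<And>l k. fact (Suc l) * fact k * c (Suc l) k = cumul (X 1) (replicate l 1 @ replicate k 2)"
    and c2: "\<And>k. fact (Suc k) * c 0 (Suc k) = cumul (X 2) (replicate k 2)"
    by (rule log_mgf_X, rule that)
  have R: "R > 0"
    using c by (simp add: double_series_def)
  define e where "e l k = (if (l, k) = (1, 0) then - real n / 2 else if (l, k) = (0, 1) then - real n / 8 else 0)"
    for l k :: nat
  define d where "d l k = c l k * (- 1 / 4) ^ l * (1 / 16) ^ k + e l k" for l k
  define \<kappa> where "\<kappa> l k = (-1) ^ (l + k) * (fact l * fact k) * d l k" for l k
  have series: "double_series d (\<lambda>z w. ln (joint_mgf \<beta> \<delta> a n z w)) R"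
    unfolding double_series_def
  proof (intro conjI allI impI)
    fix z w :: real assume zw: "\<bar>z\<bar> < R" "\<bar>w\<bar> < R"
    then have st: "\<bar>- z / 4\<bar> < R" "\<bar>w / 16\<bar> < R"
      by auto
    have "((\<lambda>(l, k). e l k * z ^ l * w ^ k) has_sum - z * real n / 2 - w * real n / 8) UNIV"
      by (rule has_sum_finite_neutralI[of "{(1, 0), (0, 1)}"])
        (auto simp: e_def mult.commute split: if_splits)
    moreover have "((\<lambda>(l, k). c l k * (- z / 4) ^ l * (w / 16) ^ k) has_sum ln (mgf_X (- z / 4) (w / 16))) UNIV"
      using c st by (simp add: double_series_def)
    ultimately have "((\<lambda>p. (case p of (l, k) \<Rightarrow> e l k * z ^ l * w ^ k) + (case p of (l, k) \<Rightarrow> c l k * (- z / 4) ^ l * (w / 16) ^ k))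
        has_sum (- z * real n / 2 - w * real n / 8) + ln (mgf_X (- z / 4) (w / 16))) UNIV"
      by (rule has_sum_add)
    moreover have "(- z * real n / 2 - w * real n / 8) + ln (mgf_X (- z / 4) (w / 16)) = ln (joint_mgf \<beta> \<delta> a n z w)"
      unfolding joint_mgf_eq[OF assms] using pos[OF st] by (subst ln_mult) auto
    moreover have "(case p of (l, k) \<Rightarrow> e l k * z ^ l * w ^ k) + (case p of (l, k) \<Rightarrow> c l k * (- z / 4) ^ l * (w / 16) ^ k)
        = (case p of (l, k) \<Rightarrow> d l k * z ^ l * w ^ k)" for p
    proof -
      obtain l k where p: "p = (l, k)" by (cases p)
      have "(- z / 4) ^ l = (- 1 / 4) ^ l * z ^ l" "(w / 16) ^ k = (1 / 16) ^ k * w ^ k"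
        by (simp_all add: power_mult_distrib[symmetric])
      then show ?thesis
        by (simp add: p d_def algebra_simps)
    qed
    ultimately show "((\<lambda>(l, k). d l k * z ^ l * w ^ k) has_sum ln (joint_mgf \<beta> \<delta> a n z w)) UNIV"
      by simp
  qed (rule R)
  have coeff_iff: "is_joint_cumulants (joint_mgf \<beta> \<delta> a n) \<kappa>' \<longleftrightarrow>
      (\<exists>r. double_series (\<lambda>l k. (-1) ^ (l + k) * \<kappa>' l k / (fact l * fact k)) (\<lambda>z w. ln (joint_mgf \<beta> \<delta> a n z w)) r)" for \<kappa>'
    by (auto simp: is_joint_cumulants_def double_series_def)
  have d_\<kappa>: "(\<lambda>l k. (-1) ^ (l + k) * \<kappa> l k / (fact l * fact k)) = d"
    by (simp add: fun_eq_iff \<kappa>_def flip: power_add mult_2)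
  have "joint_cumulant \<beta> \<delta> a n = \<kappa>"
    unfolding joint_cumulant_def
  proof (rule the_equality)
    show "is_joint_cumulants (joint_mgf \<beta> \<delta> a n) \<kappa>"
      unfolding coeff_iff d_\<kappa> using series by blast
    fix \<kappa>' assume "is_joint_cumulants (joint_mgf \<beta> \<delta> a n) \<kappa>'"
    then obtain r where "double_series (\<lambda>l k. (-1) ^ (l + k) * \<kappa>' l k / (fact l * fact k)) (\<lambda>z w. ln (joint_mgf \<beta> \<delta> a n z w)) r"
      unfolding coeff_iff by blast
    from double_series_unique[OF this series]
    have *: "(-1) ^ (l + k) * \<kappa>' l k / (fact l * fact k) = d l k" for l k
      by (simp add: fun_eq_iff)
    show "\<kappa>' = \<kappa>"
      by (simp add: fun_eq_iff \<kappa>_def *[symmetric] flip: power_add mult_2)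
  qed
  moreover have "\<kappa> (Suc l) k = (1 / 4) ^ Suc l * (- 1 / 16) ^ k * (fact (Suc l) * fact k * c (Suc l) k)"
    if "l + k \<ge> 1" for l k
  proof -
    have "(-1 :: real) ^ (Suc l + k) * (- 1 / 4) ^ Suc l * (1 / 16) ^ k = (1 / 4) ^ Suc l * (- 1 / 16) ^ k"
    proof -
      have "(-1 :: real) * (1 / 16) = - 1 / 16" "(-1 :: real) * (- 1 / 4) = 1 / 4"
        by simp_all
      moreover have "(-1 :: real) ^ (Suc l + k) * (- 1 / 4) ^ Suc l * (1 / 16) ^ k
          = ((-1) ^ Suc l * (- 1 / 4) ^ Suc l) * ((-1) ^ k * (1 / 16) ^ k)"
        by (simp only: power_add mult_ac)
      ultimately show ?thesis
        by (simp only: power_mult_distrib[symmetric])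
    qed
    moreover have "e (Suc l) k = 0"
      using that by (auto simp: e_def)
    ultimately show ?thesis
      by (simp add: \<kappa>_def d_def mult_ac)
  qed
  moreover have "\<kappa> 0 (Suc k) = (- 1 / 16) ^ Suc k * (fact (Suc k) * c 0 (Suc k))" if "k \<ge> 1" for k
  proof -
    have "(-1 :: real) ^ (0 + Suc k) * (1 / 16) ^ Suc k = (- 1 / 16) ^ Suc k"
    proof -
      have "(-1 :: real) * (1 / 16) = - 1 / 16"
        by simp
      then show ?thesis
        by (simp only: add_0 power_mult_distrib[symmetric])
    qed
    moreover have "e 0 (Suc k) = 0"
      using that by (auto simp: e_def)
    ultimately show ?thesis
      by (simp add: \<kappa>_def d_def mult_ac)
  qed
  ultimately show "l + k \<ge> 1 \<Longrightarrow> joint_cumulant \<beta> \<delta> a n (Suc l) k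
      = (1 / 4) ^ Suc l * (- 1 / 16) ^ k * cumul (X 1) (replicate l 1 @ replicate k 2)"
    "k \<ge> 1 \<Longrightarrow> joint_cumulant \<beta> \<delta> a n 0 (Suc k) = (- 1 / 16) ^ Suc k * cumul (X 2) (replicate k 2)"
    by (simp_all only: c1 c2)
qed

end

section \<open>Asymptotics of the joint cumulants\<close>

text \<open>Holds the exponents fixed while n varies; the ensemble for a single n is interpreted for
  each n from 1 on.\<close>

locale jacobi_family =
  fixes \<beta> :: nat and a b :: real and \<delta> :: int
  assumes \<beta>: "\<beta> \<ge> 1" and a: "a > -1" and b: "b > -1" and b_\<delta>: "b = of_int \<delta> / 2"
begin

definition Q :: "nat \<Rightarrow> nat \<Rightarrow> nat list \<Rightarrow> real" where
  "Q n = jacobi_ensemble.scaled_cumulant n \<beta> a b"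

lemma jacobi: "n \<ge> 1 \<Longrightarrow> jacobi_ensemble n \<beta> a b"
  using \<beta> a b by unfold_locales

sublocale cumulant_hierarchy_parity Q "real \<beta>" "jacobi_ensemble.\<rho> \<beta>" "jacobi_ensemble.g \<beta> a b"
    "jacobi_ensemble.\<gamma> \<beta> a b" "jacobi_ensemble.h \<beta> a b"
proof
  fix n k :: nat and xs :: "nat list" assume n: "n \<ge> 1"
  interpret jacobi_ensemble n \<beta> a b
    by (rule jacobi[OF n])
  show "Q n 0 = (\<lambda>xs. 2 * conv_unit xs)"
    unfolding Q_def by (rule scaled_cumulant_0)
  assume "k \<ge> 1"
  from scaled_cumulant_recursion[OF this, of xs]
  show "Q n k xs
      + 1 / 2 * (\<Sum>a\<in>{1..<k}. 1 / real n * (1 / real n * Q n a ((k - a) # xs)) + conv (Q n a) (Q n (k - a)) xs)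
      + 1 / real n * ((real k * \<rho> - g) * Q n k xs
          - 2 * (\<Sum>j\<in>{1..<k}. \<gamma> (k - j) * Q n j xs) - \<gamma> k * Q n 0 xs)
      - pick_sum (\<lambda>m ys. real m / real \<beta> * (Q n ((k - m) + (m - k)) ys - Q n (k + m) ys)) xs = 0"
    unfolding Q_def .
next
  have "jacobi_ensemble 1 \<beta> a b"
    by (rule jacobi) simp
  then show "jacobi_ensemble.\<gamma> \<beta> a b d = (if even d then jacobi_ensemble.g \<beta> a b else jacobi_ensemble.h \<beta> a b)" for d
    by (rule jacobi_ensemble.\<gamma>_def)
qed

lemma joint_cumulant_scaled:
  assumes n: "n \<ge> 1" and lk: "l + k \<ge> 1"
  shows "real n ^ (l + k) * joint_cumulant \<beta> \<delta> a n (Suc l) k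
      = (1 / 4) ^ Suc l * (- 1 / 16) ^ k * (real n * Q n 1 (replicate l 1 @ replicate k 2))"
proof -
  interpret je: jacobi_ensemble n \<beta> a b
    by (rule jacobi[OF n])
  have "real n * Q n 1 (replicate l 1 @ replicate k 2) = real n ^ (l + k) * je.cumul (je.X 1) (replicate l 1 @ replicate k 2)"
    using n by (simp add: Q_def je.scaled_cumulant_def)
  then show ?thesis
    by (simp only: je.joint_cumulant_eq(1)[OF b_\<delta> lk] mult_ac)
qed

lemma joint_cumulant_scaled_0:
  assumes n: "n \<ge> 1" and k: "k \<ge> 1"
  shows "real n ^ k * joint_cumulant \<beta> \<delta> a n 0 (Suc k) = (- 1 / 16) ^ Suc k * (real n * Q n 2 (replicate k 2))"
proof -
  interpret je: jacobi_ensemble n \<beta> a b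
    by (rule jacobi[OF n])
  have "real n * Q n 2 (replicate k 2) = real n ^ k * je.cumul (je.X 2) (replicate k 2)"
    using n by (simp add: Q_def je.scaled_cumulant_def)
  then show ?thesis
    by (simp only: je.joint_cumulant_eq(2)[OF b_\<delta> k] mult_ac)
qed

lemma \<rho>_eq: "jacobi_ensemble.\<rho> \<beta> = 1 / real \<beta> - 1 / 2"
  and g_eq: "jacobi_ensemble.g \<beta> a b = - (a + b + 1 - real \<beta> / 2) / real \<beta>"
  and h_eq: "jacobi_ensemble.h \<beta> a b = (a - b) / real \<beta>"
  using jacobi_ensemble.\<rho>_def[OF jacobi[of 1]] jacobi_ensemble.g_def[OF jacobi[of 1]]
    jacobi_ensemble.h_def[OF jacobi[of 1]] by simp_all

text \<open>The total index is l + 2k, so odd l is the odd case. Excluding (1, 0) keeps the list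
  beside the distinguished x_1 nonempty.\<close>

theorem joint_cumulant_odd:
  assumes "odd l" "(l, k) \<noteq> (1, 0)"
  shows "(\<lambda>n. real n ^ (l + k) * joint_cumulant \<beta> \<delta> a n l k) \<longlonglongrightarrow>
    (b - a) * (a + b + 2 - real \<beta>) * (fact (k + l - 1) / (real \<beta> * (2 * real \<beta>) ^ l * (4 * real \<beta>) ^ k))"
proof -
  obtain l' where l: "l = Suc l'" "even l'"
    using assms(1) by (cases l) auto
  define xs where "xs = replicate l' (1 :: nat) @ replicate k 2"
  have xs: "0 \<notin> set xs" "xs \<noteq> []" "odd (1 + sum_list xs)" "length xs = l' + k" "prod_list xs = 2 ^ k"
    using assms(2) l by (auto simp: xs_def sum_list_replicate prod_list_replicate)
  have \<beta>0: "real \<beta> > 0"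
    using \<beta> by simp
  have "(\<lambda>n. (1 / 4) ^ l * (- 1 / 16) ^ k * (real n ^ 2 * Q n 1 xs)) \<longlonglongrightarrow>
      (1 / 4) ^ l * (- 1 / 16) ^ k * (- 2 * jacobi_ensemble.h \<beta> a b * (jacobi_ensemble.\<rho> \<beta> - jacobi_ensemble.g \<beta> a b)
        * real 1 * (-1) ^ length xs * fact (length xs) * (2 / real \<beta>) ^ length xs * real (prod_list xs))"
    by (intro tendsto_mult_left Q_tendsto_second_order xs \<beta>0) auto
  also have "(1 / 4) ^ l * (- 1 / 16) ^ k * (- 2 * jacobi_ensemble.h \<beta> a b * (jacobi_ensemble.\<rho> \<beta> - jacobi_ensemble.g \<beta> a b)
        * real 1 * (-1) ^ length xs * fact (length xs) * (2 / real \<beta>) ^ length xs * real (prod_list xs))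
      = (b - a) * (a + b + 2 - real \<beta>) * (fact (k + l - 1) / (real \<beta> * (2 * real \<beta>) ^ l * (4 * real \<beta>) ^ k))"
  proof -
    \<comment> \<open>Origin of the two factors: h contributes (a - b)/\<beta>, and \<rho> - g
      simplifies to (a + b + 2 - \<beta>)/\<beta>.\<close>
    have hg: "- 2 * jacobi_ensemble.h \<beta> a b * (jacobi_ensemble.\<rho> \<beta> - jacobi_ensemble.g \<beta> a b)
        = 2 * ((b - a) * (a + b + 2 - real \<beta>)) / real \<beta> ^ 2"
      using \<beta>0 by (simp add: \<rho>_eq g_eq h_eq field_simps power2_eq_square)
    have s: "(- 1 / 16 :: real) ^ k * (-1) ^ (l' + k) = (1 / 16) ^ k"
      using l(2) by (simp add: power_add flip: power_mult_distrib)
    have p: "(1 / 4) ^ l * (1 / 16) ^ k * (2 / real \<beta> ^ 2 * (2 / real \<beta>) ^ (l' + k) * 2 ^ k)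
        = 1 / (real \<beta> * (2 * real \<beta>) ^ l * (4 * real \<beta>) ^ k)"
    proof -
      have e12: "(1 / 4) ^ l * (2 / real \<beta>) ^ l = (1 / (2 * real \<beta>)) ^ l"
        "(1 / 16) ^ k * ((2 / real \<beta>) ^ k * 2 ^ k) = (1 / (4 * real \<beta>)) ^ k"
        by (simp_all flip: power_mult_distrib)
      have e3: "2 / real \<beta> ^ 2 * (2 / real \<beta>) ^ (l' + k) = 1 / real \<beta> * ((2 / real \<beta>) ^ l * (2 / real \<beta>) ^ k)"
        by (simp add: l power_add power2_eq_square)
      have "(1 / 4) ^ l * (1 / 16) ^ k * (2 / real \<beta> ^ 2 * (2 / real \<beta>) ^ (l' + k) * 2 ^ k)
          = 1 / real \<beta> * ((1 / 4) ^ l * (2 / real \<beta>) ^ l) * ((1 / 16) ^ k * ((2 / real \<beta>) ^ k * 2 ^ k))"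
        unfolding e3 by (simp only: mult_ac)
      also have "\<dots> = 1 / real \<beta> * (1 / (2 * real \<beta>)) ^ l * (1 / (4 * real \<beta>)) ^ k"
        unfolding e12 ..
      finally have "(1 / 4) ^ l * (1 / 16) ^ k * (2 / real \<beta> ^ 2 * (2 / real \<beta>) ^ (l' + k) * 2 ^ k)
          = 1 / real \<beta> * (1 / (2 * real \<beta>)) ^ l * (1 / (4 * real \<beta>)) ^ k" .
      then show ?thesis
        by (simp add: power_one_over)
    qed
    have "(1 / 4) ^ l * (- 1 / 16) ^ k * (2 * ((b - a) * (a + b + 2 - real \<beta>)) / real \<beta> ^ 2
        * real 1 * (-1) ^ (l' + k) * fact (l' + k) * (2 / real \<beta>) ^ (l' + k) * real (2 ^ k))
      = (b - a) * (a + b + 2 - real \<beta>) * fact (l' + k)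
        * ((1 / 4) ^ l * ((- 1 / 16) ^ k * (-1) ^ (l' + k)) * (2 / real \<beta> ^ 2 * (2 / real \<beta>) ^ (l' + k) * 2 ^ k))"
      by simp
    also have "\<dots> = (b - a) * (a + b + 2 - real \<beta>) * (fact (k + l - 1) / (real \<beta> * (2 * real \<beta>) ^ l * (4 * real \<beta>) ^ k))"
      unfolding s p by (simp add: l add.commute)
    finally show ?thesis
      unfolding hg xs .
  qed
  finally show ?thesis
  proof (rule Lim_transform_eventually)
    show "\<forall>\<^sub>F n in sequentially. (1 / 4) ^ l * (- 1 / 16) ^ k * (real n ^ 2 * Q n 1 xs)
        = real n ^ (l + k) * joint_cumulant \<beta> \<delta> a n l k"
    proof (rule eventually_mono[OF eventually_ge_at_top[of 1]])
      fix n :: nat assume n: "n \<ge> 1"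
      have lk: "l' + k \<ge> 1"
        using xs(2,4) by (cases xs) auto
      have "real n ^ (l + k) * joint_cumulant \<beta> \<delta> a n l k = real n * (real n ^ (l' + k) * joint_cumulant \<beta> \<delta> a n (Suc l') k)"
        by (simp add: l)
      also have "\<dots> = (1 / 4) ^ l * (- 1 / 16) ^ k * (real n ^ 2 * Q n 1 xs)"
        unfolding joint_cumulant_scaled[OF n lk] by (simp add: l xs_def power2_eq_square)
      finally show "(1 / 4) ^ l * (- 1 / 16) ^ k * (real n ^ 2 * Q n 1 xs) = real n ^ (l + k) * joint_cumulant \<beta> \<delta> a n l k"
        by simp
    qed
  qed
qed

text \<open>Serves l = 0 and l > 0 at once, since either letter may be distinguished: the constant
  term of the product over all entries is twice the coefficient at \<open>k0\<close>, and
  \<open>k0\<close> completes the product of the entries to 2^k.\<close>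

lemma first_order_limit:
  assumes "even l" "k0 # xs = replicate l 1 @ replicate k 2" "length xs \<ge> 2"
  shows "(\<lambda>n. (1 / 4) ^ l * (- 1 / 16) ^ k * (real n * Q n k0 xs)) \<longlonglongrightarrow>
    (-1) ^ k * (real \<beta> / 2 - 1) * (fact (l + k - 2) / ((4 * real \<beta>) ^ k * (4 * real \<beta>) ^ l))
      * (\<Sum>j=0..k. real ((2 * j + l) choose (j + l div 2)) * real (k choose j) * (-2) powi (- int j))"
    (is "_ \<longlonglongrightarrow> _ * ?S")
proof -
  have \<beta>0: "real \<beta> > 0"
    using \<beta> by simp
  have "set (k0 # xs) \<subseteq> {1, 2}"
    unfolding assms(2) by auto
  then have k0: "k0 \<ge> 1" and nz: "0 \<notin> set xs"
    by auto
  have len: "length xs = l + k - 1" "l + k \<ge> 3"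
    using arg_cong[OF assms(2), of length] assms(3) by auto
  have prod: "real (prod_list xs) * real k0 = 2 ^ k"
    using arg_cong[OF assms(2), of prod_list] by (simp add: prod_list_replicate mult.commute flip: of_nat_mult)
  have "coeff_Laurent 0 (k0 # xs) = 2 * coeff_Laurent (int k0) xs"
    using coeff_Laurent_minus[of "int k0" xs] by simp
  then have E: "coeff_Laurent (int k0) xs = (-2) ^ k * ?S / 2"
    unfolding assms(2) coeff_Laurent_central[OF assms(1)] by simp
  have "(\<lambda>n. (1 / 4) ^ l * (- 1 / 16) ^ k * (real n * Q n k0 xs)) \<longlonglongrightarrow> (1 / 4) ^ l * (- 1 / 16) ^ k * q1_value (int k0) xs"
    by (intro tendsto_mult_left Q_tendsto_first_order k0 nz assms(3) \<beta>0)
  also have "(1 / 4) ^ l * (- 1 / 16) ^ k * q1_value (int k0) xs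
      = (-1) ^ k * (real \<beta> / 2 - 1) * (fact (l + k - 2) / ((4 * real \<beta>) ^ k * (4 * real \<beta>) ^ l)) * ?S"
  proof -
    define N where "N = l + k - 2"
    have N: "length xs = Suc N" "l + k = N + 2"
      using len by (auto simp: N_def)
    have sgn: "(-1 :: real) ^ N = (-1) ^ k"
    proof -
      have "(-1 :: real) ^ (N + 2) = (-1) ^ k"
        unfolding N(2)[symmetric] using assms(1) by (simp add: power_add)
      then show ?thesis by simp
    qed
    have q: "q1_value (int k0) xs = - 2 * jacobi_ensemble.\<rho> \<beta> * (-1) ^ k * fact N / real \<beta> ^ Suc N * (2 ^ k * ((-2) ^ k * ?S / 2))"
      unfolding q1_value_def E N diff_Suc_1 sgn using prod by (simp add: mult_ac)
    have r: "- 2 * jacobi_ensemble.\<rho> \<beta> = 2 * (real \<beta> / 2 - 1) / real \<beta>"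
      using \<beta>0 by (simp add: \<rho>_eq field_simps)
    have pw: "(1 / 4) ^ l * (- 1 / 16) ^ k * (1 / real \<beta> ^ (N + 2) * (2 ^ k * (-2) ^ k)) = 1 / ((4 * real \<beta>) ^ k * (4 * real \<beta>) ^ l)"
    proof -
      have e1: "(- 1 / 16 :: real) ^ k * (2 ^ k * (-2) ^ k) = (1 / 4) ^ k"
        by (simp flip: power_mult_distrib)
      have e2: "1 / real \<beta> ^ (N + 2) = (1 / real \<beta>) ^ l * (1 / real \<beta>) ^ k"
        unfolding N(2)[symmetric] by (simp add: power_add power_one_over)
      have "(1 / 4) ^ l * (- 1 / 16) ^ k * (1 / real \<beta> ^ (N + 2) * (2 ^ k * (-2) ^ k))
          = ((1 / 4) ^ l * (1 / real \<beta>) ^ l) * (((- 1 / 16) ^ k * (2 ^ k * (-2) ^ k)) * (1 / real \<beta>) ^ k)"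
        unfolding e2 by (simp only: mult_ac)
      also have "\<dots> = ((1 / 4) ^ l * (1 / real \<beta>) ^ l) * ((1 / 4) ^ k * (1 / real \<beta>) ^ k)"
        unfolding e1 ..
      also have "\<dots> = (1 / (4 * real \<beta>)) ^ l * (1 / (4 * real \<beta>)) ^ k"
        by (simp flip: power_mult_distrib)
      finally show ?thesis
        by (simp add: power_one_over mult.commute)
    qed
    have "(1 / 4) ^ l * (- 1 / 16) ^ k * q1_value (int k0) xs
        = (-1) ^ k * (real \<beta> / 2 - 1) * (fact N * ((1 / 4) ^ l * (- 1 / 16) ^ k * (1 / real \<beta> ^ (N + 2) * (2 ^ k * (-2) ^ k)))) * ?S"
    proof -
      have alg: "x * (2 * t / c * s * f / d * (p * (m * S / 2))) = s * t * (f * (x * (1 / (c * d) * (p * m)))) * S"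
        if "c \<noteq> 0" "d \<noteq> 0" for x t c s f d p m S :: real
        using that by (simp add: field_simps)
      have e: "real \<beta> ^ (N + 2) = real \<beta> * real \<beta> ^ Suc N"
        by simp
      show ?thesis
        unfolding q r e by (rule alg) (use \<beta>0 in auto)
    qed
    then show ?thesis
      unfolding pw N_def[symmetric] by simp
  qed
  finally show ?thesis .
qed

text \<open>The excluded pairs are those with l even and l + k \<le> 2. All others leave at least
  two entries beside the distinguished one, which is x_2 when l = 0, so the order 0 is
  absent.\<close>

theorem joint_cumulant_even:
  assumes "even l" "(l, k) \<notin> {(0, 0), (0, 1), (0, 2), (2, 0)}"
  shows "(\<lambda>n. real n ^ (l + k - 1) * joint_cumulant \<beta> \<delta> a n l k) \<longlonglongrightarrow>
    (-1) ^ k * (real \<beta> / 2 - 1) * (fact (l + k - 2) / ((4 * real \<beta>) ^ k * (4 * real \<beta>) ^ l))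
      * (\<Sum>j=0..k. real ((2 * j + l) choose (j + l div 2)) * real (k choose j) * (-2) powi (- int j))"
proof (cases l)
  case 0
  then have k3: "k \<ge> 3"
    using assms(2) by auto
  then obtain k' where k: "k = Suc k'" "k' \<ge> 2"
    by (cases k) auto
  have "(\<lambda>n. (1 / 4) ^ l * (- 1 / 16) ^ k * (real n * Q n 2 (replicate k' 2))) \<longlonglongrightarrow>
    (-1) ^ k * (real \<beta> / 2 - 1) * (fact (l + k - 2) / ((4 * real \<beta>) ^ k * (4 * real \<beta>) ^ l))
      * (\<Sum>j=0..k. real ((2 * j + l) choose (j + l div 2)) * real (k choose j) * (-2) powi (- int j))"
    by (rule first_order_limit[OF assms(1)]) (use 0 k in auto)
  then show ?thesis
  proof (rule Lim_transform_eventually)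
    show "\<forall>\<^sub>F n in sequentially. (1 / 4) ^ l * (- 1 / 16) ^ k * (real n * Q n 2 (replicate k' 2))
        = real n ^ (l + k - 1) * joint_cumulant \<beta> \<delta> a n l k"
      by (rule eventually_mono[OF eventually_ge_at_top[of 1]])
        (use joint_cumulant_scaled_0[of _ k'] k 0 in simp)
  qed
next
  case (Suc l')
  have lk: "l' + k \<ge> 2"
    using assms Suc by (cases k; cases "k - 1"; cases l') auto
  have "(\<lambda>n. (1 / 4) ^ l * (- 1 / 16) ^ k * (real n * Q n 1 (replicate l' 1 @ replicate k 2))) \<longlonglongrightarrow>
    (-1) ^ k * (real \<beta> / 2 - 1) * (fact (l + k - 2) / ((4 * real \<beta>) ^ k * (4 * real \<beta>) ^ l))
      * (\<Sum>j=0..k. real ((2 * j + l) choose (j + l div 2)) * real (k choose j) * (-2) powi (- int j))"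
    by (rule first_order_limit[OF assms(1)]) (use Suc lk in auto)
  then show ?thesis
  proof (rule Lim_transform_eventually)
    show "\<forall>\<^sub>F n in sequentially. (1 / 4) ^ l * (- 1 / 16) ^ k * (real n * Q n 1 (replicate l' 1 @ replicate k 2))
        = real n ^ (l + k - 1) * joint_cumulant \<beta> \<delta> a n l k"
      by (rule eventually_mono[OF eventually_ge_at_top[of 1]])
        (use joint_cumulant_scaled[of _ l' k] lk Suc in simp)
  qed
qed

end

theorem theorem2p1:
  fixes \<beta> C :: nat and \<delta> :: int and \<alpha> :: real
  assumes "\<beta> \<in> {1, 4}"
    and "(\<beta>, \<delta>) \<in> symmetry_pairs"
    and "\<And>n. n \<ge> 1 \<Longrightarrow> channel_exponent \<beta> (n + C) n = \<alpha>"
  shows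
    "(\<forall>l k. odd l \<and> (l, k) \<noteq> (1, 0) \<longrightarrow>
      (\<lambda>n. real n ^ (l + k) * joint_cumulant \<beta> \<delta> \<alpha> n l k) \<longlonglongrightarrow>
        (of_int \<delta> / 2 - \<alpha>) * (\<alpha> + of_int \<delta> / 2 + 2 - real \<beta>)
        * (fact (k + l - 1) / (real \<beta> * (2 * real \<beta>) ^ l * (4 * real \<beta>) ^ k)))
     \<and>
     (\<forall>l k. even l \<and> (l, k) \<notin> {(0, 0), (0, 1), (0, 2), (2, 0)} \<longrightarrow>
      (\<lambda>n. real n ^ (l + k - 1) * joint_cumulant \<beta> \<delta> \<alpha> n l k) \<longlonglongrightarrow>
        (-1) ^ k * (real \<beta> / 2 - 1)
        * (fact (l + k - 2) / ((4 * real \<beta>) ^ k * (4 * real \<beta>) ^ l))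
        * (\<Sum>j=0..k. real ((2 * j + l) choose (j + l div 2)) * real (k choose j)
                       * (-2) powi (- int j)))"
proof -
  \<comment> \<open>With m = n + C the exponent is at least \<beta>/2 - 1, so the weight is
    integrable at 0.\<close>
  have "\<alpha> = real \<beta> / 2 * (real C + 1) - 1"
    using assms(3)[of 1] by (simp add: channel_exponent_def)
  moreover have "real \<beta> / 2 * (real C + 1) > 0"
    using assms(1) by (intro mult_pos_pos) auto
  ultimately have \<alpha>: "\<alpha> > -1"
    by linarith
  \<comment> \<open>Every admissible \<delta> is at least -1, so the weight is integrable at
    1.\<close>
  have \<delta>: "of_int \<delta> / 2 > (-1 :: real)"
    using assms(2) by (auto simp: symmetry_pairs_def)
  interpret jacobi_family \<beta> \<alpha> "of_int \<delta> / 2" \<delta>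
    using assms(1) \<alpha> \<delta> by unfold_locales auto
  show ?thesis
    using joint_cumulant_odd joint_cumulant_even by blast
qed

end
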